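(* Let $p$ be a prime, let $K$ be a finite extension of $\mathbb{Q}_p$ contained in $\bar{\mathbb{Q}}_p$, with valuation ring $\mathcal{O}_K$, maximal ideal $\mathcal{P}_K$ and residue field of cardinality $q$. Let $n\ge1$ and let $\pi,\pi'$ be uniformising parameters of $\mathcal{O}_K$ with $\pi\equiv\pi'\bmod\mathcal{P}_K^{n+1}$. Let $P,Q\in\mathcal{O}_K[[X]]$ be Lubin-Tate series with respect to $\pi$ and $\pi'$ respectively, and let $\{\omega_i\}_{i>0}$ be a coherent set of roots associated to $Q$. For $m\ge1$ let $$\mathcal{E}^{Q}_{P,m}(X)=\exp_{F_P}\left(\sum_{i=0}^{m-1}\frac{\omega_{m-i}\,(X^{q^i}-X^{q^{i+1}})}{\pi^i}\right).$$ For $0\le i\le n-1$ let $z_i\in\mu_{q-1}\cup\{0\}$, with $z_0\neq0$. Then $$\Big[\sum_{i=0}^{n-1}z_i\pi^i\Big]_P\big(\mathcal{E}^{Q}_{P,n}(1)\big)=\mathcal{E}^{Q}_{P,n}(z_0)+_{F_P}\mathcal{E}^{Q}_{P,n-1}(z_1)+_{F_P}\cdots+_{F_P}\mathcal{E}^{Q}_{P,1}(z_{n-1}).$$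
   Context: $\bar{\mathbb{Q}}_p$ is a fixed algebraic closure of $\mathbb{Q}_p$, $\mathbb{C}_p$ its completion, and $v_p$ the valuation on $\mathbb{C}_p$ with $v_p(p)=1$. $\mu_{q-1}$ is the group of $(q-1)$th roots of unity in $\bar{\mathbb{Q}}_p^\times$ (it is contained in $\mathcal{O}_K$). Lubin-Tate series: $P\in\mathcal{O}_K[[X]]$ is a Lubin-Tate series with respect to the uniformising parameter $\pi$ if $P(X)\equiv \pi X \bmod X^2\mathcal{O}_K[[X]]$ and $P(X)\equiv X^q\bmod \pi\mathcal{O}_K[[X]]$. $F_P(X,Y)\in\mathcal{O}_K[[X,Y]]$ is the unique one-dimensional commutative formal group with $P(F_P(X,Y))=F_P(P(X),P(Y))$, and $\exp_{F_P}\in XK[[X]]$ is the unique power series with $\exp_{F_P}(X)\equiv X\bmod X^2K[[X]]$ and $\exp_{F_P}(X+Y)=F_P(\exp_{F_P}(X),\exp_{F_P}(Y))$. For $x,y\in\mathbb{C}_p$ of strictly positive valuation, $x+_{F_P}y:=F_P(x,y)$. For $a\in\mathcal{O}_K$, $[a]_P(X)\in X\mathcal{O}_K[[X]]$ is the unique power series with $[a]_P(X)\equiv aX\bmod X^2\mathcal{O}_K[[X]]$ and $P([a]_P(X))=[a]_P(P(X))$; it converges at every element of $\mathbb{C}_p$ of strictly positive valuation. Coherent set of roots associated to $Q$: a sequence $\{\omega_i\}_{i>0}$ of elements of $\bar{\mathbb{Q}}_p$ with $v_p(\omega_i)>0$, such that $\omega_1\neq0$, $Q(\omega_1)=0$ and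 $Q(\omega_{i+1})=\omega_i$ for all $i\ge1$. $\mathcal{E}^{Q}_{P,m}(z)$ denotes the value at $X=z$ of the power series $\mathcal{E}^{Q}_{P,m}(X)$ expanded in powers of $X$; for $1\le m\le n$ this series has coefficients in $\mathcal{O}_K[\omega_m]$, converges on $\{x\in\mathbb{C}_p:v_p(x)>c\}$ for some $c<0$, and its values at $x$ with $v_p(x)\ge0$ have strictly positive valuation. *)

theory Defs
  imports
    "HOL-Library.Extended_Real"
    "HOL-Computational_Algebra.Computational_Algebra"
begin

unbundle fps_syntax

section \<open>The valued field of p-adic complex numbers\<close>

definition is_valuation :: "('a::field \<Rightarrow> ereal) \<Rightarrow> bool" where
  "is_valuation v \<longleftrightarrow>
     (\<forall>x. v x \<noteq> -\<infinity>) \<and> (\<forall>x. v x = \<infinity> \<longleftrightarrow> x = 0) \<and>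
     (\<forall>x y. v (x * y) = v x + v y) \<and> (\<forall>x y. min (v x) (v y) \<le> v (x + y))"

definition val_tendsto :: "('a::field \<Rightarrow> ereal) \<Rightarrow> (nat \<Rightarrow> 'a) \<Rightarrow> 'a \<Rightarrow> bool" where
  "val_tendsto v s L \<longleftrightarrow> ((\<lambda>n. v (s n - L)) \<longlongrightarrow> \<infinity>) sequentially"

definition val_Cauchy :: "('a::field \<Rightarrow> ereal) \<Rightarrow> (nat \<Rightarrow> 'a) \<Rightarrow> bool" where
  "val_Cauchy v s \<longleftrightarrow> (\<forall>C::real. \<exists>N. \<forall>m\<ge>N. \<forall>n\<ge>N. ereal C < v (s m - s n))"

text \<open>
  Inside a complete field whose valuation restricts to the \<open>p\<close>-adic one on the
  prime field, the closure of the rationals is (a copy of) the field of \<open>p\<close>-adic numbers.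
\<close>

definition Qp :: "('a::field_char_0 \<Rightarrow> ereal) \<Rightarrow> 'a set" where
  "Qp v = {x. \<exists>s. (\<forall>n. s n \<in> \<rat>) \<and> val_tendsto v s x}"

definition Qp_bar :: "('a::field_char_0 \<Rightarrow> ereal) \<Rightarrow> 'a set" where
  "Qp_bar v = {x. \<exists>f. f \<noteq> 0 \<and> (\<forall>i. coeff f i \<in> Qp v) \<and> poly f x = 0}"

text \<open>
  The type \<open>'a\<close>, valued by \<open>v\<close>, is the completion of an algebraic closure of the
  \<open>p\<close>-adic numbers. The conditions determine \<open>('a, v)\<close> up to isometric
  isomorphism. That \<open>v\<close> is the \<open>p\<close>-adic valuation on the rationals follows from
  \<open>v p = 1\<close>.
\<close>

definition is_Cp :: "nat \<Rightarrow> ('a::field_char_0 \<Rightarrow> ereal) \<Rightarrow> bool" where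
  "is_Cp p v \<longleftrightarrow>
     is_valuation v \<and> v (of_nat p) = 1 \<and>
     (\<forall>s. val_Cauchy v s \<longrightarrow> (\<exists>L. val_tendsto v s L)) \<and>
     (\<forall>f. degree f > 0 \<and> (\<forall>i. coeff f i \<in> Qp_bar v) \<longrightarrow> (\<exists>x\<in>Qp_bar v. poly f x = 0)) \<and>
     (\<forall>x. \<exists>s. (\<forall>n. s n \<in> Qp_bar v) \<and> val_tendsto v s x)"

section \<open>Finite extensions of the p-adic numbers\<close>

definition is_subfield :: "'a::field set \<Rightarrow> bool" where
  "is_subfield K \<longleftrightarrow>
     0 \<in> K \<and> 1 \<in> K \<and> (\<forall>x\<in>K. \<forall>y\<in>K. x - y \<in> K \<and> x * y \<in> K) \<and> (\<forall>x\<in>K. inverse x \<in> K)"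

definition finite_ext_Qp :: "('a::field_char_0 \<Rightarrow> ereal) \<Rightarrow> 'a set \<Rightarrow> bool" where
  "finite_ext_Qp v K \<longleftrightarrow>
     is_subfield K \<and> Qp v \<subseteq> K \<and> K \<subseteq> Qp_bar v \<and>
     (\<exists>B. finite B \<and> B \<subseteq> K \<and>
        (\<forall>x\<in>K. \<exists>c. (\<forall>b\<in>B. c b \<in> Qp v) \<and> x = (\<Sum>b\<in>B. c b * b)))"

definition val_ring :: "('a::field \<Rightarrow> ereal) \<Rightarrow> 'a set \<Rightarrow> 'a set" where
  "val_ring v K = {x \<in> K. 0 \<le> v x}"

definition max_ideal :: "('a::field \<Rightarrow> ereal) \<Rightarrow> 'a set \<Rightarrow> 'a set" where
  "max_ideal v K = {x \<in> K. 0 < v x}"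

definition residue_field :: "('a::field \<Rightarrow> ereal) \<Rightarrow> 'a set \<Rightarrow> 'a set set" where
  "residue_field v K =
     val_ring v K // {(x, y). x \<in> val_ring v K \<and> y \<in> val_ring v K \<and> x - y \<in> max_ideal v K}"

definition uniformiser :: "('a::field \<Rightarrow> ereal) \<Rightarrow> 'a set \<Rightarrow> 'a \<Rightarrow> bool" where
  "uniformiser v K \<pi> \<longleftrightarrow> \<pi> \<in> val_ring v K \<and> max_ideal v K = (\<lambda>x. \<pi> * x) ` val_ring v K"

inductive_set ideal_mult :: "'a::comm_ring_1 set \<Rightarrow> 'a set \<Rightarrow> 'a set"
  for I J :: "'a set" where
  zero: "0 \<in> ideal_mult I J"
| add_prod: "x \<in> ideal_mult I J \<Longrightarrow> a \<in> I \<Longrightarrow> b \<in> J \<Longrightarrow> x + a * b \<in> ideal_mult I J"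

text \<open>The zeroth power of an ideal is the ambient ring \<open>R\<close>.\<close>

primrec ideal_pow :: "'a::comm_ring_1 set \<Rightarrow> 'a set \<Rightarrow> nat \<Rightarrow> 'a set" where
  "ideal_pow R I 0 = R"
| "ideal_pow R I (Suc k) = ideal_mult I (ideal_pow R I k)"

definition mu :: "('a::field_char_0 \<Rightarrow> ereal) \<Rightarrow> nat \<Rightarrow> 'a set" where
  "mu v k = {z \<in> Qp_bar v. z ^ k = 1}"

section \<open>Power series\<close>

definition fps_over :: "'a::zero set \<Rightarrow> 'a fps set" where
  "fps_over S = {f. \<forall>n. f $ n \<in> S}"

text \<open>
  A series \<open>F\<close> in two variables is an element of \<open>'a fps fps\<close>: the coefficient of
  \<open>X^i Y^j\<close> is \<open>F $ i $ j\<close>.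
\<close>

definition fps2_over :: "'a::zero set \<Rightarrow> 'a fps fps set" where
  "fps2_over S = {F. \<forall>i j. F $ i $ j \<in> S}"

definition fps_value :: "('a::field \<Rightarrow> ereal) \<Rightarrow> 'a fps \<Rightarrow> 'a \<Rightarrow> 'a" where
  "fps_value v f x = (THE L. val_tendsto v (\<lambda>N. \<Sum>i<N. f $ i * x ^ i) L)"

definition fps2_value :: "('a::field \<Rightarrow> ereal) \<Rightarrow> 'a fps fps \<Rightarrow> 'a \<Rightarrow> 'a \<Rightarrow> 'a" where
  "fps2_value v F x y =
     (THE L. val_tendsto v (\<lambda>N. \<Sum>i<N. \<Sum>j<N. F $ i $ j * x ^ i * y ^ j) L)"

text \<open>
  Formal identities in up to three variables \<open>X, Y, Z\<close> are stated in \<open>'a fps fps fps\<close>.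
  The library composition \<open>oo\<close> only handles series without constant term in the
  outermost variable, hence the following substitutions. For \<open>A\<close>, \<open>B\<close> with zero constant
  term, \<open>A^r\<close> and \<open>A^r * B^s\<close> have no terms of total degree below \<open>r\<close> and \<open>r + s\<close>,
  so the coefficient of \<open>X^i Y^j Z^k\<close> in \<open>f(A)\<close> and \<open>F(A, B)\<close> is the finite sum given
  here.
\<close>

definition varX :: "'a::comm_ring_1 fps fps fps" where "varX = fps_X"
definition varY :: "'a::comm_ring_1 fps fps fps" where "varY = fps_const fps_X"
definition varZ :: "'a::comm_ring_1 fps fps fps" where "varZ = fps_const (fps_const fps_X)"

definition subst1 :: "'a::comm_ring_1 fps \<Rightarrow> 'a fps fps fps \<Rightarrow> 'a fps fps fps" where
  "subst1 f A = Abs_fps (\<lambda>i. Abs_fps (\<lambda>j. Abs_fps (\<lambda>k.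
     \<Sum>r\<le>i + j + k. f $ r * (A ^ r) $ i $ j $ k)))"

definition subst2 ::
  "'a::comm_ring_1 fps fps \<Rightarrow> 'a fps fps fps \<Rightarrow> 'a fps fps fps \<Rightarrow> 'a fps fps fps" where
  "subst2 F A B = Abs_fps (\<lambda>i. Abs_fps (\<lambda>j. Abs_fps (\<lambda>k.
     \<Sum>(r, s)\<in>{(r, s). r + s \<le> i + j + k}. F $ r $ s * (A ^ r * B ^ s) $ i $ j $ k)))"

section \<open>Lubin-Tate series and formal groups\<close>

definition lubin_tate_series ::
  "('a::field \<Rightarrow> ereal) \<Rightarrow> 'a set \<Rightarrow> 'a \<Rightarrow> 'a fps \<Rightarrow> bool" where
  "lubin_tate_series v K \<pi> P \<longleftrightarrow>
     P \<in> fps_over (val_ring v K) \<and>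
     (\<exists>R\<in>fps_over (val_ring v K). P - fps_const \<pi> * fps_X = fps_X ^ 2 * R) \<and>
     (\<exists>R\<in>fps_over (val_ring v K).
        P - fps_X ^ card (residue_field v K) = fps_const \<pi> * R)"

definition comm_formal_group :: "'a::comm_ring_1 set \<Rightarrow> 'a fps fps \<Rightarrow> bool" where
  "comm_formal_group R F \<longleftrightarrow>
     F \<in> fps2_over R \<and>
     F $ 0 $ 0 = 0 \<and> F $ 1 $ 0 = 1 \<and> F $ 0 $ 1 = 1 \<and>
     subst2 F varX (subst2 F varY varZ) = subst2 F (subst2 F varX varY) varZ \<and>
     subst2 F varX varY = subst2 F varY varX"

definition lt_formal_group :: "('a::field \<Rightarrow> ereal) \<Rightarrow> 'a set \<Rightarrow> 'a fps \<Rightarrow> 'a fps fps" where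
  "lt_formal_group v K P =
     (THE F. comm_formal_group (val_ring v K) F \<and>
        subst1 P (subst2 F varX varY) = subst2 F (subst1 P varX) (subst1 P varY))"

definition fg_exp :: "'a::field set \<Rightarrow> 'a fps fps \<Rightarrow> 'a fps" where
  "fg_exp K F =
     (THE e. e \<in> fps_over K \<and> e $ 0 = 0 \<and> e $ 1 = 1 \<and>
        subst1 e (varX + varY) = subst2 F (subst1 e varX) (subst1 e varY))"

definition lt_mult :: "('a::field \<Rightarrow> ereal) \<Rightarrow> 'a set \<Rightarrow> 'a fps \<Rightarrow> 'a \<Rightarrow> 'a fps" where
  "lt_mult v K P a =
     (THE A. A \<in> fps_over (val_ring v K) \<and> A $ 0 = 0 \<and> A $ 1 = a \<and> P oo A = A oo P)"

definition coherent_roots ::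
  "('a::field_char_0 \<Rightarrow> ereal) \<Rightarrow> 'a fps \<Rightarrow> (nat \<Rightarrow> 'a) \<Rightarrow> bool" where
  "coherent_roots v Q \<omega> \<longleftrightarrow>
     (\<forall>i\<ge>1. \<omega> i \<in> Qp_bar v \<and> 0 < v (\<omega> i)) \<and>
     \<omega> 1 \<noteq> 0 \<and> fps_value v Q (\<omega> 1) = 0 \<and>
     (\<forall>i\<ge>1. fps_value v Q (\<omega> (i + 1)) = \<omega> i)"

text \<open>
  The series depends on \<open>Q\<close> only through the coherent set of roots \<open>\<omega>\<close>, of which
  \<open>\<omega> 1, \<dots>, \<omega> m\<close> are used.
\<close>

definition E_series ::
  "('a::field \<Rightarrow> ereal) \<Rightarrow> 'a set \<Rightarrow> 'a \<Rightarrow> 'a fps \<Rightarrow> (nat \<Rightarrow> 'a) \<Rightarrow> nat \<Rightarrow> 'a fps" where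
  "E_series v K \<pi> P \<omega> m =
     (let q = card (residue_field v K) in
      fg_exp K (lt_formal_group v K P) oo
        (\<Sum>i<m. fps_const (\<omega> (m - i) / \<pi> ^ i) * (fps_X ^ (q ^ i) - fps_X ^ (q ^ (i + 1)))))"

end

theory Submission
  imports Defs
begin

text \<open>
  Write \<open>exp\<^sub>P\<close> and \<open>log\<^sub>P\<close> for the exponential and logarithm of \<open>F\<^sub>P\<close>. Since the given congruence makes
  \<open>Q + ((\<pi> - \<pi>') / \<pi>'^n) Q\<^sup>n\<close> (with \<open>Q\<^sup>n\<close> the \<open>n\<close>-fold iterate) a Lubin-Tate series for \<open>\<pi>\<close> with the same
  coherent roots up to \<open>\<omega>\<^sub>n\<close>, one may assume \<open>\<pi> = \<pi>'\<close>. Replace \<open>\<omega>\<^sub>m\<close> by a variable \<open>T\<close> and put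
  \<open>A(T, X) = \<Sum>\<^sub>i Q\<^sup>i(T) (X^(q^i) - X^(q^(i+1))) / \<pi>^i\<close>. For the Frobenius lift \<open>\<sigma>\<close> given by \<open>T \<mapsto> Q(T)\<close>,
  \<open>X \<mapsto> X^q\<close>, the series \<open>A - \<sigma>(A) / \<pi> = T (X - X^q)\<close> is integral, so \<open>exp\<^sub>P(A)\<close> is integral by
  Hazewinkel's functional equation lemma. As \<open>Q\<^sup>i(T) / \<pi>^i\<close> tends to \<open>log\<^sub>Q(T)\<close>, the coefficient of each
  power of \<open>T\<close> in \<open>exp\<^sub>P(A)\<close> converges on the closed unit disc in \<open>X\<close>, and telescoping gives
  \<open>A(T, z) = z log\<^sub>Q(T)\<close> whenever \<open>z^q = z\<close>. Hence the value of the \<open>m\<close>-th series at \<open>z\<close> is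
  \<open>exp\<^sub>P(z log\<^sub>Q(T))\<close> at \<open>T = \<omega>\<^sub>m\<close>, an integral series in \<open>T\<close>, and \<open>Q\<^sup>i(\<omega>\<^sub>n) = \<omega>\<^bsub>n-i\<^esub>\<close> turns both sides of the
  theorem into the value of \<open>exp\<^sub>P((\<Sum>\<^sub>i z\<^sub>i \<pi>^i) log\<^sub>Q(T))\<close> at \<open>\<omega>\<^sub>n\<close>.
\<close>

section \<open>Power series over subrings\<close>

text \<open>For z^q = z the polynomial inside \<open>exp P\<close> in the m-th series vanishes at z,
  yet the value of the series at z is in general not \<open>exp P\<close> at 0: evaluation does not
  commute with a composition whose coefficients have denominators. Hence \<open>exp P\<close> is
  never evaluated at a point. Each composition with it is formed between formal series and shown to
  be integral, and only the result is evaluated. With T kept as a variable, integrality makes the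
  double family over X^k T^d summable, and its two orders of summation give the two descriptions of
  the value. Integrality is proved for one comparison logarithm \<open>l0\<close>, the sum of
  X^(q^i) / \<pi>^i, whose recursion l0(x) = x + l0(x^q) / \<pi> exposes a single q-th power;
  integral substitutions carry the result to every P. Since q is given only as the number of residue
  classes, the congruences a^q = a and (q choose i) = 0 modulo \<pi> come from counting classes, and
  closedness of K places the roots of unity in the ring.\<close>

definition subring :: "'a::comm_ring_1 set \<Rightarrow> bool" where
  "subring A \<longleftrightarrow> 0 \<in> A \<and> 1 \<in> A \<and> (\<forall>x\<in>A. \<forall>y\<in>A. x + y \<in> A \<and> x * y \<in> A) \<and> (\<forall>x\<in>A. - x \<in> A)"

lemma
  assumes "subring A"
  shows subring_0: "0 \<in> A" and subring_1: "1 \<in> A"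
    and subring_add: "x \<in> A \<Longrightarrow> y \<in> A \<Longrightarrow> x + y \<in> A"
    and subring_mult: "x \<in> A \<Longrightarrow> y \<in> A \<Longrightarrow> x * y \<in> A"
    and subring_minus: "x \<in> A \<Longrightarrow> - x \<in> A"
  using assms by (auto simp: subring_def)

lemma subring_diff: "subring A \<Longrightarrow> x \<in> A \<Longrightarrow> y \<in> A \<Longrightarrow> x - y \<in> A"
  using subring_add[of A x "- y"] subring_minus[of A y] by simp

lemma subring_power: "subring A \<Longrightarrow> x \<in> A \<Longrightarrow> x ^ n \<in> A"
  by (induction n) (auto intro: subring_1 subring_mult)

lemma subring_sum: "subring A \<Longrightarrow> (\<And>i. i \<in> I \<Longrightarrow> f i \<in> A) \<Longrightarrow> sum f I \<in> A"
  by (induction I rule: infinite_finite_induct) (auto intro: subring_0 subring_add)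

lemma subring_of_nat: "subring A \<Longrightarrow> of_nat n \<in> A"
  by (induction n) (auto intro: subring_0 subring_1 subring_add)

lemma subring_UNIV: "subring UNIV"
  by (simp add: subring_def)

lemmas subring_closed = subring_0 subring_1 subring_add subring_mult subring_minus subring_diff
  subring_power subring_sum subring_of_nat

lemma fps_overI: "(\<And>n. f $ n \<in> A) \<Longrightarrow> f \<in> fps_over A"
  by (simp add: fps_over_def)

lemma fps_overD: "f \<in> fps_over A \<Longrightarrow> f $ n \<in> A"
  by (simp add: fps_over_def)

lemma subring_fps_over:
  assumes "subring A"
  shows "subring (fps_over A)"
  unfolding subring_def fps_over_def
  using assms by (auto simp: fps_mult_nth fps_one_nth intro!: subring_closed)

lemma fps_over_const: "subring A \<Longrightarrow> c \<in> A \<Longrightarrow> fps_const c \<in> fps_over A"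
  by (auto simp: fps_over_def fps_const_def intro: subring_0)

lemma fps_over_X: "subring A \<Longrightarrow> fps_X \<in> fps_over A"
  by (auto simp: fps_over_def fps_X_def intro: subring_0 subring_1)

lemma fps_over_compose:
  assumes "subring A" "f \<in> fps_over A" "g \<in> fps_over A"
  shows "f oo g \<in> fps_over A"
proof (rule fps_overI)
  fix n
  have "g ^ i \<in> fps_over A" for i
    using assms by (intro subring_power subring_fps_over)
  then show "(f oo g) $ n \<in> A"
    using assms by (auto simp: fps_compose_nth intro!: subring_closed dest: fps_overD)
qed

text \<open>The recursion for the compositional inverse divides only by powers of
  \<open>f $ 1\<close>, so inverting that one coefficient inside \<open>A\<close> is enough.\<close>

lemma fps_over_inv:
  fixes f :: "'a::field fps"
  assumes A: "subring A" and f: "f \<in> fps_over A" and f1: "inverse (f $ 1) \<in> A"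
  shows "fps_inv f \<in> fps_over A"
proof (rule fps_overI)
  fix n
  have pow: "f ^ i \<in> fps_over A" for i
    using A f by (intro subring_power subring_fps_over)
  have "compinv f n \<in> A"
  proof (induction n rule: less_induct)
    case (less n)
    show ?case
    proof (cases n)
      case 0
      then show ?thesis using A by (simp add: subring_0)
    next
      case (Suc m)
      have "fps_X $ Suc m - (\<Sum>i = 0..m. compinv f i * (f ^ i) $ Suc m) \<in> A"
        using less Suc pow A
        by (intro subring_diff subring_sum subring_mult) (auto dest: fps_overD simp: subring_0 subring_1)
      moreover have "inverse (f $ 1) ^ Suc m \<in> A"
        using A f1 by (rule subring_power)
      ultimately show ?thesis
        unfolding Suc compinv.simps divide_inverse power_inverse[symmetric] by (rule subring_mult[OF A])
    qed
  qed
  then show "fps_inv f $ n \<in> A"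
    by (simp add: fps_inv_def)
qed

text \<open>Homomorphisms are relative to a subring \<open>D\<close> because evaluation at a point
  is additive and multiplicative only on the convergent series.\<close>

definition hom_on :: "'a::comm_ring_1 set \<Rightarrow> ('a \<Rightarrow> 'b::comm_ring_1) \<Rightarrow> bool" where
  "hom_on D h \<longleftrightarrow> subring D \<and> h 1 = 1 \<and>
     (\<forall>x\<in>D. \<forall>y\<in>D. h (x + y) = h x + h y \<and> h (x * y) = h x * h y)"

lemma
  assumes "hom_on D h"
  shows hom_on_subring: "subring D"
    and hom_on_1: "h 1 = 1"
    and hom_on_add: "x \<in> D \<Longrightarrow> y \<in> D \<Longrightarrow> h (x + y) = h x + h y"
    and hom_on_mult: "x \<in> D \<Longrightarrow> y \<in> D \<Longrightarrow> h (x * y) = h x * h y"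
  using assms by (auto simp: hom_on_def)

lemma hom_on_0: "hom_on D h \<Longrightarrow> h 0 = 0"
  using hom_on_add[of D h 0 0] hom_on_subring[of D h] by (auto simp: subring_0)

lemma hom_on_minus: "hom_on D h \<Longrightarrow> x \<in> D \<Longrightarrow> h (- x) = - h x"
  using hom_on_add[of D h x "- x"] hom_on_0[of D h] hom_on_subring[of D h]
  by (simp add: subring_minus eq_neg_iff_add_eq_0 add.commute)

lemma hom_on_diff: "hom_on D h \<Longrightarrow> x \<in> D \<Longrightarrow> y \<in> D \<Longrightarrow> h (x - y) = h x - h y"
  using hom_on_add[of D h x "- y"] hom_on_minus[of D h y] hom_on_subring[of D h]
  by (simp add: subring_minus)

lemma hom_on_sum:
  assumes "hom_on D h" "\<And>i. i \<in> I \<Longrightarrow> f i \<in> D"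
  shows "h (sum f I) = (\<Sum>i\<in>I. h (f i))"
  using assms(2)
  by (induction I rule: infinite_finite_induct)
    (auto simp: hom_on_0[OF assms(1)] hom_on_add[OF assms(1)] subring_sum[OF hom_on_subring[OF assms(1)]])

definition map_fps :: "('a \<Rightarrow> 'b::zero) \<Rightarrow> 'a::zero fps \<Rightarrow> 'b fps" where
  "map_fps h f = Abs_fps (\<lambda>n. h (f $ n))"

lemma map_fps_nth [simp]: "map_fps h f $ n = h (f $ n)"
  by (simp add: map_fps_def)

lemma map_fps_over: "(\<And>x. x \<in> A \<Longrightarrow> h x \<in> B) \<Longrightarrow> f \<in> fps_over A \<Longrightarrow> map_fps h f \<in> fps_over B"
  by (simp add: fps_over_def)

lemma hom_on_map_fps:
  assumes "hom_on D h"
  shows "hom_on (fps_over D) (map_fps h)"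
proof -
  have D: "subring D" using assms by (rule hom_on_subring)
  have mult: "map_fps h (f * g) = map_fps h f * map_fps h g"
    if "f \<in> fps_over D" "g \<in> fps_over D" for f g
    using that assms D
    by (auto simp: fps_eq_iff fps_mult_nth hom_on_sum[OF assms] hom_on_mult[OF assms] fps_overD subring_mult)
  show ?thesis
    unfolding hom_on_def
    using assms D mult
    by (auto simp: subring_fps_over fps_eq_iff hom_on_add hom_on_0 hom_on_1 fps_overD)
qed

lemma hom_on_power:
  assumes "hom_on D h" "x \<in> D"
  shows "h (x ^ n) = h x ^ n"
  using assms
  by (induction n) (auto simp: hom_on_1 hom_on_mult subring_power hom_on_subring)

lemma map_fps_power:
  assumes "hom_on D h" "f \<in> fps_over D"
  shows "map_fps h (f ^ n) = map_fps h f ^ n"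
  using hom_on_power[OF hom_on_map_fps[OF assms(1)] assms(2)] .

lemma map_fps_compose:
  assumes h: "hom_on D h" and f: "f \<in> fps_over D" and g: "g \<in> fps_over D"
  shows "map_fps h (f oo g) = map_fps h f oo map_fps h g"
proof -
  have D: "subring D" using h by (rule hom_on_subring)
  have pow: "g ^ i \<in> fps_over D" for i
    using D g by (intro subring_power subring_fps_over)
  show ?thesis
    using D f pow
    by (auto simp: fps_eq_iff fps_compose_nth hom_on_sum[OF h] hom_on_mult[OF h] subring_mult fps_overD
        map_fps_power[OF h g, symmetric])
qed

lemma fps_over_UNIV [simp]: "fps_over UNIV = UNIV"
  by (simp add: fps_over_def)

lemma hom_on_const: "hom_on UNIV fps_const"
  by (simp add: hom_on_def subring_UNIV)

text \<open>Convention for series in two variables: T is the outer variable and X the inner one.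
  This is f(T) with constants in X as coefficients.\<close>

abbreviation lift :: "'a::zero fps \<Rightarrow> 'a fps fps" where
  "lift \<equiv> map_fps fps_const"

lemma lift_simps [simp]:
  fixes f g :: "'a::comm_ring_1 fps"
  shows "lift (f + g) = lift f + lift g" "lift (f * g) = lift f * lift g"
    "lift (f - g) = lift f - lift g" "lift (f oo g) = lift f oo lift g" "lift (f ^ n) = lift f ^ n"
    "lift 0 = (0 :: 'a fps fps)" "lift 1 = (1 :: 'a fps fps)"
  using hom_on_map_fps[OF hom_on_const[where 'a='a]] map_fps_compose[OF hom_on_const[where 'a='a]]
  by (auto simp: hom_on_add hom_on_mult hom_on_diff hom_on_power hom_on_0 hom_on_1)

lemma lift_const [simp]: "lift (fps_const c) = fps_const (fps_const c)"
  by (auto simp: fps_eq_iff fps_const_def)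

lemma lift_X [simp]: "lift (fps_X :: 'a::comm_ring_1 fps) = fps_X"
  by (auto simp: fps_eq_iff fps_X_def)

lemma fps_over_lift: "subring A \<Longrightarrow> f \<in> fps_over A \<Longrightarrow> lift f \<in> fps_over (fps_over A)"
  by (rule map_fps_over) (auto intro: fps_over_const)

section \<open>Powers and compositions of series that agree up to a given degree\<close>

lemma fps_power_agree:
  fixes a b :: "'a::comm_ring_1 fps"
  assumes "\<And>m. m < N \<Longrightarrow> a $ m = b $ m" "m < N"
  shows "(a ^ r) $ m = (b ^ r) $ m"
  using assms(2)
proof (induction r arbitrary: m)
  case (Suc r)
  then show ?case
    using assms(1) by (auto simp: fps_mult_nth intro!: sum.cong)
qed auto

text \<open>Without constant terms, coefficient \<open>N\<close> of a power with exponent at least 2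
  involves only coefficients of index below \<open>N\<close>. This drives the inductions on the
  degree.\<close>

lemma fps_power_agree_next:
  fixes a b :: "'a::comm_ring_1 fps"
  assumes "a $ 0 = 0" "b $ 0 = 0" "\<And>m. m < N \<Longrightarrow> a $ m = b $ m" "r \<ge> 2"
  shows "(a ^ r) $ N = (b ^ r) $ N"
proof -
  obtain s where r: "r = Suc s" "s \<ge> 1"
    using assms(4) by (cases r) auto
  have z: "(a ^ s) $ 0 = 0" "(b ^ s) $ 0 = 0"
    using assms r by (auto simp: startsby_zero_power)
  have "a $ i * (a ^ s) $ (N - i) = b $ i * (b ^ s) $ (N - i)" if "i \<le> N" for i
  proof (cases "i = 0 \<or> i = N")
    case False
    then show ?thesis
      using that assms fps_power_agree[of N a b "N - i" s] by simp
  qed (use assms z in auto)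
  then show ?thesis
    by (simp add: r fps_mult_nth)
qed

text \<open>A discrepancy that first occurs at index \<open>N\<close> reaches coefficient
  \<open>N\<close> of the composition only through the linear term of \<open>f\<close>.\<close>

lemma fps_compose_agree_next:
  fixes f a b :: "'a::comm_ring_1 fps"
  assumes "a $ 0 = 0" "b $ 0 = 0" "\<And>m. m < N \<Longrightarrow> a $ m = b $ m"
  shows "(f oo a) $ N - (f oo b) $ N = f $ 1 * (a $ N - b $ N)"
proof -
  have "f $ i * (a ^ i) $ N - f $ i * (b ^ i) $ N = (if i = 1 then f $ 1 * (a $ N - b $ N) else 0)" for i
  proof -
    consider "i = 0" | "i = 1" | "i \<ge> 2" by linarith
    then show ?thesis
    proof cases
      case 3
      have "(a ^ i) $ N = (b ^ i) $ N"
        by (rule fps_power_agree_next) (use assms 3 in auto)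
      then show ?thesis using 3 by simp
    qed (auto simp: algebra_simps)
  qed
  then have "(f oo a) $ N - (f oo b) $ N = (\<Sum>i = 0..N. if i = 1 then f $ 1 * (a $ N - b $ N) else 0)"
    unfolding fps_compose_nth sum_subtractf[symmetric] by (intro sum.cong) auto
  also have "\<dots> = f $ 1 * (a $ N - b $ N)"
    using assms by (cases "N = 0") (auto simp: sum.delta)
  finally show ?thesis .
qed

lemma fps_compose_agree:
  fixes f a b :: "'a::comm_ring_1 fps"
  assumes "\<And>m. m < N \<Longrightarrow> a $ m = b $ m" "m < N"
  shows "(f oo a) $ m = (f oo b) $ m"
  using fps_power_agree[OF assms] by (simp add: fps_compose_nth)

lemma fps_power_nth_eq_0:
  fixes a :: "'a::comm_ring_1 fps"
  shows "a $ 0 = 0 \<Longrightarrow> n < k \<Longrightarrow> (a ^ k) $ n = 0"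
  using startsby_zero_power_prefix[of a k] by blast

section \<open>Frobenius congruences\<close>

definition pmult :: "'a::comm_ring_1 \<Rightarrow> 'a set \<Rightarrow> 'a set" where
  "pmult c A = (\<lambda>x. c * x) ` A"

lemma pmultI: "x \<in> A \<Longrightarrow> c * x \<in> pmult c A"
  by (simp add: pmult_def)

lemma pmultE: "y \<in> pmult c A \<Longrightarrow> (\<And>x. x \<in> A \<Longrightarrow> y = c * x \<Longrightarrow> thesis) \<Longrightarrow> thesis"
  by (auto simp: pmult_def)

lemma
  assumes A: "subring A"
  shows pmult_0: "0 \<in> pmult c A"
    and pmult_add: "x \<in> pmult c A \<Longrightarrow> y \<in> pmult c A \<Longrightarrow> x + y \<in> pmult c A"
    and pmult_minus: "x \<in> pmult c A \<Longrightarrow> - x \<in> pmult c A"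
    and pmult_mult_left: "a \<in> A \<Longrightarrow> x \<in> pmult c A \<Longrightarrow> a * x \<in> pmult c A"
    and pmult_mult_right: "x \<in> pmult c A \<Longrightarrow> a \<in> A \<Longrightarrow> x * a \<in> pmult c A"
    and pmult_subset: "c \<in> A \<Longrightarrow> x \<in> pmult c A \<Longrightarrow> x \<in> A"
proof -
  show "0 \<in> pmult c A"
    using pmultI[OF subring_0[OF A], of c] by simp
  show add: "x + y \<in> pmult c A" if xy: "x \<in> pmult c A" "y \<in> pmult c A" for x y
  proof -
    obtain a b where "a \<in> A" "b \<in> A" "x = c * a" "y = c * b"
      using xy by (auto elim!: pmultE)
    then show ?thesis
      using pmultI[OF subring_add[OF A], of a b c] by (simp add: algebra_simps)
  qed
  show minus: "- x \<in> pmult c A" if x: "x \<in> pmult c A" for x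
  proof -
    obtain a where "a \<in> A" "x = c * a" using x by (rule pmultE)
    then show ?thesis using pmultI[OF subring_minus[OF A], of a c] by simp
  qed
  show left: "a * x \<in> pmult c A" if ax: "a \<in> A" "x \<in> pmult c A" for a x
  proof -
    obtain b where "b \<in> A" "x = c * b" using ax by (auto simp: pmult_def)
    then show ?thesis using pmultI[OF subring_mult[OF A], of a b c] ax by (simp add: ac_simps)
  qed
  show "x * a \<in> pmult c A" if "x \<in> pmult c A" "a \<in> A" for a x
    using left[OF that(2,1)] by (simp add: mult.commute)
  show "x \<in> A" if "c \<in> A" "x \<in> pmult c A"
    using that by (auto elim!: pmultE intro: subring_mult[OF A])
qed

lemma pmult_sum: "subring A \<Longrightarrow> (\<And>i. i \<in> I \<Longrightarrow> f i \<in> pmult c A) \<Longrightarrow> sum f I \<in> pmult c A"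
  by (induction I rule: infinite_finite_induct) (auto intro: pmult_0 pmult_add)

lemma fps_over_pmult: "fps_over (pmult c A) = pmult (fps_const c) (fps_over A)"
proof (intro subset_antisym subsetI)
  fix f assume "f \<in> fps_over (pmult c A)"
  then have "\<forall>n. \<exists>x\<in>A. f $ n = c * x"
    by (auto simp: fps_over_def pmult_def)
  then obtain h where "\<And>n. h n \<in> A \<and> f $ n = c * h n" by metis
  then have "f = fps_const c * Abs_fps h" "Abs_fps h \<in> fps_over A"
    by (auto simp: fps_eq_iff fps_over_def)
  then show "f \<in> pmult (fps_const c) (fps_over A)"
    by (metis pmultI)
next
  fix f assume "f \<in> pmult (fps_const c) (fps_over A)"
  then show "f \<in> fps_over (pmult c A)"
    by (auto elim!: pmultE intro!: pmultI fps_overI dest: fps_overD)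
qed

text \<open>Divisibility of the middle binomial coefficients replaces the assumption that q is a
  power of the residue characteristic. In this form the property passes at once to power series over
  \<open>A\<close>.\<close>

definition frob_ring :: "'a::comm_ring_1 set \<Rightarrow> 'a \<Rightarrow> nat \<Rightarrow> bool" where
  "frob_ring A c q \<longleftrightarrow> subring A \<and> c \<in> A \<and> q \<ge> 2 \<and>
     (\<forall>i. 0 < i \<and> i < q \<longrightarrow> of_nat (q choose i) \<in> pmult c A)"

lemma frob_ring_fps:
  assumes "frob_ring A c q"
  shows "frob_ring (fps_over A) (fps_const c) q"
proof -
  have A: "subring A" using assms by (simp add: frob_ring_def)
  have "fps_const x \<in> fps_over (pmult c A)" if "x \<in> pmult c A" for x
    using that pmult_0[OF A] by (auto simp: fps_over_def fps_const_def)
  then show ?thesis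
    using assms unfolding frob_ring_def fps_over_pmult[symmetric]
    by (auto simp: subring_fps_over fps_over_const fps_of_nat[symmetric])
qed

lemma frobenius_add:
  assumes fr: "frob_ring A c q" and a: "a \<in> A" and b: "b \<in> A"
  shows "(a + b) ^ q - (a ^ q + b ^ q) \<in> pmult c A"
proof -
  have A: "subring A" and q: "q \<ge> 2" using fr by (auto simp: frob_ring_def)
  have "{..q} = insert 0 (insert q {1..<q})" using q by auto
  then have "(a + b) ^ q = b ^ q + (a ^ q + (\<Sum>k\<in>{1..<q}. of_nat (q choose k) * a ^ k * b ^ (q - k)))"
    using q by (simp add: binomial_ring)
  then have "(a + b) ^ q - (a ^ q + b ^ q) = (\<Sum>k\<in>{1..<q}. of_nat (q choose k) * a ^ k * b ^ (q - k))"
    by simp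
  also have "\<dots> \<in> pmult c A"
    using fr a b by (intro pmult_sum A pmult_mult_right subring_power) (auto simp: frob_ring_def)
  finally show ?thesis .
qed

lemma frobenius_sum:
  assumes fr: "frob_ring A c q" and "finite I"
    and "\<And>i. i \<in> I \<Longrightarrow> x i \<in> A" and "\<And>i. i \<in> I \<Longrightarrow> x i ^ q - y i \<in> pmult c A"
  shows "sum x I ^ q - sum y I \<in> pmult c A"
  using assms(2-)
proof (induction I rule: finite_induct)
  case empty
  then show ?case using fr by (simp add: frob_ring_def pmult_0 power_0_left)
next
  case (insert i I)
  have A: "subring A" using fr by (simp add: frob_ring_def)
  have "(x i + sum x I) ^ q - (x i ^ q + sum x I ^ q) \<in> pmult c A"
    using insert A by (intro frobenius_add[OF fr] subring_sum) auto
  moreover have "sum x I ^ q - sum y I \<in> pmult c A" "x i ^ q - y i \<in> pmult c A"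
    using insert by auto
  ultimately have "(x i + sum x I) ^ q - (x i ^ q + sum x I ^ q) + ((sum x I ^ q - sum y I) + (x i ^ q - y i))
      \<in> pmult c A"
    by (intro pmult_add[OF A])
  then show ?case using insert by (simp add: algebra_simps)
qed

text \<open>With x = y + c^j w, each middle term has c^j from the power of c^j w and one more c from
  the binomial coefficient; the last term has c^(j q), and j q >= j + 1. The gained factor later
  cancels a denominator.\<close>

lemma frobenius_cong:
  assumes fr: "frob_ring A c q" and x: "x \<in> A" and y: "y \<in> A"
    and xy: "x - y \<in> pmult (c ^ j) A" and j: "j \<ge> 1"
  shows "x ^ q - y ^ q \<in> pmult (c ^ Suc j) A"
proof -
  have A: "subring A" and q: "q \<ge> 2" and c: "c \<in> A" using fr by (auto simp: frob_ring_def)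
  obtain w where w: "w \<in> A" "x - y = c ^ j * w" using xy by (auto elim: pmultE)
  let ?d = "c ^ j * w"
  have x_eq: "x = ?d + y" using w by (simp add: algebra_simps)
  have "{..q} = insert 0 (insert q {1..<q})" using q by auto
  then have "x ^ q = y ^ q + (?d ^ q + (\<Sum>k\<in>{1..<q}. of_nat (q choose k) * ?d ^ k * y ^ (q - k)))"
    unfolding x_eq using q by (simp add: binomial_ring)
  then have eq: "x ^ q - y ^ q = ?d ^ q + (\<Sum>k\<in>{1..<q}. of_nat (q choose k) * ?d ^ k * y ^ (q - k))"
    by simp
  have "of_nat (q choose k) * ?d ^ k * y ^ (q - k) \<in> pmult (c ^ Suc j) A" if k: "k \<in> {1..<q}" for k
  proof -
    obtain b where b: "b \<in> A" "of_nat (q choose k) = c * b"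
      using fr k by (metis atLeastLessThan_iff frob_ring_def less_le_trans pmultE zero_less_one)
    obtain m where m: "k = Suc m" using k by (cases k) auto
    have "of_nat (q choose k) * ?d ^ k * y ^ (q - k) = c ^ Suc j * (b * w * ?d ^ m * y ^ (q - k))"
      unfolding b(2) by (simp add: m algebra_simps)
    also have "\<dots> \<in> pmult (c ^ Suc j) A"
      using b w c y by (intro pmultI subring_mult[OF A] subring_power[OF A]) auto
    finally show ?thesis .
  qed
  moreover have "?d ^ q \<in> pmult (c ^ Suc j) A"
  proof -
    have "j * q \<ge> j * 2" using q by simp
    then have "Suc j \<le> j * q" using j by linarith
    then obtain t where t: "j * q = Suc j + t" by (rule le_Suc_ex[THEN exE])
    have "?d ^ q = c ^ (j * q) * w ^ q" by (simp add: power_mult_distrib power_mult)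
    also have "\<dots> = c ^ Suc j * (c ^ t * w ^ q)" unfolding t power_add by (simp add: ac_simps)
    also have "\<dots> \<in> pmult (c ^ Suc j) A"
      using w c by (intro pmultI subring_mult[OF A] subring_power[OF A]) auto
    finally show ?thesis .
  qed
  ultimately show ?thesis
    unfolding eq by (intro pmult_add[OF A] pmult_sum[OF A]) auto
qed

lemma pmult_power_diff:
  assumes A: "subring A" and x: "x \<in> A" and y: "y \<in> A" and xy: "x - y \<in> pmult c A"
  shows "x ^ n - y ^ n \<in> pmult c A"
  unfolding power_diff_sumr2[of x n y] using x y xy
  by (intro pmult_mult_right[OF A] subring_sum[OF A] subring_mult[OF A] subring_power[OF A])

text \<open>A Frobenius lift \<open>s\<close> of \<open>A\<close> extends to series by acting on
  coefficients and sending the variable to a series congruent to its q-th power. Only finitely many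
  monomials affect a given coefficient, so additivity of the q-th power modulo \<open>c\<close>
  suffices.\<close>

lemma frobenius_fps:
  assumes fr: "frob_ring A c q"
    and sA: "\<And>a. a \<in> A \<Longrightarrow> s a \<in> A" and s: "\<And>a. a \<in> A \<Longrightarrow> a ^ q - s a \<in> pmult c A"
    and S: "S \<in> fps_over A" "S $ 0 = 0" "S - fps_X ^ q \<in> fps_over (pmult c A)"
    and f: "f \<in> fps_over A"
  shows "f ^ q - (map_fps s f oo S) \<in> pmult (fps_const c) (fps_over A)"
  unfolding fps_over_pmult[symmetric]
proof (rule fps_overI)
  fix n
  let ?B = "fps_over A" and ?c = "fps_const c"
  have A: "subring A" using fr by (simp add: frob_ring_def)
  have B: "subring ?B" using A by (rule subring_fps_over)
  define x where "x = (\<lambda>i. fps_const (f $ i) * fps_X ^ i)"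
  define y where "y = (\<lambda>i. fps_const (s (f $ i)) * S ^ i)"
  have fA: "f $ i \<in> A" for i using f by (rule fps_overD)
  have xB: "x i \<in> ?B" for i
    unfolding x_def using fA by (intro subring_mult[OF B] fps_over_const[OF A] subring_power[OF B] fps_over_X[OF A])
  have "x i ^ q - y i \<in> pmult ?c ?B" for i
  proof -
    have "fps_X ^ q - S \<in> pmult ?c ?B"
      using pmult_minus[OF B S(3)[unfolded fps_over_pmult]] by simp
    then have "(fps_X ^ q) ^ i - S ^ i \<in> pmult ?c ?B"
      using S(1) by (intro pmult_power_diff[OF B] subring_power[OF B] fps_over_X[OF A])
    then have "fps_const (s (f $ i)) * ((fps_X ^ q) ^ i - S ^ i) \<in> pmult ?c ?B"
      using fA sA by (intro pmult_mult_left[OF B] fps_over_const[OF A]) auto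
    moreover have "fps_const ((f $ i) ^ q - s (f $ i)) \<in> fps_over (pmult c A)"
      using s[OF fA] pmult_0[OF A] by (auto simp: fps_over_def)
    then have "fps_const ((f $ i) ^ q - s (f $ i)) \<in> pmult ?c ?B"
      unfolding fps_over_pmult .
    then have "fps_const ((f $ i) ^ q - s (f $ i)) * fps_X ^ (i * q) \<in> pmult ?c ?B"
      by (intro pmult_mult_right[OF B] subring_power[OF B] fps_over_X[OF A])
    ultimately have "fps_const ((f $ i) ^ q - s (f $ i)) * fps_X ^ (i * q) +
        fps_const (s (f $ i)) * ((fps_X ^ q) ^ i - S ^ i) \<in> pmult ?c ?B"
      by (intro pmult_add[OF B])
    also have "fps_const ((f $ i) ^ q - s (f $ i)) * fps_X ^ (i * q) +
        fps_const (s (f $ i)) * ((fps_X ^ q) ^ i - S ^ i) = x i ^ q - y i"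
      unfolding x_def y_def
      by (simp add: power_mult_distrib power_mult[symmetric] algebra_simps fps_const_sub[symmetric] fps_const_power[symmetric]
          del: fps_const_sub fps_const_power)
    finally show ?thesis .
  qed
  then have "sum x {..n} ^ q - sum y {..n} \<in> pmult ?c ?B"
    using xB by (intro frobenius_sum[OF frob_ring_fps[OF fr]]) auto
  then have "(sum x {..n} ^ q - sum y {..n}) $ n \<in> pmult c A"
    unfolding fps_over_pmult[symmetric] by (rule fps_overD)
  moreover have "(sum x {..n} ^ q) $ n = (f ^ q) $ n"
  proof (rule fps_power_agree[of "Suc n"])
    show "sum x {..n} $ m = f $ m" if "m < Suc n" for m
      using that by (simp add: x_def fps_sum_nth if_distrib cong: if_cong)
  qed auto
  moreover have "sum y {..n} $ n = (map_fps s f oo S) $ n"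
    by (simp add: y_def fps_compose_nth fps_sum_nth atMost_atLeast0)
  ultimately show "(f ^ q - (map_fps s f oo S)) $ n \<in> pmult c A"
    by simp
qed

section \<open>The functional equation lemma\<close>

text \<open>The coefficients of \<open>\<Sum>\<^sub>i X^(q^i) / \<pi>^i\<close>.\<close>

fun l0c :: "'a::field \<Rightarrow> nat \<Rightarrow> nat \<Rightarrow> 'a" where
  "l0c \<pi> q n = (if n = 0 then 0 else if n = 1 then 1 else
     if q \<ge> 2 \<and> q dvd n then l0c \<pi> q (n div q) / \<pi> else 0)"

declare l0c.simps [simp del]

lemma hom_on_compose_X_power:
  "q \<ge> 1 \<Longrightarrow> hom_on UNIV (\<lambda>f :: 'a::idom fps. f oo fps_X ^ q)"
  by (simp add: hom_on_def subring_UNIV fps_compose_add_distrib fps_compose_mult_distrib)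

text \<open>The properties of the valuation ring that the formal part uses. The units 1 - \<pi> a
  give the nonzero denominators \<pi> - \<pi>^n of the logarithm and the division in degree 0 of
  \<open>twisted_integral\<close>.\<close>

locale lubin_tate =
  fixes R :: "'a::field_char_0 set" and \<pi> :: 'a and q :: nat
  assumes frob_ring: "frob_ring R \<pi> q"
    and fermat: "a \<in> R \<Longrightarrow> a ^ q - a \<in> pmult \<pi> R"
    and \<pi>_nonzero: "\<pi> \<noteq> 0"
    and unit_nonzero: "a \<in> R \<Longrightarrow> 1 - \<pi> * a \<noteq> 0"
    and unit_inverse: "a \<in> R \<Longrightarrow> inverse (1 - \<pi> * a) \<in> R"
begin

lemma R: "subring R" and \<pi>_in: "\<pi> \<in> R" and q_ge_2: "q \<ge> 2"
  using frob_ring by (auto simp: frob_ring_def)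

lemma q_pos: "q > 0" "q \<ge> 1"
  using q_ge_2 by auto

abbreviation "R1 \<equiv> fps_over R"
abbreviation "R2 \<equiv> fps_over R1"

lemma R1: "subring R1" and R2: "subring R2"
  by (auto intro: R subring_fps_over)

abbreviation \<pi>1 :: "'a fps" where "\<pi>1 \<equiv> fps_const \<pi>"
abbreviation \<pi>2 :: "'a fps fps" where "\<pi>2 \<equiv> fps_const \<pi>1"

definition l0 :: "'a fps" where "l0 = Abs_fps (l0c \<pi> q)"
definition e0 :: "'a fps" where "e0 = fps_inv l0"

lemma l0_nth [simp]: "l0 $ 0 = 0" "l0 $ Suc 0 = 1"
  by (simp_all add: l0_def l0c.simps)

lemma l0_rec: "l0 = fps_X + fps_const (1 / \<pi>) * (l0 oo fps_X ^ q)"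
proof (rule fps_ext)
  fix n
  show "l0 $ n = (fps_X + fps_const (1 / \<pi>) * (l0 oo fps_X ^ q)) $ n"
    using q_ge_2 by (auto simp: l0_def fps_nth_compose_X_power l0c.simps[of \<pi> q n] l0c.simps[of \<pi> q 0])
qed

lemma
  shows l0_e0: "l0 oo e0 = fps_X" and e0_l0: "e0 oo l0 = fps_X"
    and e0_nth [simp]: "e0 $ 0 = 0" "e0 $ Suc 0 = 1"
proof -
  show le: "l0 oo e0 = fps_X" and "e0 oo l0 = fps_X"
    unfolding e0_def by (auto intro: fps_inv_right fps_inv)
  show 0: "e0 $ 0 = 0" by (simp add: e0_def fps_inv_def)
  have "(l0 oo e0) $ 1 = 1" by (simp add: le)
  then show "e0 $ Suc 0 = 1" by (simp add: fps_compose_nth)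
qed

abbreviation "c2 a \<equiv> fps_const (fps_const (a :: 'a))"

lemma lift_l0_rec:
  fixes x :: "'a fps fps"
  assumes "x $ 0 = 0"
  shows "lift l0 oo x = x + c2 (1 / \<pi>) * (lift l0 oo x ^ q)"
proof -
  have X0: "(fps_X ^ q :: 'a fps fps) $ 0 = 0" using q_pos by simp
  have "lift l0 = fps_X + c2 (1 / \<pi>) * (lift l0 oo fps_X ^ q)"
    by (subst l0_rec) simp
  then have "lift l0 oo x = (fps_X + c2 (1 / \<pi>) * (lift l0 oo fps_X ^ q)) oo x"
    by simp
  also have "\<dots> = x + c2 (1 / \<pi>) * (lift l0 oo (fps_X ^ q oo x))"
    using assms X0 by (simp add: fps_compose_add_distrib fps_compose_mult_distrib fps_compose_assoc)
  also have "fps_X ^ q oo x = x ^ q"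
    using assms by (simp add: fps_compose_power[symmetric])
  finally show ?thesis .
qed

lemma c2_pi_cancel: "c2 (1 / \<pi>) * (\<pi>2 * x) = x"
  using \<pi>_nonzero by (simp add: mult.assoc[symmetric])

lemma c2_in: "a \<in> R \<Longrightarrow> c2 a \<in> R2"
  by (intro fps_over_const R R1)

lemma frob_ring1: "frob_ring R1 \<pi>1 q" and frob_ring2: "frob_ring R2 \<pi>2 q"
  using frob_ring_fps[OF frob_ring] frob_ring_fps[OF frob_ring_fps[OF frob_ring]] by auto

text \<open>For n = q m the coefficient of index n carries one more 1 / \<pi> than that of index m,
  and passing from x, y to x^q, y^q gains one factor \<pi> in the congruence. \<open>j\<close> is
  general because it grows along the induction.\<close>

lemma l0_power_cong:
  assumes "x \<in> R2" "y \<in> R2" "x - y \<in> pmult (\<pi>2 ^ j) R2" "j \<ge> 1"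
  shows "c2 (l0c \<pi> q n) * (x ^ n - y ^ n) \<in> pmult (\<pi>2 ^ j) R2"
  using assms
proof (induction n arbitrary: x y j rule: less_induct)
  case (less n)
  consider "n = 0" | "n = 1" | "n \<ge> 2" "q dvd n" | "n \<ge> 2" "\<not> q dvd n" by linarith
  then show ?case
  proof cases
    case 3
    then obtain m where m: "n = q * m" by (auto elim: dvdE)
    have mn: "m < n" using m 3 mult_le_mono1[OF q_ge_2, of m] by linarith
    have "c2 (l0c \<pi> q m) * ((x ^ q) ^ m - (y ^ q) ^ m) \<in> pmult (\<pi>2 ^ Suc j) R2"
      using less.prems by (intro less.IH mn frobenius_cong[OF frob_ring2] subring_power[OF R2]) auto
    then obtain w where w: "w \<in> R2" "c2 (l0c \<pi> q m) * ((x ^ q) ^ m - (y ^ q) ^ m) = \<pi>2 ^ Suc j * w"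
      by (rule pmultE)
    have "l0c \<pi> q n = (1 / \<pi>) * l0c \<pi> q m"
      using 3 m mn q_ge_2 by (subst l0c.simps) auto
    then have "c2 (l0c \<pi> q n) * (x ^ n - y ^ n) = c2 (1 / \<pi>) * (c2 (l0c \<pi> q m) * ((x ^ q) ^ m - (y ^ q) ^ m))"
      by (simp add: m power_mult mult.assoc[symmetric])
    also have "\<dots> = c2 (1 / \<pi>) * (\<pi>2 * (\<pi>2 ^ j * w))"
      unfolding w(2) by (simp only: power_Suc mult.assoc)
    also have "\<dots> = \<pi>2 ^ j * w" by (rule c2_pi_cancel)
    finally show ?thesis using w(1) by (simp only: pmultI)
  qed (use less.prems in \<open>auto simp: l0c.simps pmult_0[OF R2]\<close>)
qed

text \<open>Summing the termwise congruences for \<open>j\<close> = 1 shows that the denominators of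
  \<open>l0\<close> do no harm modulo \<pi>.\<close>

lemma l0_cong:
  assumes "x \<in> R2" "y \<in> R2" "x - y \<in> pmult \<pi>2 R2"
  shows "c2 (1 / \<pi>) * ((lift l0 oo x) - (lift l0 oo y)) \<in> R2"
proof -
  have "(lift l0 oo x) - (lift l0 oo y) \<in> fps_over (pmult \<pi>1 R1)"
  proof (rule fps_overI)
    fix n
    have "((lift l0 oo x) - (lift l0 oo y)) $ n = (\<Sum>i = 0..n. (c2 (l0c \<pi> q i) * (x ^ i - y ^ i)) $ n)"
      by (simp add: fps_compose_nth l0_def sum_subtractf[symmetric] algebra_simps)
    also have "\<dots> \<in> pmult \<pi>1 R1"
    proof (rule pmult_sum[OF R1])
      fix i
      have "c2 (l0c \<pi> q i) * (x ^ i - y ^ i) \<in> fps_over (pmult \<pi>1 R1)"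
        unfolding fps_over_pmult using l0_power_cong[OF assms(1,2), of 1 i] assms(3) by simp
      then show "(c2 (l0c \<pi> q i) * (x ^ i - y ^ i)) $ n \<in> pmult \<pi>1 R1"
        by (rule fps_overD)
    qed
    finally show "((lift l0 oo x) - (lift l0 oo y)) $ n \<in> pmult \<pi>1 R1" .
  qed
  then obtain w where "w \<in> R2" "(lift l0 oo x) - (lift l0 oo y) = \<pi>2 * w"
    unfolding fps_over_pmult by (rule pmultE)
  then show ?thesis by (simp only: c2_pi_cancel)
qed

text \<open>The Frobenius lift on series in \<open>T\<close> (outer variable) and \<open>X\<close> (inner variable) given by
  \<open>T \<mapsto> S(T)\<close> and \<open>X \<mapsto> X^q\<close>.\<close>

definition \<sigma> :: "'a fps \<Rightarrow> 'a fps fps \<Rightarrow> 'a fps fps" where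
  "\<sigma> S f = map_fps (\<lambda>g. g oo fps_X ^ q) f oo lift S"

text \<open>Lubin-Tate series for \<pi> and \<open>fps_X ^ q\<close> both qualify: T -> Q(T) is
  adapted to the roots, T -> T^q serves \<open>lt_hom_integral\<close> and
  \<open>FG_integral\<close>.\<close>

definition frob_series :: "'a fps \<Rightarrow> bool" where
  "frob_series S \<longleftrightarrow> S \<in> R1 \<and> S $ 0 = 0 \<and> S - fps_X ^ q \<in> fps_over (pmult \<pi> R)"

lemma hom_inner: "hom_on UNIV (map_fps (\<lambda>g :: 'a fps. g oo fps_X ^ q))"
  using hom_on_map_fps[OF hom_on_compose_X_power[OF q_pos(2)]] by simp

lemma \<sigma>_hom:
  assumes "frob_series S"
  shows "hom_on UNIV (\<sigma> S)"
  using assms hom_inner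
  by (auto simp: hom_on_def \<sigma>_def frob_series_def fps_compose_add_distrib fps_compose_mult_distrib)

text \<open>Two applications of \<open>frobenius_fps\<close>: first in X, with the identity as
  Frobenius lift on \<open>R\<close> by Fermat's congruence, then in T over the result.\<close>

lemma \<sigma>_frob:
  assumes S: "frob_series S" and f: "f \<in> R2"
  shows "f ^ q - \<sigma> S f \<in> pmult \<pi>2 R2"
  unfolding \<sigma>_def
proof (rule frobenius_fps[OF frob_ring1])
  fix g assume g: "g \<in> R1"
  show "g oo fps_X ^ q \<in> R1"
    by (intro fps_over_compose subring_power R R1 g fps_over_X)
  have "g ^ q - (map_fps id g oo fps_X ^ q) \<in> pmult \<pi>1 R1"
    using fermat g q_pos pmult_0[OF R]
    by (intro frobenius_fps[OF frob_ring] subring_power R1 fps_over_X R) (auto simp: fps_over_def)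
  also have "map_fps id g = g" by (simp add: fps_eq_iff)
  finally show "g ^ q - (g oo fps_X ^ q) \<in> pmult \<pi>1 R1" .
next
  have "lift (S - fps_X ^ q) \<in> fps_over (pmult \<pi>1 R1)"
  proof (rule map_fps_over)
    fix x assume "x \<in> pmult \<pi> R"
    then have "fps_const x \<in> fps_over (pmult \<pi> R)"
      using pmult_0[OF R] by (auto simp: fps_over_def)
    then show "fps_const x \<in> pmult \<pi>1 R1"
      unfolding fps_over_pmult .
  qed (use S in \<open>simp add: frob_series_def\<close>)
  then show "lift S - fps_X ^ q \<in> fps_over (pmult \<pi>1 R1)" by simp
qed (use S f R in \<open>auto simp: frob_series_def intro: fps_over_lift\<close>)

lemma \<sigma>_in: "frob_series S \<Longrightarrow> f \<in> R2 \<Longrightarrow> \<sigma> S f \<in> R2"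
  using \<sigma>_frob[of S f] pmult_subset[OF R2 c2_in[OF \<pi>_in]] subring_power[OF R2, of f q] subring_diff[OF R2]
  by (metis add_diff_cancel_left' diff_add_cancel)

lemma \<sigma>_nth_0: "frob_series S \<Longrightarrow> f $ 0 = 0 \<Longrightarrow> \<sigma> S f $ 0 = 0"
  by (simp add: \<sigma>_def)

text \<open>The coefficients of \<open>g\<close> are constants, which the Frobenius lift fixes, so
  it acts through the argument alone.\<close>

lemma \<sigma>_lift_compose:
  assumes S: "frob_series S" and f: "f $ 0 = 0"
  shows "\<sigma> S (lift g oo f) = lift g oo \<sigma> S f"
proof -
  have "map_fps (\<lambda>g. g oo fps_X ^ q) (lift g) = lift g"
    by (simp add: fps_eq_iff)
  then have "map_fps (\<lambda>g. g oo fps_X ^ q) (lift g oo f) = lift g oo map_fps (\<lambda>g. g oo fps_X ^ q) f"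
    using map_fps_compose[OF hom_on_compose_X_power[OF q_pos(2)], of "lift g" f] by simp
  then show ?thesis
    using S f by (simp add: \<sigma>_def frob_series_def fps_compose_assoc)
qed

text \<open>Hazewinkel's functional equation with integral remainder. The linear coefficient in T is
  required separately: degree d brings in the factor (S $ 1)^d / \<pi>, which need not be divisible
  by \<pi> when d = 1.\<close>

definition fun_eq :: "'a fps \<Rightarrow> 'a fps fps \<Rightarrow> bool" where
  "fun_eq S g \<longleftrightarrow> g $ 0 = 0 \<and> g $ 1 \<in> R1 \<and> g - c2 (1 / \<pi>) * \<sigma> S g \<in> R2"

lemma fun_eq_add: "frob_series S \<Longrightarrow> fun_eq S f \<Longrightarrow> fun_eq S g \<Longrightarrow> fun_eq S (f + g)"
proof -
  assume *: "frob_series S" "fun_eq S f" "fun_eq S g"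
  have "(f - c2 (1 / \<pi>) * \<sigma> S f) + (g - c2 (1 / \<pi>) * \<sigma> S g) \<in> R2"
    using * by (intro subring_add[OF R2]) (auto simp: fun_eq_def)
  moreover have "(f - c2 (1 / \<pi>) * \<sigma> S f) + (g - c2 (1 / \<pi>) * \<sigma> S g) = (f + g) - c2 (1 / \<pi>) * \<sigma> S (f + g)"
    using hom_on_add[OF \<sigma>_hom[OF *(1)], of f g] by (simp add: algebra_simps)
  ultimately show ?thesis
    using * by (auto simp: fun_eq_def intro: subring_add[OF R1])
qed

lemma \<sigma>_c2: "\<sigma> S (c2 a) = c2 a"
proof -
  have "map_fps (\<lambda>g. g oo fps_X ^ q) (c2 a) = c2 a"
    by (rule fps_ext) simp
  then show ?thesis by (simp add: \<sigma>_def)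
qed

lemma fun_eq_const_mult: "frob_series S \<Longrightarrow> a \<in> R \<Longrightarrow> fun_eq S g \<Longrightarrow> fun_eq S (c2 a * g)"
proof -
  assume *: "frob_series S" "a \<in> R" "fun_eq S g"
  have "c2 a * (g - c2 (1 / \<pi>) * \<sigma> S g) \<in> R2"
    using * by (intro subring_mult[OF R2] c2_in) (auto simp: fun_eq_def)
  moreover have "c2 a * (g - c2 (1 / \<pi>) * \<sigma> S g) = c2 a * g - c2 (1 / \<pi>) * \<sigma> S (c2 a * g)"
    using hom_on_mult[OF \<sigma>_hom[OF *(1)], of "c2 a" g] by (simp only: \<sigma>_c2 UNIV_I algebra_simps)
  ultimately show ?thesis
    using * by (auto simp: fun_eq_def intro!: subring_mult[OF R1] fps_over_const[OF R])
qed

text \<open>Converse direction of the functional equation lemma: by the recursion of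
  \<open>l0\<close> the remainder is x + (l0(x^q) - l0(\<sigma> x)) / \<pi>, and x^q and \<sigma> x
  are congruent modulo \<pi>.\<close>

lemma fun_eq_l0:
  assumes S: "frob_series S" and x: "x \<in> R2" "x $ 0 = 0"
  shows "fun_eq S (lift l0 oo x)"
proof -
  have "(lift l0 oo x) $ 1 = x $ 1"
    by (simp add: fps_compose_nth)
  moreover have "x + c2 (1 / \<pi>) * ((lift l0 oo x ^ q) - (lift l0 oo \<sigma> S x)) \<in> R2"
    using x S by (intro subring_add[OF R2] l0_cong \<sigma>_frob \<sigma>_in subring_power[OF R2])
  moreover have "x + c2 (1 / \<pi>) * ((lift l0 oo x ^ q) - (lift l0 oo \<sigma> S x))
      = (lift l0 oo x) - c2 (1 / \<pi>) * \<sigma> S (lift l0 oo x)"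
    unfolding \<sigma>_lift_compose[OF S x(2)] 
    by (simp only: lift_l0_rec[OF x(2)] right_diff_distrib add_diff_eq)
  ultimately show ?thesis
    using x by (auto simp: fun_eq_def intro: fps_overD)
qed

text \<open>Coefficient k of h(X^q) is 0 or coefficient k / q of h, which comes earlier unless k =
  0; there 1 - \<pi> b is invertible.\<close>

lemma twisted_integral:
  assumes b: "b \<in> R" and h: "h - fps_const (\<pi> * b) * (h oo fps_X ^ q) \<in> R1"
  shows "h \<in> R1"
proof (rule fps_overI)
  fix k
  show "h $ k \<in> R"
  proof (induction k rule: less_induct)
    case (less k)
    have r: "h $ k - \<pi> * b * (if q dvd k then h $ (k div q) else 0) \<in> R"
      using fps_overD[OF h, of k] by (simp add: fps_nth_compose_X_power)
    show ?case
    proof (cases "k = 0")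
      case True
      have eq: "h $ k - \<pi> * b * (if q dvd k then h $ (k div q) else 0) = h $ k * (1 - \<pi> * b)"
        by (simp add: True algebra_simps)
      have "h $ k * (1 - \<pi> * b) * inverse (1 - \<pi> * b) \<in> R"
        using r unfolding eq by (rule subring_mult[OF R _ unit_inverse[OF b]])
      then show ?thesis using unit_nonzero[OF b] by (simp add: mult.assoc)
    next
      case False
      then have "k div q < k" using q_ge_2 by simp
      then have "\<pi> * b * (if q dvd k then h $ (k div q) else 0) \<in> R"
        using less b by (auto intro!: subring_mult[OF R] \<pi>_in subring_0[OF R])
      from subring_add[OF R r this] show ?thesis by simp
    qed
  qed
qed

text \<open>Induction on the degree d in T. With f = e0(g) the equation reads f = r + (l0(\<sigma>
  f) - l0(f^q)) / \<pi>. For the truncation of f below d the quotient is integral by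
  \<open>l0_cong\<close>. The unknown coefficient h of degree d enters the right side only as a
  multiple of h(X^q), and \<open>twisted_integral\<close> solves for h.\<close>

lemma functional_equation:
  assumes S: "frob_series S" and g: "fun_eq S g"
  shows "lift e0 oo g \<in> R2"
proof (rule fps_overI)
  fix d
  define f where "f = lift e0 oo g"
  define r where "r = g - c2 (1 / \<pi>) * \<sigma> S g"
  have g0: "g $ 0 = 0" and g1: "g $ 1 \<in> R1" and r: "r \<in> R2"
    using g by (auto simp: fun_eq_def r_def)
  have f0: "f $ 0 = 0" by (simp add: f_def)
  have lf: "lift l0 oo f = g"
  proof -
    have "lift l0 oo f = lift (l0 oo e0) oo g"
      using g0 by (simp add: f_def fps_compose_assoc)
    then show ?thesis using g0 by (simp add: l0_e0)
  qed
  have eq: "f = r + c2 (1 / \<pi>) * ((lift l0 oo \<sigma> S f) - (lift l0 oo f ^ q))"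
  proof -
    have "f + c2 (1 / \<pi>) * (lift l0 oo f ^ q) = r + c2 (1 / \<pi>) * (lift l0 oo \<sigma> S f)"
      unfolding \<sigma>_lift_compose[OF S f0, symmetric] lift_l0_rec[OF f0, symmetric]
      by (simp add: lf r_def)
    then show ?thesis by (simp add: algebra_simps)
  qed
  have S1: "S $ 0 = 0" "S $ 1 \<in> pmult \<pi> R"
  proof -
    have "(S - fps_X ^ q) $ 1 \<in> pmult \<pi> R"
      by (rule fps_overD) (use S in \<open>simp add: frob_series_def\<close>)
    then show "S $ 1 \<in> pmult \<pi> R" using q_ge_2 by simp
  qed (use S in \<open>auto simp: frob_series_def\<close>)
  have "f $ d \<in> R1"
  proof (induction d rule: less_induct)
    case (less d)
    consider "d = 0" | "d = 1" | "d \<ge> 2" by linarith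
    then show ?case
    proof cases
      case 1
      then show ?thesis using f0 by (simp add: subring_0[OF R1])
    next
      case 2
      then show ?thesis using g1 by (simp add: f_def fps_compose_nth)
    next
      case 3
      define f' where "f' = fps_cutoff d f"
      have f': "f' \<in> R2"
        using less by (auto simp: f'_def intro!: fps_overI subring_0[OF R])
          (metis fps_overD subring_0[OF R])
      have f'0: "f' $ 0 = 0" using f0 by (simp add: f'_def)
      have agree: "f $ m = f' $ m" if "m < d" for m using that by (simp add: f'_def)
      \<comment> \<open>As q >= 2, coefficient d of f^q does not see coefficient d of f.\<close>
      have pow: "(lift l0 oo f ^ q) $ d = (lift l0 oo f' ^ q) $ d"
      proof (rule fps_compose_agree[of "Suc d"])
        show "(f ^ q) $ m = (f' ^ q) $ m" if "m < Suc d" for m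
          using that fps_power_agree_next[OF f0 f'0 agree q_ge_2] fps_power_agree[of d f f' m q] agree
          by (cases "m = d") auto
      qed auto
      let ?s = "\<lambda>g :: 'a fps. g oo fps_X ^ q"
      have \<sigma>_agree: "\<sigma> S f $ m = \<sigma> S f' $ m" if "m < d" for m
        unfolding \<sigma>_def fps_compose_nth using that by (intro sum.cong) (auto simp: agree)
      \<comment> \<open>In T-degree d the power S^d contributes (S $ 1)^d; this is how the unknown
        coefficient reappears, with X^q substituted.\<close>
      have "\<sigma> S f $ d - \<sigma> S f' $ d = (\<Sum>i = 0..d. if i = d then ?s (f $ d) * fps_const ((S $ 1) ^ d) else 0)"
        unfolding \<sigma>_def fps_compose_nth sum_subtractf[symmetric]
      proof (intro sum.cong refl)
        fix i assume "i \<in> {0..d}"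
        then show "map_fps ?s f $ i * (lift S ^ i) $ d - map_fps ?s f' $ i * (lift S ^ i) $ d =
            (if i = d then ?s (f $ d) * fps_const ((S $ 1) ^ d) else 0)"
          using agree S1 by (auto simp: f'_def startsby_zero_power_nth_same)
      qed
      also have "\<dots> = ?s (f $ d) * fps_const ((S $ 1) ^ d)" by simp
      finally have \<sigma>_diff: "\<sigma> S f $ d - \<sigma> S f' $ d = ?s (f $ d) * fps_const ((S $ 1) ^ d)" .
      have "(lift l0 oo \<sigma> S f) $ d - (lift l0 oo \<sigma> S f') $ d = ?s (f $ d) * fps_const ((S $ 1) ^ d)"
        using fps_compose_agree_next[OF \<sigma>_nth_0[OF S f0] \<sigma>_nth_0[OF S f'0] \<sigma>_agree, where f = "lift l0"] \<sigma>_diff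
        by simp
      then have "f $ d = r $ d + fps_const (1 / \<pi>) * ((lift l0 oo \<sigma> S f') $ d + ?s (f $ d) * fps_const ((S $ 1) ^ d)
          - (lift l0 oo f' ^ q) $ d)"
        by (subst eq) (simp add: pow algebra_simps)
      also have "\<dots> = r $ d + (c2 (1 / \<pi>) * ((lift l0 oo \<sigma> S f') - (lift l0 oo f' ^ q))) $ d
          + fps_const ((S $ 1) ^ d / \<pi>) * ?s (f $ d)"
        by (simp add: algebra_simps divide_inverse fps_const_mult[symmetric] del: fps_const_mult)
      finally have fd: "f $ d = r $ d + (c2 (1 / \<pi>) * ((lift l0 oo \<sigma> S f') - (lift l0 oo f' ^ q))) $ d
          + fps_const ((S $ 1) ^ d / \<pi>) * ?s (f $ d)" .
      have "\<sigma> S f' - f' ^ q \<in> pmult \<pi>2 R2"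
        using pmult_minus[OF R2 \<sigma>_frob[OF S f']] by simp
      then have "c2 (1 / \<pi>) * ((lift l0 oo \<sigma> S f') - (lift l0 oo f' ^ q)) \<in> R2"
        using f' S by (intro l0_cong \<sigma>_in subring_power[OF R2])
      then have "r $ d + (c2 (1 / \<pi>) * ((lift l0 oo \<sigma> S f') - (lift l0 oo f' ^ q))) $ d \<in> R1"
        by (intro subring_add[OF R1] fps_overD[OF r] fps_overD[of _ R1])
      moreover have "f $ d - fps_const ((S $ 1) ^ d / \<pi>) * ?s (f $ d) =
          r $ d + (c2 (1 / \<pi>) * ((lift l0 oo \<sigma> S f') - (lift l0 oo f' ^ q))) $ d"
        unfolding diff_eq_eq by (rule fd)
      ultimately have int: "f $ d - fps_const ((S $ 1) ^ d / \<pi>) * ?s (f $ d) \<in> R1"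
        by (simp only:)
      obtain a where a: "a \<in> R" "S $ 1 = \<pi> * a" using S1(2) by (rule pmultE)
      \<comment> \<open>With d = e + 2, one factor \<pi> of (S $ 1)^d cancels the denominator and
        another one stays in front, as \<open>twisted_integral\<close> requires.\<close>
      obtain e where e: "d = Suc (Suc e)" using 3 le_Suc_ex[OF 3] by auto
      have "(S $ 1) ^ d / \<pi> = \<pi> * (\<pi> ^ e * a ^ d)"
        using \<pi>_nonzero unfolding a(2) by (simp add: e power_mult_distrib)
      with int have int': "f $ d - fps_const (\<pi> * (\<pi> ^ e * a ^ d)) * ?s (f $ d) \<in> R1"
        by (simp only:)
      have "\<pi> ^ e * a ^ d \<in> R"
        using a(1) \<pi>_in by (intro subring_mult[OF R] subring_power[OF R])
      then show ?thesis using int' by (rule twisted_integral)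
    qed
  qed
  then show "(lift e0 oo g) $ d \<in> R1" by (simp add: f_def)
qed

end

section \<open>Logarithms and endomorphisms of Lubin-Tate series\<close>

text \<open>The recursion compares coefficients of index n in log(P) = \<pi> log for P with linear
  coefficient \<pi>: the n-th coefficient of log occurs with \<pi>^n on the left and with \<pi> on
  the right.\<close>

fun logc :: "'a::field \<Rightarrow> 'a fps \<Rightarrow> nat \<Rightarrow> 'a" where
  "logc \<pi> P n = (if n = 0 then 0 else if n = 1 then 1 else
     (\<Sum>i\<in>{..<n}. logc \<pi> P i * (P ^ i) $ n) / (\<pi> - \<pi> ^ n))"

declare logc.simps [simp del]

primrec fps_iter :: "'a::comm_ring_1 fps \<Rightarrow> nat \<Rightarrow> 'a fps" where
  "fps_iter P 0 = fps_X"
| "fps_iter P (Suc i) = fps_iter P i oo P"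

lemma fps_const_mult_compose:
  fixes a b :: "'a::idom fps"
  shows "b $ 0 = 0 \<Longrightarrow> (fps_const c * a) oo b = fps_const c * (a oo b)"
  by (simp add: fps_compose_mult_distrib)

lemma fps_over_lift_iff:
  assumes "subring A"
  shows "lift f \<in> fps_over (fps_over A) \<longleftrightarrow> f \<in> fps_over A"
proof
  assume "lift f \<in> fps_over (fps_over A)"
  then have "lift f $ n $ 0 \<in> A" for n by (intro fps_overD)
  then show "f \<in> fps_over A" by (simp add: fps_over_def)
qed (rule fps_over_lift[OF assms])

context lubin_tate
begin

definition lt_series :: "'a fps \<Rightarrow> bool" where
  "lt_series P \<longleftrightarrow> frob_series P \<and> P $ 1 = \<pi>"

definition log :: "'a fps \<Rightarrow> 'a fps" where "log P = Abs_fps (logc \<pi> P)"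
definition exp :: "'a fps \<Rightarrow> 'a fps" where "exp P = fps_inv (log P)"

lemma pi_power_neq: "(n::nat) \<ge> 2 \<Longrightarrow> \<pi> - \<pi> ^ n \<noteq> 0"
proof -
  assume "n \<ge> 2"
  then obtain k where "n = Suc (Suc k)" by (metis add_2_eq_Suc le_Suc_ex)
  then have "\<pi> - \<pi> ^ n = \<pi> * (1 - \<pi> * \<pi> ^ k)" by (simp add: algebra_simps)
  then show ?thesis
    using \<pi>_nonzero unit_nonzero[of "\<pi> ^ k"] by (simp add: subring_power[OF R] \<pi>_in)
qed

lemma lt_series_simps:
  assumes "lt_series P"
  shows "P \<in> R1" "P $ 0 = 0" "P $ 1 = \<pi>" "P $ Suc 0 = \<pi>" "frob_series P"
  using assms by (auto simp: lt_series_def frob_series_def)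

lemma log_nth [simp]: "log P $ 0 = 0" "log P $ Suc 0 = 1"
  by (simp_all add: log_def logc.simps)

lemma exp_nth_0 [simp]: "exp P $ 0 = 0"
  by (simp add: exp_def fps_inv_def)

lemma log_exp: "log P oo exp P = fps_X" and exp_log: "exp P oo log P = fps_X"
  unfolding exp_def by (auto intro: fps_inv_right fps_inv)

lemma exp_nth_1 [simp]: "exp P $ Suc 0 = 1"
proof -
  have "(log P oo exp P) $ 1 = 1" by (simp add: log_exp)
  then show ?thesis by (simp add: fps_compose_nth)
qed

lemma log_exp_compose: "x $ 0 = 0 \<Longrightarrow> log P oo (exp P oo x) = x"
  by (simp add: fps_compose_assoc log_exp)

lemma exp_log_compose: "x $ 0 = 0 \<Longrightarrow> exp P oo (log P oo x) = x"
  by (simp add: fps_compose_assoc exp_log)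

lemma fps_compose_lt_nth:
  assumes P: "lt_series P" and D: "\<And>i. i < n \<Longrightarrow> D $ i = 0"
  shows "(D oo P) $ n = D $ n * \<pi> ^ n"
proof -
  have "(D oo P) $ n = (\<Sum>i = 0..n. if i = n then D $ n * \<pi> ^ n else 0)"
    unfolding fps_compose_nth using D lt_series_simps[OF P]
    by (intro sum.cong) (auto simp: startsby_zero_power_nth_same)
  then show ?thesis by simp
qed

lemma log_lt:
  assumes P: "lt_series P"
  shows "log P oo P = \<pi>1 * log P"
proof (rule fps_ext)
  fix n :: nat
  note P' = lt_series_simps[OF P]
  consider "n = 0" | "n = 1" | "n \<ge> 2" by linarith
  then show "(log P oo P) $ n = (\<pi>1 * log P) $ n"
  proof cases
    case 3
    have "log P $ n * (\<pi> - \<pi> ^ n) = (\<Sum>i\<in>{..<n}. log P $ i * (P ^ i) $ n)"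
      using 3 pi_power_neq[OF 3] unfolding log_def by (simp add: logc.simps[of \<pi> P n])
    moreover have "(log P oo P) $ n = (\<Sum>i\<in>{..<n}. log P $ i * (P ^ i) $ n) + log P $ n * \<pi> ^ n"
      using startsby_zero_power_nth_same[OF P'(2), of n] P'(3)
      by (simp add: fps_compose_nth atLeast0AtMost lessThan_Suc_atMost[symmetric])
    ultimately show ?thesis by (simp add: algebra_simps)
  qed (auto simp: fps_compose_nth P')
qed

text \<open>Composition with P multiplies the lowest nonzero coefficient, of some index n >= 2, by
  \<pi>^n, which differs from \<pi>.\<close>

lemma lt_eigen_unique:
  assumes P: "lt_series P" and D: "D oo P = \<pi>1 * D" "D $ 0 = 0" "D $ 1 = 0"
  shows "D = 0"
proof (rule fps_ext)
  fix n
  show "D $ n = 0 $ n"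
  proof (induction n rule: less_induct)
    case (less n)
    consider "n = 0" | "n = 1" | "n \<ge> 2" by linarith
    then show ?case
    proof cases
      case 3
      have eq: "D $ n * \<pi> ^ n = \<pi> * D $ n"
      proof -
        have "(D oo P) $ n = D $ n * \<pi> ^ n"
          by (rule fps_compose_lt_nth[OF P]) (use less in simp)
        then show ?thesis by (simp only: D(1) fps_mult_left_const_nth)
      qed
      have "D $ n * (\<pi> - \<pi> ^ n) = \<pi> * D $ n - D $ n * \<pi> ^ n"
        by (simp add: algebra_simps)
      also have "\<dots> = 0" by (simp only: eq diff_self)
      finally have "D $ n * (\<pi> - \<pi> ^ n) = 0" .
      then show ?thesis using pi_power_neq[OF 3] by (metis mult_eq_0_iff fps_zero_nth)
    qed (use D in auto)
  qed
qed

lemma log_over: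
  assumes K: "subring K" "\<And>x. x \<in> K \<Longrightarrow> inverse x \<in> K" "R \<subseteq> K" and P: "lt_series P"
  shows "log P \<in> fps_over K"
proof (rule fps_overI)
  fix n
  have \<pi>K: "\<pi> \<in> K" using K \<pi>_in by auto
  have "P \<in> fps_over K" using lt_series_simps(1)[OF P] K(3) by (auto simp: fps_over_def)
  then have pow: "(P ^ i) $ m \<in> K" for i m
    by (intro fps_overD subring_power subring_fps_over K)
  show "log P $ n \<in> K"
  proof (induction n rule: less_induct)
    case (less n)
    have "(\<Sum>i\<in>{..<n}. log P $ i * (P ^ i) $ n) \<in> K"
      using less pow by (intro subring_sum[OF K(1)] subring_mult[OF K(1)]) auto
    moreover have "inverse (\<pi> - \<pi> ^ n) \<in> K"
      using \<pi>K by (intro K(2) subring_diff[OF K(1)] subring_power[OF K(1)])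
    ultimately have "(\<Sum>i\<in>{..<n}. log P $ i * (P ^ i) $ n) / (\<pi> - \<pi> ^ n) \<in> K"
      unfolding divide_inverse by (rule subring_mult[OF K(1)])
    then show ?case
      using subring_0[OF K(1)] subring_1[OF K(1)] by (simp add: log_def logc.simps[of \<pi> P n])
  qed
qed

lemma exp_over:
  assumes K: "subring K" "\<And>x. x \<in> K \<Longrightarrow> inverse x \<in> K" "R \<subseteq> K" and P: "lt_series P"
  shows "exp P \<in> fps_over K"
  unfolding exp_def using log_over[OF assms] subring_1[OF K(1)]
  by (intro fps_over_inv K) auto

lemma \<sigma>_lift: "\<sigma> S (lift f) = lift f oo lift S"
proof -
  have "map_fps (\<lambda>g. g oo fps_X ^ q) (lift f) = lift f"
    by (rule fps_ext) simp
  then show ?thesis by (simp add: \<sigma>_def)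
qed

text \<open>The lift T -> P(T) multiplies log P by \<pi>, so the remainder is 0.\<close>

lemma fun_eq_lift_log:
  assumes P: "lt_series P"
  shows "fun_eq P (lift (log P))"
proof -
  have "\<sigma> P (lift (log P)) = \<pi>2 * lift (log P)"
    unfolding \<sigma>_lift lift_simps(4)[symmetric] log_lt[OF P] by simp
  then have "lift (log P) - c2 (1 / \<pi>) * \<sigma> P (lift (log P)) = 0"
    by (simp only: c2_pi_cancel diff_self)
  then show ?thesis
    by (simp add: fun_eq_def subring_0[OF R2] subring_1[OF R1])
qed

text \<open>\<theta> and \<psi> are the mutually inverse isomorphisms between the formal group of P
  and the one with logarithm \<open>l0\<close>. Once known to be integral they reduce questions
  about P to \<open>l0\<close>.\<close>

definition \<theta> :: "'a fps \<Rightarrow> 'a fps" where "\<theta> P = e0 oo log P"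
definition \<psi> :: "'a fps \<Rightarrow> 'a fps" where "\<psi> P = exp P oo l0"

lemma \<theta>_integral: "lt_series P \<Longrightarrow> \<theta> P \<in> R1"
  using functional_equation[OF _ fun_eq_lift_log] lt_series_simps(5)
  by (simp add: \<theta>_def fps_over_lift_iff[OF R, symmetric])

lemma \<theta>_nth_0 [simp]: "\<theta> P $ 0 = 0" and \<psi>_nth_0 [simp]: "\<psi> P $ 0 = 0"
  by (simp_all add: \<theta>_def \<psi>_def)

lemma log_eq: "log P = l0 oo \<theta> P"
  by (simp add: \<theta>_def fps_compose_assoc l0_e0)

lemma exp_eq: "exp P = \<psi> P oo e0"
  by (simp add: \<psi>_def fps_compose_assoc[symmetric] l0_e0)

text \<open>\<psi> is the compositional inverse of the integral series \<theta>, whose linear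
  coefficient is 1.\<close>

lemma \<psi>_integral:
  assumes "lt_series P"
  shows "\<psi> P \<in> R1"
proof -
  have \<theta>: "\<theta> P $ 0 = 0" "\<theta> P $ 1 = 1"
    by (simp_all add: \<theta>_def fps_compose_nth)
  have "\<theta> P oo \<psi> P = e0 oo (log P oo (exp P oo l0))"
    by (simp add: \<theta>_def \<psi>_def fps_compose_assoc)
  then have inv: "\<theta> P oo \<psi> P = fps_X"
    by (simp add: log_exp_compose e0_l0)
  have "fps_inv (\<theta> P) oo (\<theta> P oo \<psi> P) = (fps_inv (\<theta> P) oo \<theta> P) oo \<psi> P"
    using \<theta> by (intro fps_compose_assoc) (auto simp: \<psi>_def)
  then have "fps_inv (\<theta> P) = \<psi> P"
    using \<theta> by (simp add: inv fps_inv)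
  then show ?thesis
    using fps_over_inv[OF R \<theta>_integral[OF assms]] \<theta> subring_1[OF R] by simp
qed

text \<open>\<open>exp P\<close> is \<psi> after \<open>e0\<close>, and
  \<open>functional_equation\<close> settles \<open>e0\<close>.\<close>

lemma exp_integral:
  assumes "lt_series P" "frob_series S" "fun_eq S g"
  shows "lift (exp P) oo g \<in> R2"
proof -
  have "lift (exp P) oo g = lift (\<psi> P) oo (lift e0 oo g)"
    using assms(3) by (simp add: exp_eq fps_compose_assoc fun_eq_def)
  also have "\<dots> \<in> R2"
    using assms by (intro fps_over_compose R1 fps_over_lift R \<psi>_integral functional_equation)
  finally show ?thesis .
qed

lemma fun_eq_log:
  assumes P: "lt_series P" and S: "frob_series S" and x: "x \<in> R2" "x $ 0 = 0"
  shows "fun_eq S (lift (log P) oo x)"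
proof -
  have "lift (log P) oo x = lift l0 oo (lift (\<theta> P) oo x)"
    using x by (simp add: log_eq fps_compose_assoc)
  also have "fun_eq S \<dots>"
    using x P by (intro fun_eq_l0 S fps_over_compose R1 fps_over_lift R \<theta>_integral) auto
  finally show ?thesis .
qed

lemma frob_series_X_power: "frob_series (fps_X ^ q)"
  using q_pos pmult_0[OF R]
  by (auto simp: frob_series_def fps_over_def intro!: subring_0[OF R] subring_1[OF R])

text \<open>The homomorphism \<open>[a]\<close> from the formal group of \<open>Q\<close> to that of \<open>P\<close>.\<close>

definition lt_hom :: "'a fps \<Rightarrow> 'a fps \<Rightarrow> 'a \<Rightarrow> 'a fps" where
  "lt_hom P Q a = exp P oo (fps_const a * log Q)"

lemma lt_hom_nth [simp]: "lt_hom P Q a $ 0 = 0" "lt_hom P Q a $ Suc 0 = a"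
  by (simp_all add: lt_hom_def fps_compose_nth)

text \<open>The Frobenius lift fixes constants, so a log Q satisfies the functional equation along
  with log Q.\<close>

lemma lt_hom_integral:
  assumes "lt_series P" "lt_series Q" "a \<in> R"
  shows "lt_hom P Q a \<in> R1"
proof -
  have "fun_eq (fps_X ^ q) (c2 a * (lift (log Q) oo fps_X))"
    using assms by (intro fun_eq_const_mult fun_eq_log frob_series_X_power fps_over_X R1) auto
  from exp_integral[OF assms(1) frob_series_X_power this]
  have "lift (lt_hom P Q a) \<in> R2" by (simp add: lt_hom_def)
  then show ?thesis by (simp add: fps_over_lift_iff[OF R])
qed

lemma log_lt_hom: "log P oo lt_hom P Q a = fps_const a * log Q"
  unfolding lt_hom_def by (rule log_exp_compose) simp

lemma lt_hom_compose: "lt_hom P Q a oo lt_hom Q Q' b = lt_hom P Q' (a * b)"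
proof -
  have "lt_hom P Q a oo lt_hom Q Q' b = exp P oo ((fps_const a * log Q) oo lt_hom Q Q' b)"
    by (simp add: lt_hom_def[of P] fps_compose_assoc)
  also have "\<dots> = lt_hom P Q' (a * b)"
    by (simp add: fps_const_mult_compose log_lt_hom) (simp add: lt_hom_def mult.assoc[symmetric])
  finally show ?thesis .
qed

lemma lt_hom_compose_lt:
  assumes "lt_series Q"
  shows "lt_hom P Q a oo Q = lt_hom P Q (a * \<pi>)"
  using assms lt_series_simps[OF assms]
  by (simp add: lt_hom_def fps_compose_assoc[symmetric] fps_const_mult_compose log_lt mult.assoc[symmetric])

lemma lt_eq_lt_hom:
  assumes "lt_series P"
  shows "P = lt_hom P P \<pi>"
  using log_lt[OF assms] exp_log_compose[of P P] lt_series_simps[OF assms] by (simp add: lt_hom_def)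

lemma lt_hom_one: "lt_hom P P 1 = fps_X"
  by (simp add: lt_hom_def exp_log)

lemma fps_iter_eq_lt_hom:
  assumes "lt_series P"
  shows "fps_iter P i = lt_hom P P (\<pi> ^ i)"
  by (induction i) (simp_all add: lt_hom_one lt_hom_compose_lt[OF assms] mult.commute)

text \<open>The defect log P(A) - a log P has no linear term and is multiplied by \<pi> under
  composition with P, so \<open>lt_eigen_unique\<close> applies.\<close>

lemma lt_mult_unique:
  assumes P: "lt_series P" and A: "A $ 0 = 0" "A $ 1 = a" "P oo A = A oo P"
  shows "A = lt_hom P P a"
proof -
  note P' = lt_series_simps[OF P]
  define D where "D = (log P oo A) - fps_const a * log P"
  have "(log P oo A) oo P = log P oo (P oo A)" using P'(2) A(1) by (simp add: fps_compose_assoc A(3))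
  also have "\<dots> = (log P oo P) oo A" using P'(2) A(1) by (simp add: fps_compose_assoc)
  also have "\<dots> = \<pi>1 * (log P oo A)" using A(1) by (simp add: log_lt[OF P] fps_const_mult_compose)
  finally have "D oo P = \<pi>1 * D"
    using P'(2) by (simp add: D_def fps_compose_sub_distrib fps_const_mult_compose log_lt[OF P] algebra_simps)
  moreover have "D $ 0 = 0" "D $ 1 = 0"
    using A(1,2) by (simp_all add: D_def fps_compose_nth)
  ultimately have "D = 0" by (rule lt_eigen_unique[OF P])
  then have "log P oo A = fps_const a * log P" by (simp add: D_def)
  then show ?thesis using exp_log_compose[of A P] A(1) by (simp add: lt_hom_def)
qed

end

section \<open>The formal group\<close>

text \<open>F(a, b) for series a, b without constant term: then a^r b^s has order at least r + s, so
  the truncated sum is complete.\<close>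

definition comp2 :: "'a::comm_ring_1 fps fps \<Rightarrow> 'a fps \<Rightarrow> 'a fps \<Rightarrow> 'a fps" where
  "comp2 F a b = Abs_fps (\<lambda>n. \<Sum>(r, s)\<in>{(r, s). r + s \<le> n}. F $ r $ s * (a ^ r * b ^ s) $ n)"

text \<open>The series \<open>e(l(X) + l(Y))\<close>, defined by coefficients because \<open>l(X) + l(Y)\<close> has a nonzero
  constant term as a series in \<open>X\<close>.\<close>

definition exp_law :: "'a::comm_ring_1 fps \<Rightarrow> 'a fps \<Rightarrow> 'a fps fps" where
  "exp_law e l = Abs_fps (\<lambda>r. Abs_fps (\<lambda>s.
     \<Sum>t\<le>r + s. e $ t * (\<Sum>u\<le>t. of_nat (t choose u) * (l ^ u) $ r * (l ^ (t - u)) $ s)))"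

lemma finite_pairs_le: "finite {(r, s). r + s \<le> (n::nat)}"
  by (rule finite_subset[of _ "{..n} \<times> {..n}"]) auto

text \<open>The binomial theorem for (l(a) + l(b))^t, regrouped by powers of a and b.\<close>

lemma comp2_exp_law:
  fixes e l :: "'a::idom fps"
  assumes l: "l $ 0 = 0" and a: "a $ 0 = 0" and b: "b $ 0 = 0"
  shows "comp2 (exp_law e l) a b = e oo ((l oo a) + (l oo b))"
proof (rule fps_ext)
  fix n :: nat
  let ?T = "{(r, s). r + s \<le> n}"
  let ?c = "\<lambda>t r s. e $ t * (\<Sum>u\<le>t. of_nat (t choose u) * (l ^ u) $ r * (l ^ (t - u)) $ s)"
  \<comment> \<open>l^u has order at least u and l^(t - u) order at least t - u, so the cut-off t <=
    r + s in \<open>exp_law\<close> loses nothing.\<close>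
  have vanish: "?c t r s = 0" if "t > r + s" for t r s
  proof -
    have "(l ^ u) $ r * (l ^ (t - u)) $ s = 0" if "u \<le> t" for u
    proof (cases "u > r")
      case True
      then show ?thesis by (simp add: fps_power_nth_eq_0[OF l])
    next
      case False
      then have "t - u > s" using \<open>t > r + s\<close> by simp
      then show ?thesis by (simp add: fps_power_nth_eq_0[OF l])
    qed
    then have "of_nat (t choose u) * (l ^ u) $ r * (l ^ (t - u)) $ s = 0" if "u \<le> t" for u
      using that by (simp only: mult.assoc mult_zero_right)
    then have "(\<Sum>u\<le>t. of_nat (t choose u) * (l ^ u) $ r * (l ^ (t - u)) $ s) = 0"
      by (intro sum.neutral) blast
    then show ?thesis by (simp only: mult_zero_right)
  qed
  have pow: "(((l oo a) + (l oo b)) ^ t) $ n = (\<Sum>u\<le>t. \<Sum>(r, s)\<in>?T.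
      of_nat (t choose u) * (l ^ u) $ r * (l ^ (t - u)) $ s * (a ^ r * b ^ s) $ n)" for t
  proof -
    have "((l oo a) + (l oo b)) ^ t = (\<Sum>u\<le>t. of_nat (t choose u) * ((l ^ u oo a) * (l ^ (t - u) oo b)))"
      by (simp add: binomial_ring fps_compose_power[OF a] fps_compose_power[OF b] mult.assoc)
    then show ?thesis
      by (simp add: fps_sum_nth fps_of_nat[symmetric] product_composition_lemma[OF a b] sum_distrib_left
          split_def mult.assoc)
  qed
  have "(e oo ((l oo a) + (l oo b))) $ n = (\<Sum>t\<le>n. e $ t * (\<Sum>u\<le>t. \<Sum>(r, s)\<in>?T.
      of_nat (t choose u) * (l ^ u) $ r * (l ^ (t - u)) $ s * (a ^ r * b ^ s) $ n))"
    by (simp add: fps_compose_nth pow atMost_atLeast0)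
  also have "\<dots> = (\<Sum>t\<le>n. e $ t * (\<Sum>(r, s)\<in>?T. \<Sum>u\<le>t.
      of_nat (t choose u) * (l ^ u) $ r * (l ^ (t - u)) $ s * (a ^ r * b ^ s) $ n))"
    by (subst sum.swap) (simp add: split_def)
  also have "\<dots> = (\<Sum>t\<le>n. \<Sum>(r, s)\<in>?T. ?c t r s * (a ^ r * b ^ s) $ n)"
    by (simp add: split_def sum_distrib_left sum_distrib_right mult.assoc)
  also have "\<dots> = (\<Sum>(r, s)\<in>?T. \<Sum>t\<le>n. ?c t r s * (a ^ r * b ^ s) $ n)"
    by (subst sum.swap) (simp add: split_def)
  also have "\<dots> = (\<Sum>(r, s)\<in>?T. (\<Sum>t\<le>r + s. ?c t r s) * (a ^ r * b ^ s) $ n)"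
  proof (rule sum.cong[OF refl], clarify)
    fix r s assume rs: "r + s \<le> n"
    have "(\<Sum>t\<le>n. ?c t r s * (a ^ r * b ^ s) $ n) = (\<Sum>t\<le>r + s. ?c t r s * (a ^ r * b ^ s) $ n)"
      using rs vanish by (intro sum.mono_neutral_right) auto
    then show "(\<Sum>t\<le>n. ?c t r s * (a ^ r * b ^ s) $ n) = (\<Sum>t\<le>r + s. ?c t r s) * (a ^ r * b ^ s) $ n"
      by (simp add: sum_distrib_right)
  qed
  finally show "comp2 (exp_law e l) a b $ n = (e oo ((l oo a) + (l oo b))) $ n"
    by (simp add: comp2_def exp_law_def)
qed

lemma hom_on_of_nat: "hom_on D h \<Longrightarrow> h (of_nat n) = of_nat n"
  by (induction n)
    (auto simp: hom_on_0 hom_on_1 hom_on_add subring_of_nat[OF hom_on_subring] subring_1[OF hom_on_subring])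

lemma map_exp_law:
  assumes h: "hom_on UNIV h"
  shows "map_fps (map_fps h) (exp_law e l) = exp_law (map_fps h e) (map_fps h l)"
proof -
  have pow: "map_fps h l ^ i = map_fps h (l ^ i)" for i
    using map_fps_power[OF h, of l i] by simp
  show ?thesis
    using h by (auto simp: fps_eq_iff exp_law_def pow hom_on_sum[OF h] hom_on_mult[OF h] hom_on_of_nat[OF h])
qed

text \<open>Sorting the terms by total degree moves the substitutions of \<open>Defs\<close> to series without
  constant term, where the library composition applies.\<close>

definition grad :: "'a::comm_ring_1 fps fps fps \<Rightarrow> 'a fps fps fps fps" where
  "grad A = Abs_fps (\<lambda>n. Abs_fps (\<lambda>i. Abs_fps (\<lambda>j. Abs_fps (\<lambda>k.
     if i + j + k = n then A $ i $ j $ k else 0))))"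

lemma grad_nth: "grad A $ n $ i $ j $ k = (if i + j + k = n then A $ i $ j $ k else 0)"
  by (simp add: grad_def)

lemma grad_eqI: "grad A = grad B \<Longrightarrow> A = B"
proof (intro fps_ext)
  fix i j k assume "grad A = grad B"
  then have "grad A $ (i + j + k) $ i $ j $ k = grad B $ (i + j + k) $ i $ j $ k" by simp
  then show "A $ i $ j $ k = B $ i $ j $ k" by (simp add: grad_nth)
qed

lemma fps3_mult_nth:
  "(A * B) $ i $ j $ k = (\<Sum>a=0..i. \<Sum>b=0..j. \<Sum>c=0..k. A $ a $ b $ c * B $ (i - a) $ (j - b) $ (k - c))"
  by (simp add: fps_mult_nth fps_sum_nth)

text \<open>\<open>grad A\<close> is A(uX, uY, uZ) with u outermost. Degrees add under
  multiplication, so for fixed exponents only m = a + b + c contributes.\<close>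

lemma grad_mult: "grad (A * B) = grad A * grad B"
proof (intro fps_ext)
  fix n i j k
  have "(grad A * grad B) $ n $ i $ j $ k = (\<Sum>m=0..n. \<Sum>a=0..i. \<Sum>b=0..j. \<Sum>c=0..k.
      grad A $ m $ a $ b $ c * grad B $ (n - m) $ (i - a) $ (j - b) $ (k - c))"
    unfolding fps_mult_nth[of "grad A"] by (simp add: fps_sum_nth fps3_mult_nth)
  also have "\<dots> = (\<Sum>a=0..i. \<Sum>b=0..j. \<Sum>c=0..k. \<Sum>m=0..n.
      grad A $ m $ a $ b $ c * grad B $ (n - m) $ (i - a) $ (j - b) $ (k - c))"
    by (simp only: sum.swap[of _ "{0..n}"])
  also have "\<dots> = (\<Sum>a=0..i. \<Sum>b=0..j. \<Sum>c=0..k.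
      if i + j + k = n then A $ a $ b $ c * B $ (i - a) $ (j - b) $ (k - c) else 0)"
  proof (intro sum.cong refl)
    fix a b c assume *: "a \<in> {0..i}" "b \<in> {0..j}" "c \<in> {0..k}"
    have "(\<Sum>m=0..n. grad A $ m $ a $ b $ c * grad B $ (n - m) $ (i - a) $ (j - b) $ (k - c)) =
        (\<Sum>m=0..n. if m = a + b + c then (if i + j + k = n then A $ a $ b $ c * B $ (i - a) $ (j - b) $ (k - c) else 0) else 0)"
      using * by (intro sum.cong refl) (auto simp: grad_nth)
    also have "\<dots> = (if i + j + k = n then A $ a $ b $ c * B $ (i - a) $ (j - b) $ (k - c) else 0)"
      using * by (auto simp: sum.delta)
    finally show "(\<Sum>m=0..n. grad A $ m $ a $ b $ c * grad B $ (n - m) $ (i - a) $ (j - b) $ (k - c)) =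
      (if i + j + k = n then A $ a $ b $ c * B $ (i - a) $ (j - b) $ (k - c) else 0)" .
  qed
  also have "\<dots> = grad (A * B) $ n $ i $ j $ k"
    by (simp add: grad_nth fps3_mult_nth)
  finally show "grad (A * B) $ n $ i $ j $ k = (grad A * grad B) $ n $ i $ j $ k" by simp
qed

lemma hom_on_grad: "hom_on UNIV grad"
proof -
  have "grad 1 = 1"
    by (intro fps_ext) (auto simp: grad_nth)
  then show ?thesis
    by (auto simp: hom_on_def subring_UNIV grad_mult fps_eq_iff grad_nth)
qed

lemmas grad_power = hom_on_power[OF hom_on_grad UNIV_I]

abbreviation const3 :: "'a::zero \<Rightarrow> 'a fps fps fps" where
  "const3 c \<equiv> fps_const (fps_const (fps_const c))"

abbreviation lift3 :: "'a::zero fps \<Rightarrow> 'a fps fps fps fps" where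
  "lift3 \<equiv> map_fps const3"

lemma hom_on_const3: "hom_on UNIV (const3 :: 'a::comm_ring_1 \<Rightarrow> _)"
  by (simp add: hom_on_def subring_UNIV)

text \<open>The bound r <= i + j + k of \<open>subst1\<close> is exactly the bound r <= n of
  ordinary composition in the grading variable.\<close>

lemma grad_subst1: "grad (subst1 f A) = lift3 f oo grad A"
proof (intro fps_ext)
  fix n i j k
  have "(lift3 f oo grad A) $ n $ i $ j $ k = (\<Sum>r=0..n. f $ r * (if i + j + k = n then (A ^ r) $ i $ j $ k else 0))"
    by (simp add: fps_compose_nth fps_sum_nth grad_power[symmetric] grad_nth)
  also have "\<dots> = grad (subst1 f A) $ n $ i $ j $ k"
    by (simp add: grad_nth subst1_def atMost_atLeast0)
  finally show "grad (subst1 f A) $ n $ i $ j $ k = (lift3 f oo grad A) $ n $ i $ j $ k" by simp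
qed

lemma grad_subst2: "grad (subst2 F A B) = comp2 (map_fps (map_fps const3) F) (grad A) (grad B)"
proof (intro fps_ext)
  fix n i j k
  have "grad A ^ r * grad B ^ s = grad (A ^ r * B ^ s)" for r s
    by (simp add: grad_mult grad_power)
  then have "comp2 (map_fps (map_fps const3) F) (grad A) (grad B) $ n $ i $ j $ k =
      (\<Sum>(r, s)\<in>{(r, s). r + s \<le> n}. F $ r $ s * (if i + j + k = n then (A ^ r * B ^ s) $ i $ j $ k else 0))"
    by (simp only: comp2_def) (simp add: fps_sum_nth split_def grad_nth)
  also have "\<dots> = grad (subst2 F A B) $ n $ i $ j $ k"
    by (simp add: grad_nth subst2_def split_def)
  finally show "grad (subst2 F A B) $ n $ i $ j $ k = comp2 (map_fps (map_fps const3) F) (grad A) (grad B) $ n $ i $ j $ k"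
    by simp
qed

lemma grad_var: "grad varX = fps_const varX * fps_X" "grad varY = fps_const varY * fps_X"
  "grad varZ = fps_const varZ * fps_X"
  by (auto simp: fps_eq_iff grad_nth varX_def varY_def varZ_def)

lemma comp2_nth_0: "comp2 F a b $ 0 = F $ 0 $ 0"
proof -
  have "{(r, s). r + s \<le> (0::nat)} = {(0, 0)}" by auto
  then show ?thesis by (simp add: comp2_def)
qed

lemma fps_power_mult_nth_same:
  fixes a b :: "'a::idom fps"
  assumes "a $ 0 = 0" "b $ 0 = 0"
  shows "(a ^ r * b ^ s) $ (r + s) = (a $ 1) ^ r * (b $ 1) ^ s"
proof -
  have "(a ^ r) $ i * (b ^ s) $ (r + s - i) = (if i = r then (a $ 1) ^ r * (b $ 1) ^ s else 0)"
    if "i \<le> r + s" for i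
  proof -
    consider "i < r" | "i = r" | "i > r" by linarith
    then show ?thesis
    proof cases
      case 3
      then have "r + s - i < s" using that by simp
      then show ?thesis using 3 by (simp add: fps_power_nth_eq_0[OF assms(2)])
    qed (auto simp: fps_power_nth_eq_0[OF assms(1)] startsby_zero_power_nth_same assms)
  qed
  then have "(a ^ r * b ^ s) $ (r + s) = (\<Sum>i=0..r + s. if i = r then (a $ 1) ^ r * (b $ 1) ^ s else 0)"
    unfolding fps_mult_nth by (intro sum.cong) auto
  then show ?thesis by simp
qed

lemma fps_X_plus_const_power_nth_1:
  "((fps_X + fps_const c) ^ n :: 'a::comm_ring_1 fps) $ 1 = of_nat n * c ^ (n - 1)"
proof (induction n)
  case (Suc n)
  have "((fps_X + fps_const c) ^ n) $ 0 = c ^ n"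
    by (simp add: fps_power_zeroth)
  then have "((fps_X + fps_const c) ^ Suc n) $ 1 = c * (of_nat n * c ^ (n - 1)) + c ^ n"
    using Suc by (simp add: distrib_right fps_mult_nth)
  then show ?case
    by (cases n) (auto simp: algebra_simps)
qed auto

section \<open>The formal group law of a Lubin-Tate series and its exponential\<close>

context lubin_tate
begin

definition FG :: "'a fps \<Rightarrow> 'a fps fps" where
  "FG P = exp_law (exp P) (log P)"

lemma grad_subst2_FG:
  assumes "grad A $ 0 = 0" "grad B $ 0 = 0"
  shows "grad (subst2 (FG P) A B) = lift3 (exp P) oo ((lift3 (log P) oo grad A) + (lift3 (log P) oo grad B))"
  unfolding grad_subst2 FG_def map_exp_law[OF hom_on_const3]
  by (rule comp2_exp_law) (use assms in auto)

lemma lift3_compose: "lift3 (f oo g) = lift3 f oo lift3 (g :: 'a fps)"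
  using map_fps_compose[OF hom_on_const3, of f g] by simp

lemma lift3_X: "lift3 (fps_X :: 'a fps) = fps_X"
  by (auto simp: fps_eq_iff)

lemma lift3_log_exp: "x $ 0 = 0 \<Longrightarrow> lift3 (log P) oo (lift3 (exp P) oo x) = x"
  by (simp add: fps_compose_assoc lift3_compose[symmetric] log_exp lift3_X)

lemma lift3_exp_log: "x $ 0 = 0 \<Longrightarrow> lift3 (exp P) oo (lift3 (log P) oo x) = x"
  by (simp add: fps_compose_assoc lift3_compose[symmetric] exp_log lift3_X)

lemma grad_var_nth_0: "grad varX $ 0 = 0" "grad varY $ 0 = 0" "grad varZ $ 0 = 0"
  by (simp_all add: grad_var)

lemma FG_nth: "FG P $ 0 $ 0 = 0" "FG P $ 1 $ 0 = 1" "FG P $ 0 $ 1 = 1"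
  by (simp_all add: FG_def exp_law_def)

text \<open>Substituting X = T and Y = c T, with c the inner variable, reduces to
  \<open>exp_integral\<close>. Coefficient (r, s) of the law is recovered as that of T^(r + s)
  c^s.\<close>

lemma FG_integral:
  assumes P: "lt_series P"
  shows "FG P \<in> fps2_over R"
proof -
  define c :: "'a fps fps" where "c = fps_const fps_X"
  define F' :: "'a fps fps fps" where "F' = map_fps (map_fps fps_const) (FG P)"
  have c: "c \<in> R2" unfolding c_def by (intro fps_over_const R1 fps_over_X R)
  have X: "fps_X \<in> R2" by (rule fps_over_X[OF R1])
  have "fun_eq (fps_X ^ q) ((lift (log P) oo fps_X) + (lift (log P) oo (c * fps_X)))"
    by (intro fun_eq_add fun_eq_log P frob_series_X_power subring_mult[OF R2] c X) auto
  then have "lift (exp P) oo ((lift (log P) oo fps_X) + (lift (log P) oo (c * fps_X))) \<in> R2"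
    by (rule exp_integral[OF P frob_series_X_power])
  also have "lift (exp P) oo ((lift (log P) oo fps_X) + (lift (log P) oo (c * fps_X))) = comp2 F' fps_X (c * fps_X)"
    unfolding F'_def FG_def map_exp_law[OF hom_on_const]
    by (rule comp2_exp_law[symmetric]) auto
  finally have int: "comp2 F' fps_X (c * fps_X) $ n $ k \<in> R" for n k
    by (intro fps_overD)
  have "FG P $ r $ s \<in> R" for r s
  proof -
    have pw: "(fps_X ^ r' * (c * fps_X) ^ s') $ (r + s) = (if r' + s' = r + s then fps_X ^ s' else 0)" for r' s'
    proof -
      have "fps_X ^ r' * (c * fps_X) ^ s' = c ^ s' * fps_X ^ (r' + s')"
        by (simp add: power_mult_distrib power_add ac_simps)
      moreover have "c ^ s' = fps_const (fps_X ^ s')"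
        by (simp only: c_def fps_const_power)
      ultimately show ?thesis
        by (simp only: fps_mult_left_const_nth fps_X_power_nth) auto
    qed
    have "comp2 F' fps_X (c * fps_X) $ (r + s) $ s =
        (\<Sum>x\<in>{(r', s'). r' + s' \<le> r + s}. if x = (r, s) then FG P $ r $ s else 0)"
      unfolding comp2_def
      by (auto simp: fps_sum_nth pw F'_def intro!: sum.cong)
    also have "\<dots> = FG P $ r $ s"
      using finite_pairs_le[of "r + s"] by (simp add: sum.delta)
    finally show ?thesis using int[of "r + s" s] by simp
  qed
  then show ?thesis by (simp add: fps2_over_def)
qed

lemma subst1_const_mult_log:
  assumes "x $ 0 = 0"
  shows "lift3 (fps_const a * log P) oo x = fps_const (const3 a) * (lift3 (log P) oo x)"
proof -
  have "lift3 (fps_const a * log P) = fps_const (const3 a) * lift3 (log P)"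
    by (simp add: fps_eq_iff)
  then show ?thesis using assms by (simp add: fps_const_mult_compose)
qed

lemma lift3_log_lt:
  assumes P: "lt_series P" and x: "x $ 0 = 0"
  shows "lift3 (log P) oo (lift3 P oo x) = fps_const (const3 \<pi>) * (lift3 (log P) oo x)"
proof -
  have "lift3 (log P) oo (lift3 P oo x) = lift3 (log P oo P) oo x"
    using x lt_series_simps[OF P] by (simp add: lift3_compose fps_compose_assoc)
  then show ?thesis using subst1_const_mult_log[OF x] by (simp only: log_lt[OF P])
qed

lemma lift3_lt_exp:
  assumes P: "lt_series P" and x: "x $ 0 = 0"
  shows "lift3 P oo (lift3 (exp P) oo x) = lift3 (exp P) oo (fps_const (const3 \<pi>) * x)"
proof -
  define y where "y = lift3 (exp P) oo x"
  have y: "y $ 0 = 0" by (simp add: y_def)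
  have "lift3 (exp P) oo (fps_const (const3 \<pi>) * (lift3 (log P) oo y)) = lift3 P oo y"
    using lift3_exp_log[of "lift3 P oo y" P] lt_series_simps[OF P] by (simp add: lift3_log_lt[OF P y])
  then show ?thesis by (simp add: y_def lift3_log_exp[OF x])
qed

text \<open>In graded form both sides are exp_P(\<pi> (log_P X + log_P Y)).\<close>

lemma FG_commutes:
  assumes P: "lt_series P"
  shows "subst1 P (subst2 (FG P) varX varY) = subst2 (FG P) (subst1 P varX) (subst1 P varY)"
proof (rule grad_eqI)
  have "grad (subst1 P A) $ 0 = 0" if "grad A $ 0 = 0" for A
    using that lt_series_simps[OF P] by (simp add: grad_subst1)
  then show "grad (subst1 P (subst2 (FG P) varX varY)) = grad (subst2 (FG P) (subst1 P varX) (subst1 P varY))"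
    by (simp add: grad_subst2_FG grad_var_nth_0 grad_subst1[of _ "subst2 _ _ _"] lift3_lt_exp[OF P])
      (simp add: grad_subst1 lift3_log_lt[OF P] grad_var_nth_0 distrib_left)
qed

text \<open>In graded form associativity and commutativity become those of adding
  logarithms.\<close>

lemma FG_formal_group:
  assumes P: "lt_series P"
  shows "comm_formal_group R (FG P)"
proof -
  have "subst2 (FG P) varX (subst2 (FG P) varY varZ) = subst2 (FG P) (subst2 (FG P) varX varY) varZ"
    by (rule grad_eqI)
      (simp add: grad_subst2_FG grad_var_nth_0 lift3_log_exp add.assoc)
  moreover have "subst2 (FG P) varX varY = subst2 (FG P) varY varX"
    by (rule grad_eqI) (simp add: grad_subst2_FG grad_var_nth_0 add.commute)
  ultimately show ?thesis
    using FG_integral[OF P] FG_nth by (simp add: comm_formal_group_def)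
qed

text \<open>Induction on the total degree n. If both laws agree below n, let D be the difference of
  their degree n parts. Applying P to the laws multiplies D by \<pi>, inserting P into the arguments
  multiplies it by \<pi>^n, and these differ for n >= 2.\<close>

lemma FG_unique:
  assumes P: "lt_series P"
    and F: "F $ 0 $ 0 = 0" "F $ 1 $ 0 = 1" "F $ 0 $ 1 = 1"
    and comm: "subst1 P (subst2 F varX varY) = subst2 F (subst1 P varX) (subst1 P varY)"
  shows "F = FG P"
proof -
  define c3 where "c3 = (map_fps (map_fps const3) :: 'a fps fps \<Rightarrow> _)"
  define x where "x = (fps_const varX * fps_X :: 'a fps fps fps fps)"
  define y where "y = (fps_const varY * fps_X :: 'a fps fps fps fps)"
  \<comment> \<open>\<open>U G\<close> is G(uX, uY) for the grading variable u; its coefficient n is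
    the homogeneous part of degree n.\<close>
  define U where "U = (\<lambda>F. comp2 (c3 F) x y)"
  have xy0: "x $ 0 = 0" "y $ 0 = 0" "x $ 1 = varX" "y $ 1 = varY" by (simp_all add: x_def y_def)
  have xy: "x ^ r * y ^ s = fps_const (varX ^ r * varY ^ s) * fps_X ^ (r + s)" for r s
  proof -
    have "x ^ r * y ^ s = fps_const varX ^ r * fps_const varY ^ s * fps_X ^ (r + s)"
      unfolding x_def y_def by (simp only: power_mult_distrib power_add ac_simps)
    then show ?thesis by (simp only: fps_const_power fps_const_mult)
  qed
  have U_nth: "U G $ n = (\<Sum>(r, s)\<in>{(r, s). r + s = n}. const3 (G $ r $ s) * (varX ^ r * varY ^ s))" for G n
  proof -
    have "U G $ n = (\<Sum>(r, s)\<in>{(r, s). r + s \<le> n}. const3 (G $ r $ s) * (x ^ r * y ^ s) $ n)"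
      by (simp add: U_def comp2_def c3_def)
    also have "\<dots> = (\<Sum>(r, s)\<in>{(r, s). r + s = n}. const3 (G $ r $ s) * (x ^ r * y ^ s) $ n)"
      using finite_pairs_le[of n]
      by (intro sum.mono_neutral_right)
        (auto simp only: xy fps_mult_left_const_nth fps_X_power_nth split_def mem_Collect_eq, auto split: if_splits)
    also have "\<dots> = (\<Sum>(r, s)\<in>{(r, s). r + s = n}. const3 (G $ r $ s) * (varX ^ r * varY ^ s))"
      by (intro sum.cong refl) (auto simp only: xy fps_mult_left_const_nth fps_X_power_nth split_def mem_Collect_eq, auto)
    finally show ?thesis .
  qed
  have eq: "lift3 P oo U G = comp2 (c3 G) (lift3 P oo x) (lift3 P oo y)"
    if "subst1 P (subst2 G varX varY) = subst2 G (subst1 P varX) (subst1 P varY)" for G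
    using arg_cong[OF that, of grad]
    by (simp add: grad_subst1 grad_subst2 grad_var U_def c3_def x_def y_def)
  have same: "F $ i $ j = FG P $ i $ j" if "i + j = n" for n i j
    using that
  proof (induction n arbitrary: i j rule: less_induct)
    case (less n)
    have IH: "F $ i $ j = FG P $ i $ j" if "i + j < n" for i j
      using less.IH[OF that] by simp
    consider "n = 0" | "n = 1" | "n \<ge> 2" by linarith
    then show ?case
    proof cases
      case 1
      then show ?thesis using less.prems F FG_nth by simp
    next
      case 2
      then have "i = 1 \<and> j = 0 \<or> i = 0 \<and> j = 1" using less.prems by auto
      then show ?thesis using F FG_nth[of P] by auto
    next
      case 3
      have below: "U F $ m = U (FG P) $ m" if "m < n" for m
        unfolding U_nth using that IH by (intro sum.cong) auto
      have Px: "(lift3 P oo x) $ 0 = 0" "(lift3 P oo y) $ 0 = 0"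
        "(lift3 P oo x) $ 1 = const3 \<pi> * varX" "(lift3 P oo y) $ 1 = const3 \<pi> * varY"
        using lt_series_simps[OF P] xy0 by (simp_all add: fps_compose_nth)
      define a where "a = lift3 P oo x"
      define b where "b = lift3 P oo y"
      have ab: "(a ^ r * b ^ s) $ n = const3 (\<pi> ^ n) * (varX ^ r * varY ^ s)" if "r + s = n" for r s
      proof -
        have "(a ^ r * b ^ s) $ n = (const3 \<pi> * varX) ^ r * (const3 \<pi> * varY) ^ s"
          using fps_power_mult_nth_same[of a b r s] Px that by (simp add: a_def b_def)
        also have "\<dots> = const3 \<pi> ^ (r + s) * (varX ^ r * varY ^ s)"
          by (simp only: power_mult_distrib power_add ac_simps)
        also have "const3 \<pi> ^ (r + s) = const3 (\<pi> ^ n)"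
          by (simp only: that fps_const_power)
        finally show ?thesis .
      qed
      have "U F $ 0 = 0" "U (FG P) $ 0 = 0"
        using F FG_nth by (simp_all add: U_def comp2_nth_0 c3_def)
      then have "(lift3 P oo U F) $ n - (lift3 P oo U (FG P)) $ n = const3 \<pi> * (U F $ n - U (FG P) $ n)"
        using fps_compose_agree_next[of "U F" "U (FG P)" n "lift3 P"] below lt_series_simps[OF P] by simp
      moreover have "(lift3 P oo U F) $ n - (lift3 P oo U (FG P)) $ n = const3 (\<pi> ^ n) * (U F $ n - U (FG P) $ n)"
      proof -
        have "(lift3 P oo U F) $ n - (lift3 P oo U (FG P)) $ n = comp2 (c3 F) a b $ n - comp2 (c3 (FG P)) a b $ n"
          unfolding eq[OF comm] eq[OF FG_commutes[OF P]] a_def b_def ..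
        also have "\<dots> = (\<Sum>(r, s)\<in>{(r, s). r + s \<le> n}. const3 (F $ r $ s - FG P $ r $ s) * (a ^ r * b ^ s) $ n)"
          by (simp add: comp2_def c3_def sum_subtractf[symmetric] split_def left_diff_distrib
              fps_const_sub[symmetric] del: fps_const_sub)
        also have "\<dots> = (\<Sum>(r, s)\<in>{(r, s). r + s = n}. const3 (F $ r $ s - FG P $ r $ s) * (a ^ r * b ^ s) $ n)"
        proof (intro sum.mono_neutral_right finite_pairs_le ballI)
          fix z assume "z \<in> {(r, s). r + s \<le> n} - {(r, s). r + s = n}"
          then obtain r s where z: "z = (r, s)" "r + s < n" by (cases z) auto
          show "(case z of (r, s) \<Rightarrow> const3 (F $ r $ s - FG P $ r $ s) * (a ^ r * b ^ s) $ n) = 0"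
            by (simp add: z(1) IH[OF z(2)])
        qed auto
        also have "\<dots> = (\<Sum>(r, s)\<in>{(r, s). r + s = n}. const3 (\<pi> ^ n) *
            (const3 (F $ r $ s) * (varX ^ r * varY ^ s) - const3 (FG P $ r $ s) * (varX ^ r * varY ^ s)))"
        proof (intro sum.cong refl, clarify)
          fix r s assume n: "n = r + s"
          have diff: "const3 (F $ r $ s - FG P $ r $ s) = const3 (F $ r $ s) - const3 (FG P $ r $ s)" by simp
          show "const3 (F $ r $ s - FG P $ r $ s) * (a ^ r * b ^ s) $ (r + s) = const3 (\<pi> ^ (r + s)) *
            (const3 (F $ r $ s) * (varX ^ r * varY ^ s) - const3 (FG P $ r $ s) * (varX ^ r * varY ^ s))"
            unfolding diff ab[OF n[symmetric], unfolded n] by (simp only: algebra_simps)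
        qed
        also have "\<dots> = const3 (\<pi> ^ n) * (U F $ n - U (FG P) $ n)"
          by (simp only: U_nth split_def sum_distrib_left[symmetric] sum_subtractf)
        finally show ?thesis .
      qed
      ultimately have "(const3 \<pi> - const3 (\<pi> ^ n)) * (U F $ n - U (FG P) $ n) = 0"
        by (simp only: left_diff_distrib diff_self)
      moreover have "const3 \<pi> - const3 (\<pi> ^ n) \<noteq> 0"
        using pi_power_neq[OF 3] by simp
      ultimately have "U F $ n = U (FG P) $ n" by simp
      then have Un: "U F $ n $ i $ j $ 0 = U (FG P) $ n $ i $ j $ 0" by simp
      have "U G $ n $ i $ j $ 0 = G $ i $ j" for G
      proof -
        have "U G $ n $ i $ j $ 0 = (\<Sum>z\<in>{(r, s). r + s = n}. if z = (i, j) then G $ i $ j else 0)"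
        proof -
          have eq: "(varX ^ r * varY ^ s :: 'a fps fps fps) $ i $ j $ 0 = (if r = i \<and> s = j then 1 else 0)" for r s
          proof -
          have "varX ^ r * varY ^ s = fps_const (fps_X ^ s) * (fps_X ^ r :: 'a fps fps fps)"
            by (simp only: varX_def varY_def fps_const_power mult.commute)
          then show ?thesis
            by (simp only: fps_mult_left_const_nth fps_X_power_nth) auto
          qed
          show ?thesis
            unfolding U_nth fps_sum_nth split_def fps_mult_left_const_nth eq
            by (intro sum.cong refl) auto
        qed
        also have "\<dots> = G $ i $ j"
        proof -
          have "finite {(r, s). r + s = n}"
            by (rule finite_subset[OF _ finite_pairs_le[of n]]) auto
          then show ?thesis using less.prems by (simp add: sum.delta)
        qed
        finally show ?thesis .
      qed
      then show ?thesis using Un by simp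
    qed
  qed
  show ?thesis by (intro fps_ext) (rule same[OF refl])
qed

lemma exp_homomorphism:
  "subst1 (exp P) (varX + varY) = subst2 (FG P) (subst1 (exp P) varX) (subst1 (exp P) varY)"
proof (rule grad_eqI)
  have "grad (varX + varY :: 'a fps fps fps) = grad varX + grad varY"
    by (rule hom_on_add[OF hom_on_grad]) auto
  then show "grad (subst1 (exp P) (varX + varY)) = grad (subst2 (FG P) (subst1 (exp P) varX) (subst1 (exp P) varY))"
    by (simp add: grad_subst2_FG grad_subst1 grad_var_nth_0 lift3_log_exp)
qed

text \<open>g = log_P(e) is additive. Coefficient X Y^(n - 1) of g(X + Y) is n times the n-th
  coefficient of g and must vanish for n >= 2; in characteristic 0 this leaves g = X.\<close>

lemma exp_unique:
  assumes e: "e $ 0 = 0" "e $ 1 = 1"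
    and hom: "subst1 e (varX + varY) = subst2 (FG P) (subst1 e varX) (subst1 e varY)"
  shows "e = exp P"
proof -
  define g where "g = log P oo e"
  have add: "grad (varX + varY :: 'a fps fps fps) = fps_const (varX + varY) * fps_X"
    using hom_on_add[OF hom_on_grad, of "varX :: 'a fps fps fps" varY]
    by (simp add: grad_var distrib_right fps_const_add[symmetric] del: fps_const_add)
  have g_comp: "lift3 (log P) oo (lift3 e oo x) = lift3 g oo x" if "x $ 0 = 0" for x
    using that e by (simp add: g_def lift3_compose fps_compose_assoc)
  have "lift3 e oo grad (varX + varY) =
      lift3 (exp P) oo ((lift3 g oo grad varX) + (lift3 g oo grad varY))"
    using arg_cong[OF hom, of grad] e
    by (simp add: grad_subst1 grad_subst2_FG grad_var_nth_0 g_comp)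
  then have "lift3 (log P) oo (lift3 e oo grad (varX + varY)) = (lift3 g oo grad varX) + (lift3 g oo grad varY)"
    by (simp add: lift3_log_exp g_def grad_var_nth_0)
  then have g_add: "lift3 g oo (fps_const (varX + varY) * fps_X) =
      (lift3 g oo (fps_const varX * fps_X)) + (lift3 g oo (fps_const varY * fps_X))"
    by (simp add: g_comp add grad_var)
  have "g = fps_X"
  proof (rule fps_ext)
    fix n :: nat
    consider "n = 0" | "n = 1" | "n \<ge> 2" by linarith
    then show "g $ n = fps_X $ n"
    proof cases
      case 3
      have lin: "(lift3 g oo (fps_const c * fps_X)) $ n = const3 (g $ n) * c ^ n" for c
        by (simp add: fps_compose_linear)
      have "const3 (g $ n) * (varX + varY) ^ n = const3 (g $ n) * varX ^ n + const3 (g $ n) * varY ^ n"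
        using arg_cong[OF g_add, of "\<lambda>f. f $ n"] by (simp only: lin fps_add_nth)
      then have *: "const3 (g $ n) * (fps_X + fps_const fps_X) ^ n =
          const3 (g $ n) * fps_X ^ n + const3 (g $ n) * fps_const (fps_X ^ n)"
        by (simp only: varX_def varY_def fps_const_power)
      have A: "(const3 (g $ n) * (fps_X + fps_const fps_X) ^ n) $ 1 $ (n - 1) $ 0 = g $ n * of_nat n"
      proof -
        have "fps_const (fps_const (g $ n)) * (of_nat n * fps_X ^ (n - 1)) =
            fps_const (fps_const (g $ n * of_nat n)) * (fps_X ^ (n - 1) :: 'a fps fps)"
          by (simp add: fps_of_nat[symmetric] mult.assoc[symmetric])
        then have "(const3 (g $ n) * (fps_X + fps_const fps_X) ^ n) $ 1 =
            fps_const (fps_const (g $ n * of_nat n)) * fps_X ^ (n - 1)"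
          by (simp only: fps_mult_left_const_nth fps_X_plus_const_power_nth_1)
        then show ?thesis by (simp only: fps_mult_left_const_nth fps_X_power_nth) simp
      qed
      have B: "(const3 (g $ n) * fps_X ^ n + const3 (g $ n) * fps_const (fps_X ^ n)) $ 1 = 0"
      proof -
        have "n \<noteq> 1" using 3 by simp
        then show ?thesis
          by (simp only: fps_add_nth fps_mult_left_const_nth fps_X_power_nth fps_nth_fps_const) simp
      qed
      have "g $ n * of_nat n = 0"
        using A unfolding * B by (simp only: fps_zero_nth)
      then show ?thesis using 3 by auto
    qed (use e in \<open>auto simp: g_def fps_compose_nth\<close>)
  qed
  then show ?thesis
    using exp_log_compose[of e P] e by (simp add: g_def)
qed

end

section \<open>Summation in a complete valued field\<close>

locale complete_valuation =
  fixes v :: "'a::field \<Rightarrow> ereal"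
  assumes valuation: "is_valuation v"
    and complete: "val_Cauchy v s \<Longrightarrow> \<exists>L. val_tendsto v s L"
begin

lemma v_not_MInf: "v x \<noteq> -\<infinity>" and v_eq_PInf: "v x = \<infinity> \<longleftrightarrow> x = 0"
  and v_mult: "v (x * y) = v x + v y" and v_add: "min (v x) (v y) \<le> v (x + y)"
  using valuation by (auto simp: is_valuation_def)

lemma v_0 [simp]: "v 0 = \<infinity>"
  by (simp add: v_eq_PInf)

lemma v_1 [simp]: "v 1 = 0"
  using v_mult[of 1 1] v_not_MInf[of 1] v_eq_PInf[of 1] by (cases "v 1") auto

lemma v_minus [simp]: "v (- x) = v x"
proof -
  have "v (-1) + v (-1) = 0" using v_mult[of "-1" "-1"] by simp
  then have "v (-1) = 0" by (cases "v (-1)") auto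
  then show ?thesis using v_mult[of "-1" x] by simp
qed

lemma v_diff_commute: "v (x - y) = v (y - x)"
  using v_minus[of "x - y"] by simp

lemma v_ge_add: "C \<le> v x \<Longrightarrow> C \<le> v y \<Longrightarrow> C \<le> v (x + y)"
  using v_add[of x y] by (meson min.boundedI order_trans)

lemma v_ge_diff: "C \<le> v x \<Longrightarrow> C \<le> v y \<Longrightarrow> C \<le> v (x - y)"
  using v_ge_add[of C x "- y"] by simp

lemma v_ge_trans: "C \<le> v (x - y) \<Longrightarrow> C \<le> v (y - z) \<Longrightarrow> C \<le> v (x - z)"
  using v_ge_add[of C "x - y" "y - z"] by simp

lemma v_ge_sum: "(\<And>a. a \<in> A \<Longrightarrow> C \<le> v (f a)) \<Longrightarrow> C \<le> v (sum f A)"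
  by (induction A rule: infinite_finite_induct) (auto intro: v_ge_add)

lemma v_ge_mult: "ereal C \<le> v x \<Longrightarrow> ereal D \<le> v y \<Longrightarrow> ereal (C + D) \<le> v (x * y)"
  using add_mono[of "ereal C" "v x" "ereal D" "v y"] by (simp add: v_mult)

lemma v_nonneg_mult: "0 \<le> v x \<Longrightarrow> 0 \<le> v y \<Longrightarrow> 0 \<le> v (x * y)"
  by (simp add: v_mult)

lemma v_ge_mult_nonneg: "C \<le> v x \<Longrightarrow> 0 \<le> v y \<Longrightarrow> C \<le> v (x * y)"
  using add_mono[of C "v x" 0 "v y"] by (simp add: v_mult)

lemma v_nonneg_power: "0 \<le> v x \<Longrightarrow> 0 \<le> v (x ^ n)"
  by (induction n) (auto intro: v_nonneg_mult)

lemma v_ge_power: "ereal d \<le> v x \<Longrightarrow> ereal (real n * d) \<le> v (x ^ n)"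
  by (induction n) (auto dest: v_ge_mult simp: algebra_simps)

lemma v_bounded: "\<exists>C. ereal C \<le> v x"
  using v_not_MInf[of x] by (cases "v x") auto

lemma v_inverse: "x \<noteq> 0 \<Longrightarrow> v (inverse x) = - v x"
proof -
  assume x: "x \<noteq> 0"
  then have "v x + v (inverse x) = 0" using v_mult[of x "inverse x"] by simp
  then show ?thesis using v_not_MInf v_eq_PInf x
    by (cases "v x"; cases "v (inverse x)") auto
qed

lemma v_zeroI: "(\<And>C. ereal C \<le> v (x - y)) \<Longrightarrow> x = y"
proof -
  assume "\<And>C. ereal C \<le> v (x - y)"
  then have "v (x - y) = \<infinity>" by (metis ereal_top)
  then show ?thesis by (simp add: v_eq_PInf)
qed

lemma val_tendsto_iff: "val_tendsto v s L \<longleftrightarrow> (\<forall>C. \<exists>N. \<forall>n\<ge>N. ereal C \<le> v (s n - L))"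
proof -
  have "(\<forall>C. \<exists>N. \<forall>n\<ge>N. ereal C < v (s n - L)) \<longleftrightarrow> (\<forall>C. \<exists>N. \<forall>n\<ge>N. ereal C \<le> v (s n - L))"
  proof (intro iffI allI)
    fix C assume "\<forall>C. \<exists>N. \<forall>n\<ge>N. ereal C \<le> v (s n - L)"
    then obtain N where "\<forall>n\<ge>N. ereal (C + 1) \<le> v (s n - L)" by blast
    moreover have "ereal C < ereal (C + 1)" by simp
    ultimately show "\<exists>N. \<forall>n\<ge>N. ereal C < v (s n - L)" by (meson less_le_trans)
  qed (meson less_imp_le)
  then show ?thesis
    by (simp add: val_tendsto_def tendsto_PInfty eventually_sequentially)
qed

lemma val_tendsto_unique: "val_tendsto v s L \<Longrightarrow> val_tendsto v s L' \<Longrightarrow> L = L'"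
proof (rule v_zeroI)
  fix C assume "val_tendsto v s L" "val_tendsto v s L'"
  then obtain N N' where "\<And>n. n \<ge> N \<Longrightarrow> ereal C \<le> v (s n - L)" "\<And>n. n \<ge> N' \<Longrightarrow> ereal C \<le> v (s n - L')"
    unfolding val_tendsto_iff by meson
  then have "ereal C \<le> v (s (max N N') - L)" "ereal C \<le> v (s (max N N') - L')" by auto
  then show "ereal C \<le> v (L - L')"
    using v_ge_trans[of "ereal C" L "s (max N N')" L'] v_diff_commute[of L] by simp
qed

definition vnull :: "('i \<Rightarrow> 'a) \<Rightarrow> 'i set \<Rightarrow> bool" where
  "vnull c A \<longleftrightarrow> (\<forall>C. finite {a \<in> A. \<not> ereal C \<le> v (c a)})"

text \<open>Convergence along the net of finite subsets, for arbitrary index sets. Sums over pairs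
  can then be reindexed and iterated in either order, whereas \<open>fps_value\<close> and
  \<open>fps2_value\<close> are limits along particular exhaustions.\<close>

definition has_vsum :: "('i \<Rightarrow> 'a) \<Rightarrow> 'i set \<Rightarrow> 'a \<Rightarrow> bool" where
  "has_vsum c A L \<longleftrightarrow> (\<forall>C. \<exists>F0. finite F0 \<and> F0 \<subseteq> A \<and>
     (\<forall>F. finite F \<longrightarrow> F0 \<subseteq> F \<longrightarrow> F \<subseteq> A \<longrightarrow> ereal C \<le> v (sum c F - L)))"

lemma has_vsumE:
  assumes "has_vsum c A L"
  obtains F0 where "finite F0" "F0 \<subseteq> A" "\<And>F. finite F \<Longrightarrow> F0 \<subseteq> F \<Longrightarrow> F \<subseteq> A \<Longrightarrow> ereal C \<le> v (sum c F - L)"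
  using assms unfolding has_vsum_def by meson

lemma has_vsum_unique: "has_vsum c A L \<Longrightarrow> has_vsum c A L' \<Longrightarrow> L = L'"
proof (rule v_zeroI)
  fix C assume "has_vsum c A L" and L': "has_vsum c A L'"
  from this(1) obtain F where F: "finite F" "F \<subseteq> A" "\<And>F'. finite F' \<Longrightarrow> F \<subseteq> F' \<Longrightarrow> F' \<subseteq> A \<Longrightarrow> ereal C \<le> v (sum c F' - L)"
    by (rule has_vsumE[where C = C]) (rule that; blast)
  from L' obtain G where G: "finite G" "G \<subseteq> A" "\<And>F'. finite F' \<Longrightarrow> G \<subseteq> F' \<Longrightarrow> F' \<subseteq> A \<Longrightarrow> ereal C \<le> v (sum c F' - L')"
    by (rule has_vsumE[where C = C]) (rule that; blast)
  have "ereal C \<le> v (sum c (F \<union> G) - L)" "ereal C \<le> v (sum c (F \<union> G) - L')"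
    using F(1,2) G(1,2) by (auto intro!: F(3) G(3))
  then show "ereal C \<le> v (L - L')"
    using v_ge_trans[of "ereal C" L "sum c (F \<union> G)" L'] v_diff_commute[of L] by simp
qed

text \<open>By the ultrametric inequality terms tending to 0 suffice: outside the finite set
  \<open>F k\<close> of terms of valuation below k, every finite sum has valuation at least
  k.\<close>

lemma vnull_has_vsum:
  assumes "vnull c A"
  shows "\<exists>L. has_vsum c A L"
proof -
  define F where "F = (\<lambda>k::nat. {a \<in> A. \<not> ereal (real k) \<le> v (c a)})"
  define s where "s = (\<lambda>k. sum c (F k))"
  have fin: "finite (F k)" for k using assms by (auto simp: F_def vnull_def)
  have mono: "F k \<subseteq> F l" if "k \<le> l" for k l
    using that by (auto simp: F_def) (meson ereal_less_eq(3) of_nat_mono order_trans)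
  have tail: "ereal (real k) \<le> v (sum c G - s k)" if "finite G" "F k \<subseteq> G" "G \<subseteq> A" for G k
  proof -
    have "sum c G - s k = sum c (G - F k)"
      using that fin by (simp add: s_def sum_diff)
    also have "ereal (real k) \<le> v \<dots>"
      using that by (intro v_ge_sum) (auto simp: F_def)
    finally show ?thesis .
  qed
  have tail2: "ereal (real k) \<le> v (s l - s k)" if "k \<le> l" for k l
    using tail[of "F l" k] fin mono[OF that] by (simp add: s_def F_def)
  have "val_Cauchy v s"
    unfolding val_Cauchy_def
  proof
    fix C :: real
    obtain N :: nat where N: "C < real N" using reals_Archimedean2 by blast
    have "ereal C < v (s m - s n)" if "m \<ge> N" "n \<ge> N" for m n
    proof -
      have "ereal (real N) \<le> v (s m - s n)"
        using v_ge_trans[OF tail2[OF that(1)], of "s n"] tail2[OF that(2)] v_diff_commute[of "s N"] by simp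
      moreover have "ereal C < ereal (real N)" using N by simp
      ultimately show ?thesis by (rule less_le_trans[rotated])
    qed
    then show "\<exists>N. \<forall>m\<ge>N. \<forall>n\<ge>N. ereal C < v (s m - s n)" by blast
  qed
  then obtain L where L: "val_tendsto v s L" using complete by blast
  have "has_vsum c A L"
    unfolding has_vsum_def
  proof
    fix C :: real
    obtain N where N: "\<And>n. n \<ge> N \<Longrightarrow> ereal C \<le> v (s n - L)" using L unfolding val_tendsto_iff by meson
    obtain M :: nat where M: "C < real M" using reals_Archimedean2 by blast
    define k where "k = max N M"
    have "ereal C \<le> v (sum c G - L)" if "finite G" "F k \<subseteq> G" "G \<subseteq> A" for G
    proof (rule v_ge_trans)
      have "ereal C \<le> ereal (real k)" using M by (simp add: k_def)
      then show "ereal C \<le> v (sum c G - s k)" using tail[OF that] by (rule order_trans)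
    qed (use N in \<open>simp add: k_def\<close>)
    then show "\<exists>F0. finite F0 \<and> F0 \<subseteq> A \<and> (\<forall>F. finite F \<longrightarrow> F0 \<subseteq> F \<longrightarrow> F \<subseteq> A \<longrightarrow> ereal C \<le> v (sum c F - L))"
      using fin by (intro exI[of _ "F k"]) (auto simp: F_def)
  qed
  then show ?thesis by blast
qed

lemma has_vsum_finite: "finite A \<Longrightarrow> has_vsum c A (sum c A)"
  unfolding has_vsum_def by (intro allI exI[of _ A]) (auto dest: antisym)

lemma has_vsum_superset:
  assumes "has_vsum c A L" "A \<subseteq> B" "\<And>b. b \<in> B - A \<Longrightarrow> c b = 0"
  shows "has_vsum c B L"
  unfolding has_vsum_def
proof
  fix C
  obtain F0 where F0: "finite F0" "F0 \<subseteq> A" "\<And>F. finite F \<Longrightarrow> F0 \<subseteq> F \<Longrightarrow> F \<subseteq> A \<Longrightarrow> ereal C \<le> v (sum c F - L)"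
    by (rule has_vsumE[OF assms(1), where C = C]) (rule that; blast)
  have "ereal C \<le> v (sum c F - L)" if F: "finite F" "F0 \<subseteq> F" "F \<subseteq> B" for F
  proof -
    have "sum c F = sum c (F \<inter> A)"
      using F assms(3) by (intro sum.mono_neutral_right) auto
    then show ?thesis using F0(2) F by (simp add: F0(3))
  qed
  then show "\<exists>F0. finite F0 \<and> F0 \<subseteq> B \<and> (\<forall>F. finite F \<longrightarrow> F0 \<subseteq> F \<longrightarrow> F \<subseteq> B \<longrightarrow> ereal C \<le> v (sum c F - L))"
    using F0 assms(2) by (intro exI[of _ F0]) auto
qed

lemma has_vsum_reindex:
  assumes "inj_on h A" "has_vsum c (h ` A) L"
  shows "has_vsum (\<lambda>a. c (h a)) A L"
  unfolding has_vsum_def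
proof
  fix C
  obtain F0 where F0: "finite F0" "F0 \<subseteq> h ` A" "\<And>F. finite F \<Longrightarrow> F0 \<subseteq> F \<Longrightarrow> F \<subseteq> h ` A \<Longrightarrow> ereal C \<le> v (sum c F - L)"
    by (rule has_vsumE[OF assms(2), where C = C]) (rule that; blast)
  obtain G where G: "finite G" "G \<subseteq> A" "F0 = h ` G"
    using F0(1,2) by (metis finite_subset_image)
  have "ereal C \<le> v ((\<Sum>a\<in>F. c (h a)) - L)" if F: "finite F" "G \<subseteq> F" "F \<subseteq> A" for F
  proof -
    have "(\<Sum>a\<in>F. c (h a)) = sum c (h ` F)"
      using inj_on_subset[OF assms(1) F(3)] by (simp add: sum.reindex)
    then show ?thesis using F G by (simp add: F0(3) image_mono)
  qed
  then show "\<exists>F0. finite F0 \<and> F0 \<subseteq> A \<and> (\<forall>F. finite F \<longrightarrow> F0 \<subseteq> F \<longrightarrow> F \<subseteq> A \<longrightarrow> ereal C \<le> v ((\<Sum>a\<in>F. c (h a)) - L))"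
    using G by (intro exI[of _ G]) auto
qed

lemma has_vsum_cmult:
  assumes "has_vsum c A L"
  shows "has_vsum (\<lambda>a. k * c a) A (k * L)"
  unfolding has_vsum_def
proof
  fix C
  obtain D where D: "ereal D \<le> v k" using v_bounded by blast
  obtain F0 where F0: "finite F0" "F0 \<subseteq> A" "\<And>F. finite F \<Longrightarrow> F0 \<subseteq> F \<Longrightarrow> F \<subseteq> A \<Longrightarrow> ereal (C - D) \<le> v (sum c F - L)"
    by (rule has_vsumE[OF assms, where C = "C - D"]) (rule that; blast)
  have "ereal C \<le> v ((\<Sum>a\<in>F. k * c a) - k * L)" if F: "finite F" "F0 \<subseteq> F" "F \<subseteq> A" for F
    using v_ge_mult[OF D F0(3)[OF F]] by (simp add: sum_distrib_left right_diff_distrib)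
  then show "\<exists>F0. finite F0 \<and> F0 \<subseteq> A \<and> (\<forall>F. finite F \<longrightarrow> F0 \<subseteq> F \<longrightarrow> F \<subseteq> A \<longrightarrow> ereal C \<le> v ((\<Sum>a\<in>F. k * c a) - k * L))"
    using F0 by (intro exI[of _ F0]) auto
qed

lemma has_vsum_add:
  assumes "has_vsum c A L" "has_vsum d A M"
  shows "has_vsum (\<lambda>a. c a + d a) A (L + M)"
  unfolding has_vsum_def
proof
  fix C
  obtain F0 where F0: "finite F0" "F0 \<subseteq> A" "\<And>F. finite F \<Longrightarrow> F0 \<subseteq> F \<Longrightarrow> F \<subseteq> A \<Longrightarrow> ereal C \<le> v (sum c F - L)"
    by (rule has_vsumE[OF assms(1), where C = C]) (rule that; blast)
  obtain G0 where G0: "finite G0" "G0 \<subseteq> A" "\<And>F. finite F \<Longrightarrow> G0 \<subseteq> F \<Longrightarrow> F \<subseteq> A \<Longrightarrow> ereal C \<le> v (sum d F - M)"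
    by (rule has_vsumE[OF assms(2), where C = C]) (rule that; blast)
  have "ereal C \<le> v ((\<Sum>a\<in>F. c a + d a) - (L + M))" if F: "finite F" "F0 \<union> G0 \<subseteq> F" "F \<subseteq> A" for F
  proof -
    have "(\<Sum>a\<in>F. c a + d a) - (L + M) = (sum c F - L) + (sum d F - M)"
      by (simp add: sum.distrib)
    also have "ereal C \<le> v \<dots>"
      using F by (intro v_ge_add F0(3) G0(3)) auto
    finally show ?thesis .
  qed
  then show "\<exists>F0. finite F0 \<and> F0 \<subseteq> A \<and> (\<forall>F. finite F \<longrightarrow> F0 \<subseteq> F \<longrightarrow> F \<subseteq> A \<longrightarrow> ereal C \<le> v ((\<Sum>a\<in>F. c a + d a) - (L + M)))"
    using F0(1,2) G0(1,2) by (intro exI[of _ "F0 \<union> G0"]) blast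
qed

text \<open>Fubini without uniformity: finitely many inner sums are each approximated to precision
  C, and the ultrametric inequality keeps the total error at precision C.\<close>

lemma has_vsum_Sigma:
  assumes L: "has_vsum (\<lambda>(a, b). c a b) (Sigma A B) L"
    and s: "\<And>a. a \<in> A \<Longrightarrow> has_vsum (c a) (B a) (s a)"
  shows "has_vsum s A L"
  unfolding has_vsum_def
proof
  fix C
  obtain F0 where F0: "finite F0" "F0 \<subseteq> Sigma A B"
      "\<And>F. finite F \<Longrightarrow> F0 \<subseteq> F \<Longrightarrow> F \<subseteq> Sigma A B \<Longrightarrow> ereal C \<le> v ((\<Sum>(a, b)\<in>F. c a b) - L)"
    by (rule has_vsumE[OF L, where C = C]) (rule that; blast)
  have "ereal C \<le> v (sum s G - L)" if G: "finite G" "fst ` F0 \<subseteq> G" "G \<subseteq> A" for G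
  proof -
    have "\<exists>H. finite H \<and> H \<subseteq> B a \<and> {b. (a, b) \<in> F0} \<subseteq> H \<and> ereal C \<le> v (sum (c a) H - s a)"
      if a: "a \<in> G" for a
    proof -
      have "a \<in> A" using a G by auto
      from s[OF this] obtain H0 where H0: "finite H0" "H0 \<subseteq> B a"
        "\<And>H. finite H \<Longrightarrow> H0 \<subseteq> H \<Longrightarrow> H \<subseteq> B a \<Longrightarrow> ereal C \<le> v (sum (c a) H - s a)"
        by (rule has_vsumE[where C = C]) (rule that; blast)
      let ?H = "H0 \<union> {b. (a, b) \<in> F0}"
      have "{b. (a, b) \<in> F0} \<subseteq> snd ` F0" by force
      then have "finite ?H" "?H \<subseteq> B a"
        using F0(1,2) H0(1,2) by (auto intro: finite_subset)
      then show ?thesis using H0(3)[of ?H] by blast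
    qed
    then obtain H where H: "\<And>a. a \<in> G \<Longrightarrow> finite (H a) \<and> H a \<subseteq> B a \<and> {b. (a, b) \<in> F0} \<subseteq> H a \<and>
        ereal C \<le> v (sum (c a) (H a) - s a)"
      by metis
    have "ereal C \<le> v ((\<Sum>(a, b)\<in>Sigma G H. c a b) - L)"
    proof (rule F0(3))
      show "finite (Sigma G H)" using G H by auto
      show "Sigma G H \<subseteq> Sigma A B" using G H by blast
      show "F0 \<subseteq> Sigma G H"
      proof
        fix z assume z: "z \<in> F0"
        then have "fst z \<in> G" using G by auto
        moreover have "snd z \<in> {b. (fst z, b) \<in> F0}" using z by simp
        ultimately show "z \<in> Sigma G H" using H by (metis SigmaI prod.collapse subsetD)
      qed
    qed
    moreover have "(\<Sum>(a, b)\<in>Sigma G H. c a b) = (\<Sum>a\<in>G. sum (c a) (H a))"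
      using G H by (intro sum.Sigma[symmetric]) auto
    moreover have "ereal C \<le> v (\<Sum>a\<in>G. s a - sum (c a) (H a))"
      using H v_diff_commute by (intro v_ge_sum) metis
    ultimately show ?thesis
      using v_ge_add[of "ereal C" "\<Sum>a\<in>G. s a - sum (c a) (H a)" "(\<Sum>a\<in>G. sum (c a) (H a)) - L"]
      by (simp add: sum_subtractf)
  qed
  then show "\<exists>F0. finite F0 \<and> F0 \<subseteq> A \<and> (\<forall>F. finite F \<longrightarrow> F0 \<subseteq> F \<longrightarrow> F \<subseteq> A \<longrightarrow> ereal C \<le> v (sum s F - L))"
    using F0(1,2) by (intro exI[of _ "fst ` F0"]) auto
qed

lemma has_vsum_swap:
  assumes "has_vsum (\<lambda>(a, b). c a b) (A \<times> B) L"
  shows "has_vsum (\<lambda>(b, a). c a b) (B \<times> A) L"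
proof -
  have "prod.swap ` (B \<times> A) = A \<times> B" by auto
  then show ?thesis
    using has_vsum_reindex[of prod.swap "B \<times> A" "\<lambda>(a, b). c a b" L] assms
    by (simp add: split_def)
qed

text \<open>Connects unordered sums with the sequential limits in the definitions.\<close>

lemma has_vsum_partial_sums:
  assumes c: "has_vsum c UNIV L" and F: "\<And>n. finite (F n)" "\<And>n. F n \<subseteq> F (Suc n)" "\<And>a. \<exists>n. a \<in> F n"
  shows "val_tendsto v (\<lambda>n. sum c (F n)) L"
  unfolding val_tendsto_iff
proof
  fix C
  obtain F0 where F0: "finite F0" "\<And>F. finite F \<Longrightarrow> F0 \<subseteq> F \<Longrightarrow> F \<subseteq> UNIV \<Longrightarrow> ereal C \<le> v (sum c F - L)"
    by (rule has_vsumE[OF c, where C = C]) (rule that; blast)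
  have mono: "F m \<subseteq> F n" if "m \<le> n" for m n using F(2) that by (rule lift_Suc_mono_le)
  have "\<exists>N. F0 \<subseteq> F N"
    using F0(1)
  proof (induction F0 rule: finite_induct)
    case (insert a F0)
    then obtain N where N: "F0 \<subseteq> F N" by blast
    obtain M where M: "a \<in> F M" using F(3) by blast
    have "F N \<subseteq> F (max N M)" "F M \<subseteq> F (max N M)" by (auto intro!: mono)
    then show ?case using N M by blast
  qed simp
  then obtain N where "F0 \<subseteq> F N" by blast
  then have "F0 \<subseteq> F n" if "n \<ge> N" for n using mono[OF that] by blast
  then show "\<exists>N. \<forall>n\<ge>N. ereal C \<le> v (sum c (F n) - L)"
    using F0(2)[OF F(1)] by (intro exI[of _ N]) auto
qed

section \<open>Evaluation of power series at points of the field\<close>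

definition conv :: "'a \<Rightarrow> 'a fps \<Rightarrow> bool" where
  "conv x f \<longleftrightarrow> vnull (\<lambda>i. f $ i * x ^ i) UNIV"

abbreviation ev :: "'a \<Rightarrow> 'a fps \<Rightarrow> 'a" where
  "ev x f \<equiv> fps_value v f x"

lemma fps_value_eqI:
  assumes "has_vsum (\<lambda>i. f $ i * x ^ i) UNIV L"
  shows "fps_value v f x = L"
proof -
  have t: "val_tendsto v (\<lambda>n. \<Sum>i<n. f $ i * x ^ i) L"
    using assms by (rule has_vsum_partial_sums) auto
  show ?thesis
    unfolding fps_value_def by (intro the_equality t) (rule val_tendsto_unique[OF _ t])
qed

lemma fps2_value_eqI:
  assumes "has_vsum (\<lambda>(i, j). F $ i $ j * x ^ i * y ^ j) UNIV L"
  shows "fps2_value v F x y = L"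
proof -
  have "val_tendsto v (\<lambda>n. \<Sum>(i, j)\<in>{..<n} \<times> {..<n}. F $ i $ j * x ^ i * y ^ j) L"
  proof (rule has_vsum_partial_sums[OF assms])
    fix a :: "nat \<times> nat"
    obtain i j where "a = (i, j)" by (cases a)
    then show "\<exists>n. a \<in> {..<n} \<times> {..<n}" by (intro exI[of _ "Suc (max i j)"]) auto
  qed auto
  then have t: "val_tendsto v (\<lambda>n. \<Sum>i<n. \<Sum>j<n. F $ i $ j * x ^ i * y ^ j) L"
    by (simp add: sum.cartesian_product)
  show ?thesis
    unfolding fps2_value_def by (intro the_equality t) (rule val_tendsto_unique[OF _ t])
qed

lemma conv_has_vsum: "conv x f \<Longrightarrow> has_vsum (\<lambda>i. f $ i * x ^ i) UNIV (ev x f)"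
  unfolding conv_def by (metis vnull_has_vsum fps_value_eqI)

lemma vnull_bounded:
  assumes "vnull c A"
  shows "\<exists>C. \<forall>a\<in>A. ereal C \<le> v (c a)"
proof -
  let ?F = "{a \<in> A. \<not> ereal 0 \<le> v (c a)}"
  have fin: "finite ?F" using assms by (simp add: vnull_def)
  define b where "b = (\<lambda>a. SOME C. ereal C \<le> v (c a))"
  have b: "ereal (b a) \<le> v (c a)" for a unfolding b_def by (rule someI_ex[OF v_bounded])
  define C where "C = Min (insert 0 (b ` ?F))"
  have "ereal C \<le> v (c a)" if a: "a \<in> A" for a
  proof (cases "ereal 0 \<le> v (c a)")
    case True
    have "C \<le> 0" using fin unfolding C_def by (intro Min_le) auto
    then show ?thesis using True by (meson ereal_less_eq(3) order_trans)
  next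
    case False
    then have "C \<le> b a" using fin a unfolding C_def by (intro Min_le) auto
    then show ?thesis using b[of a] by (meson ereal_less_eq(3) order_trans)
  qed
  then show ?thesis by blast
qed

text \<open>Both families are bounded below in valuation, so a product of valuation below C forces
  each factor into a finite exceptional set.\<close>

lemma vnull_mult:
  assumes c: "vnull c A" and d: "vnull d B"
  shows "vnull (\<lambda>(a, b). c a * d b) (A \<times> B)"
  unfolding vnull_def
proof
  fix C
  obtain M N where M: "\<And>a. a \<in> A \<Longrightarrow> ereal M \<le> v (c a)" and N: "\<And>b. b \<in> B \<Longrightarrow> ereal N \<le> v (d b)"
    using vnull_bounded[OF c] vnull_bounded[OF d] by blast
  let ?F = "{a \<in> A. \<not> ereal (C - N) \<le> v (c a)} \<times> {b \<in> B. \<not> ereal (C - M) \<le> v (d b)}"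
  have "{z \<in> A \<times> B. \<not> ereal C \<le> v (case z of (a, b) \<Rightarrow> c a * d b)} \<subseteq> ?F"
  proof
    fix z assume z: "z \<in> {z \<in> A \<times> B. \<not> ereal C \<le> v (case z of (a, b) \<Rightarrow> c a * d b)}"
    obtain a b where zab: "z = (a, b)" by (cases z)
    have ab: "a \<in> A" "b \<in> B" and nb: "\<not> ereal C \<le> v (c a * d b)" using z zab by auto
    have "\<not> ereal (C - N) \<le> v (c a)" using v_ge_mult[of "C - N" "c a" N "d b"] N[OF ab(2)] nb by auto
    moreover have "\<not> ereal (C - M) \<le> v (d b)" using v_ge_mult[of M "c a" "C - M" "d b"] M[OF ab(1)] nb by auto
    ultimately show "z \<in> ?F" using ab zab by blast
  qed
  moreover have "finite ?F" using c d by (auto simp: vnull_def)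
  ultimately show "finite {z \<in> A \<times> B. \<not> ereal C \<le> v (case z of (a, b) \<Rightarrow> c a * d b)}"
    by (rule finite_subset)
qed

lemma fps_mult_eval_nth:
  fixes f g :: "'a fps"
  shows "(f * g) $ n * x ^ n = (\<Sum>i\<le>n. (f $ i * x ^ i) * (g $ (n - i) * x ^ (n - i)))"
proof -
  have "f $ i * g $ (n - i) * x ^ n = (f $ i * x ^ i) * (g $ (n - i) * x ^ (n - i))" if "i \<le> n" for i
  proof -
    have "x ^ n = x ^ i * x ^ (n - i)" using power_add[of x i "n - i"] that by simp
    then show ?thesis by (simp only: ac_simps)
  qed
  then show ?thesis
    unfolding fps_mult_nth sum_distrib_right atMost_atLeast0 by (intro sum.cong refl) auto
qed

lemma conv_mult:
  assumes f: "conv x f" and g: "conv x g"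
  shows "conv x (f * g)"
  unfolding conv_def vnull_def
proof
  fix C
  let ?c = "\<lambda>(i, j). (f $ i * x ^ i) * (g $ j * x ^ j)"
  have fin: "finite {z \<in> UNIV \<times> UNIV. \<not> ereal C \<le> v (?c z)}"
    using vnull_mult[OF f[unfolded conv_def] g[unfolded conv_def]] by (simp add: vnull_def)
  have "n \<in> (\<lambda>(i, j). i + j) ` {z \<in> UNIV \<times> UNIV. \<not> ereal C \<le> v (?c z)}"
    if n: "\<not> ereal C \<le> v ((f * g) $ n * x ^ n)" for n
  proof -
    obtain i where "i \<le> n" "\<not> ereal C \<le> v (?c (i, n - i))"
      using n v_ge_sum[of "{..n}" "ereal C" "\<lambda>i. ?c (i, n - i)"] by (auto simp: fps_mult_eval_nth)
    then show ?thesis by (intro image_eqI[of _ _ "(i, n - i)"]) auto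
  qed
  then have "{n \<in> UNIV. \<not> ereal C \<le> v ((f * g) $ n * x ^ n)} \<subseteq>
      (\<lambda>(i, j). i + j) ` {z \<in> UNIV \<times> UNIV. \<not> ereal C \<le> v (?c z)}" by blast
  then show "finite {n \<in> UNIV. \<not> ereal C \<le> v ((f * g) $ n * x ^ n)}"
    using fin by (meson finite_imageI finite_subset)
qed

lemma ev_mult:
  assumes f: "conv x f" and g: "conv x g"
  shows "ev x (f * g) = ev x f * ev x g"
proof -
  let ?a = "\<lambda>i. f $ i * x ^ i" and ?b = "\<lambda>j. g $ j * x ^ j"
  obtain L where L: "has_vsum (\<lambda>(i, j). ?a i * ?b j) (UNIV \<times> UNIV) L"
    using vnull_has_vsum[OF vnull_mult[OF f[unfolded conv_def] g[unfolded conv_def]]] by blast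
  have "has_vsum (\<lambda>i. ?a i * ev x g) UNIV L"
    by (rule has_vsum_Sigma[OF L]) (intro has_vsum_cmult conv_has_vsum g)
  moreover have "has_vsum (\<lambda>i. ev x g * ?a i) UNIV (ev x g * ev x f)"
    by (intro has_vsum_cmult conv_has_vsum f)
  ultimately have L_eq: "L = ev x f * ev x g"
    using has_vsum_unique by (simp add: mult.commute)
  \<comment> \<open>Pairs (i, j) are regrouped by their sum n, which produces the Cauchy
    product.\<close>
  let ?h = "\<lambda>(n, i). (i, n - i :: nat)"
  have inj: "inj_on ?h (Sigma UNIV (\<lambda>n. {..n}))" by (auto simp: inj_on_def)
  have "(i, j) \<in> ?h ` Sigma UNIV (\<lambda>n. {..n})" for i j
    by (intro image_eqI[of _ _ "(i + j, i)"]) auto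
  then have im: "?h ` Sigma UNIV (\<lambda>n. {..n}) = UNIV \<times> UNIV" by auto
  have "has_vsum (\<lambda>(n, i). ?a i * ?b (n - i)) (Sigma UNIV (\<lambda>n. {..n})) L"
    using has_vsum_reindex[OF inj, unfolded im, OF L] by (simp add: split_def)
  then have "has_vsum (\<lambda>n. \<Sum>i\<le>n. ?a i * ?b (n - i)) UNIV L"
    by (rule has_vsum_Sigma) (auto intro: has_vsum_finite)
  then have "has_vsum (\<lambda>n. (f * g) $ n * x ^ n) UNIV L"
    by (simp only: fps_mult_eval_nth)
  then show ?thesis using L_eq fps_value_eqI by blast
qed

lemma conv_add: "conv x f \<Longrightarrow> conv x g \<Longrightarrow> conv x (f + g)"
proof -
  assume fg: "conv x f" "conv x g"
  have "{n. \<not> ereal C \<le> v ((f + g) $ n * x ^ n)} \<subseteq>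
      {n \<in> UNIV. \<not> ereal C \<le> v (f $ n * x ^ n)} \<union> {n \<in> UNIV. \<not> ereal C \<le> v (g $ n * x ^ n)}" for C
    by (auto simp: distrib_right dest: v_ge_add)
  moreover have "finite ({n \<in> UNIV. \<not> ereal C \<le> v (f $ n * x ^ n)} \<union> {n \<in> UNIV. \<not> ereal C \<le> v (g $ n * x ^ n)})" for C
    using fg by (simp add: conv_def vnull_def)
  ultimately have "finite {n. \<not> ereal C \<le> v ((f + g) $ n * x ^ n)}" for C
    by (rule finite_subset)
  then show ?thesis by (simp add: conv_def vnull_def)
qed

lemma conv_minus: "conv x f \<Longrightarrow> conv x (- f)"
  by (simp add: conv_def vnull_def)

lemma conv_finite_support: "(\<And>n. n > N \<Longrightarrow> f $ n = 0) \<Longrightarrow> conv x f"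
proof -
  assume f: "\<And>n. n > N \<Longrightarrow> f $ n = 0"
  have "{n \<in> UNIV. \<not> ereal C \<le> v (f $ n * x ^ n)} \<subseteq> {..N}" for C
    using f by (force simp: not_le[symmetric])
  then show ?thesis unfolding conv_def vnull_def by (meson finite_atMost finite_subset)
qed

lemma has_vsum_fps_finite:
  assumes "\<And>n. n > N \<Longrightarrow> f $ n = 0"
  shows "has_vsum (\<lambda>i. f $ i * x ^ i) UNIV (\<Sum>i\<le>N. f $ i * x ^ i)"
  by (rule has_vsum_superset[OF has_vsum_finite]) (use assms in auto)

lemma ev_const [simp]: "ev x (fps_const c) = c"
  using fps_value_eqI[OF has_vsum_fps_finite[of 0 "fps_const c" x]] by simp

lemma ev_X [simp]: "ev x fps_X = x"
  using fps_value_eqI[OF has_vsum_fps_finite[of 1 fps_X x]] by simp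

lemma conv_const: "conv x (fps_const c)"
  by (rule conv_finite_support[of 0]) simp

lemma conv_hom: "hom_on {f. conv x f} (ev x)"
proof -
  have "conv x 0" "conv x 1" using conv_const[of x 0] conv_const[of x 1] by simp_all
  then have "subring {f. conv x f}"
    by (simp add: subring_def conv_add conv_mult conv_minus)
  moreover have "ev x (f + g) = ev x f + ev x g" if "conv x f" "conv x g" for f g
    using has_vsum_add[OF that[THEN conv_has_vsum]] by (intro fps_value_eqI) (simp add: distrib_right)
  moreover have "ev x 1 = 1" unfolding fps_const_1_eq_1[symmetric] by (rule ev_const)
  ultimately show ?thesis by (simp add: hom_on_def ev_mult)
qed

lemma ev_0 [simp]: "ev 0 f = f $ 0"
  using fps_value_eqI[of f 0 "f $ 0"]
    has_vsum_superset[OF has_vsum_finite[of "{0}" "\<lambda>i. f $ i * 0 ^ i"], of UNIV] by simp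

definition V :: "'a set" where "V = {x. 0 \<le> v x}"

lemma subring_V: "subring V"
  by (auto simp: subring_def V_def intro: v_ge_add v_nonneg_mult)

lemma v_pos_real: "0 < v x \<Longrightarrow> \<exists>d>0. ereal d \<le> v x"
  by (cases "v x") (auto intro: exI[of _ 1])

text \<open>The coefficients are integral, so x^n alone makes the terms small for large n; each of
  the remaining degrees involves only finitely many \<open>i\<close>.\<close>

lemma vnull_locally_finite:
  assumes B: "\<And>i. B i \<in> fps_over V" and fin: "\<And>n. finite {i. B i $ n \<noteq> 0}" and x: "0 < v x"
  shows "vnull (\<lambda>(i, n). B i $ n * x ^ n) (UNIV \<times> UNIV)"
  unfolding vnull_def
proof
  fix C :: real
  obtain d where d: "d > 0" "ereal d \<le> v x" using v_pos_real[OF x] by blast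
  obtain N :: nat where N: "C / d < real N" using reals_Archimedean2 by blast
  let ?F = "(\<Union>n\<in>{..N}. {i. B i $ n \<noteq> 0} \<times> {n})"
  have "{z \<in> UNIV \<times> UNIV. \<not> ereal C \<le> v (case z of (i, n) \<Rightarrow> B i $ n * x ^ n)} \<subseteq> ?F"
  proof
    fix z assume z: "z \<in> {z \<in> UNIV \<times> UNIV. \<not> ereal C \<le> v (case z of (i, n) \<Rightarrow> B i $ n * x ^ n)}"
    obtain i n where zin: "z = (i, n)" by (cases z)
    have nb: "\<not> ereal C \<le> v (B i $ n * x ^ n)" using z zin by simp
    have "0 \<le> v (B i $ n)" using B[of i] by (auto simp: fps_over_def V_def)
    then have "ereal (real n * d) \<le> v (B i $ n * x ^ n)"
      using v_ge_mult_nonneg[OF v_ge_power[OF d(2), of n], of "B i $ n"] by (simp add: mult.commute)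
    then have "real n * d < C" using nb by (meson ereal_less_eq(3) not_le order_trans)
    then have "real n < real N" using N d(1) by (simp add: pos_less_divide_eq[symmetric] less_trans)
    moreover have "B i $ n \<noteq> 0" using nb by auto
    ultimately show "z \<in> ?F" using zin by auto
  qed
  moreover have "finite ?F" using fin by auto
  ultimately show "finite {z \<in> UNIV \<times> UNIV. \<not> ereal C \<le> v (case z of (i, n) \<Rightarrow> B i $ n * x ^ n)}"
    by (rule finite_subset)
qed

lemma conv_integral: "f \<in> fps_over V \<Longrightarrow> 0 < v x \<Longrightarrow> conv x f"
proof -
  assume f: "f \<in> fps_over V" and x: "0 < v x"
  have *: "vnull (\<lambda>(i :: unit, n). f $ n * x ^ n) (UNIV \<times> UNIV)"
    using vnull_locally_finite[of "\<lambda>_ :: unit. f" x] f x by simp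
  have "{n \<in> UNIV. \<not> ereal C \<le> v (f $ n * x ^ n)} \<subseteq>
    snd ` {z \<in> UNIV \<times> UNIV. \<not> ereal C \<le> v (case z of (i :: unit, n) \<Rightarrow> f $ n * x ^ n)}" for C
    by (auto intro!: image_eqI[of _ snd "((), _)"])
  moreover have "finite (snd ` {z \<in> UNIV \<times> UNIV. \<not> ereal C \<le> v (case z of (i :: unit, n) \<Rightarrow> f $ n * x ^ n)})" for C
    using * by (simp add: vnull_def)
  ultimately show ?thesis
    unfolding conv_def vnull_def by (blast intro: finite_subset)
qed

text \<open>The double sum over (i, n) taken in both orders: the values of the series
  \<open>B i\<close> on one side, the coefficients of \<open>G\<close> on the other.\<close>

lemma ev_locally_finite:
  assumes B: "\<And>i. B i \<in> fps_over V" and fin: "\<And>n. finite {i. B i $ n \<noteq> 0}" and x: "0 < v x"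
    and G: "\<And>n. G $ n = (\<Sum>i | B i $ n \<noteq> 0. B i $ n)"
  shows "has_vsum (\<lambda>i. ev x (B i)) UNIV (ev x G)"
proof -
  obtain L where L: "has_vsum (\<lambda>(i, n). B i $ n * x ^ n) (UNIV \<times> UNIV) L"
    using vnull_has_vsum[OF vnull_locally_finite[OF B fin x]] by blast
  have *: "has_vsum (\<lambda>i. ev x (B i)) UNIV L"
    by (rule has_vsum_Sigma[OF L]) (intro conv_has_vsum conv_integral B x)
  have "has_vsum (\<lambda>i. B i $ n * x ^ n) UNIV (G $ n * x ^ n)" for n
  proof -
    have "has_vsum (\<lambda>i. B i $ n * x ^ n) UNIV (\<Sum>i | B i $ n \<noteq> 0. B i $ n * x ^ n)"
      by (rule has_vsum_superset[OF has_vsum_finite[OF fin]]) auto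
    then show ?thesis by (simp add: G sum_distrib_right)
  qed
  then have "has_vsum (\<lambda>n. G $ n * x ^ n) UNIV L"
    by (rule has_vsum_Sigma[OF has_vsum_swap[OF L]])
  then show ?thesis using * fps_value_eqI by blast
qed

lemma ev_power: "conv x f \<Longrightarrow> ev x (f ^ n) = ev x f ^ n"
  using hom_on_power[OF conv_hom, of f x n] by simp

lemma conv_power: "conv x f \<Longrightarrow> conv x (f ^ n)"
  using subring_power[OF hom_on_subring[OF conv_hom], of f x n] by simp

text \<open>The series f_r g^r form a locally finite family because g^r has order at least
  r.\<close>

lemma ev_compose:
  assumes f: "f \<in> fps_over V" and g: "g \<in> fps_over V" "g $ 0 = 0" and x: "0 < v x"
  shows "fps_value v f (ev x g) = ev x (f oo g)"
proof -
  let ?B = "\<lambda>r. fps_const (f $ r) * g ^ r"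
  have pow: "g ^ r \<in> fps_over V" for r
    using g by (intro subring_power subring_fps_over subring_V)
  have B: "?B r \<in> fps_over V" for r
    using f pow by (intro subring_mult subring_fps_over subring_V fps_over_const) (auto dest: fps_overD)
  have sub: "{r. ?B r $ n \<noteq> 0} \<subseteq> {0..n}" for n
    using fps_power_nth_eq_0[OF g(2), of n] by (auto simp: not_less[symmetric])
  have G: "(f oo g) $ n = (\<Sum>r | ?B r $ n \<noteq> 0. ?B r $ n)" for n
  proof -
    have "(f oo g) $ n = (\<Sum>r = 0..n. ?B r $ n)" by (simp add: fps_compose_nth)
    also have "\<dots> = (\<Sum>r | ?B r $ n \<noteq> 0. ?B r $ n)"
      using sub by (intro sum.mono_neutral_right) auto
    finally show ?thesis .
  qed
  have "has_vsum (\<lambda>r. ev x (?B r)) UNIV (ev x (f oo g))"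
    by (rule ev_locally_finite[OF B _ x G]) (rule finite_subset[OF sub], simp)
  moreover have "ev x (?B r) = f $ r * (ev x g) ^ r" for r
    using conv_integral[OF g(1) x] by (simp add: ev_mult conv_const conv_power ev_power)
  ultimately show ?thesis by (intro fps_value_eqI) simp
qed

lemma ev_comp2:
  assumes F: "F \<in> fps2_over V" and a: "a \<in> fps_over V" "a $ 0 = 0" and b: "b \<in> fps_over V" "b $ 0 = 0"
    and x: "0 < v x"
  shows "fps2_value v F (ev x a) (ev x b) = ev x (comp2 F a b)"
proof -
  let ?B = "\<lambda>(r, s). fps_const (F $ r $ s) * (a ^ r * b ^ s)"
  have pow: "a ^ r \<in> fps_over V" "b ^ r \<in> fps_over V" for r
    using a b by (auto intro!: subring_power subring_fps_over subring_V)
  have B: "?B z \<in> fps_over V" for z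
    using F pow by (auto simp: fps2_over_def split_def
        intro!: subring_mult[OF subring_fps_over[OF subring_V]] fps_over_const[OF subring_V])
  have vanish: "(a ^ r * b ^ s) $ n = 0" if "r + s > n" for r s n
  proof -
    have "(a ^ r) $ i * (b ^ s) $ (n - i) = 0" if "i \<le> n" for i
    proof (cases "i < r")
      case False
      then have "n - i < s" using \<open>r + s > n\<close> that by simp
      then show ?thesis using fps_power_nth_eq_0[OF b(2)] by simp
    qed (simp add: fps_power_nth_eq_0[OF a(2)])
    then show ?thesis unfolding fps_mult_nth by (intro sum.neutral) auto
  qed
  have sub: "{z. ?B z $ n \<noteq> 0} \<subseteq> {(r, s). r + s \<le> n}" for n
    using vanish[of n] by (auto simp: not_less[symmetric])
  have G: "comp2 F a b $ n = (\<Sum>z | ?B z $ n \<noteq> 0. ?B z $ n)" for n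
  proof -
    have "comp2 F a b $ n = (\<Sum>z\<in>{(r, s). r + s \<le> n}. ?B z $ n)"
      by (auto simp: comp2_def intro!: sum.cong)
    also have "\<dots> = (\<Sum>z | ?B z $ n \<noteq> 0. ?B z $ n)"
      using sub by (intro sum.mono_neutral_right finite_pairs_le) auto
    finally show ?thesis .
  qed
  have "has_vsum (\<lambda>z. ev x (?B z)) UNIV (ev x (comp2 F a b))"
    by (rule ev_locally_finite[OF B _ x G]) (rule finite_subset[OF sub finite_pairs_le])
  moreover have "ev x (?B z) = (case z of (r, s) \<Rightarrow> F $ r $ s * (ev x a) ^ r * (ev x b) ^ s)" for z
    using conv_integral[OF a(1) x] conv_integral[OF b(1) x]
    by (simp add: split_def ev_mult conv_const conv_power ev_power conv_mult mult.assoc)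
  ultimately show ?thesis by (intro fps2_value_eqI) simp
qed

end

section \<open>Convergence and values of the series E\<close>

text \<open>The coefficient of \<open>X^k\<close> in \<open>\<Sum>\<^sub>i Q\<^sup>i(T) X^(q^i) / \<pi>^i\<close>, as a series in \<open>T\<close>.\<close>

function G_coeff :: "'a::field \<Rightarrow> nat \<Rightarrow> 'a fps \<Rightarrow> nat \<Rightarrow> 'a fps" where
  "G_coeff \<pi> q Q k = (if k = 0 then 0 else if k = 1 then fps_X else
     if q \<ge> 2 \<and> q dvd k then fps_const (1 / \<pi>) * (G_coeff \<pi> q Q (k div q) oo Q) else 0)"
  by auto
termination by (relation "measure (\<lambda>(\<pi>, q, Q, k). k)") auto

declare G_coeff.simps [simp del]

text \<open>\<open>G_coeff\<close> is indexed by powers of X, whereas \<sigma> and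
  \<open>fun_eq\<close> need T as the outer variable.\<close>

definition swap_vars :: "'a::zero fps fps \<Rightarrow> 'a fps fps" where
  "swap_vars f = Abs_fps (\<lambda>k. Abs_fps (\<lambda>d. f $ d $ k))"

lemma swap_vars_nth [simp]: "swap_vars f $ k $ d = f $ d $ k"
  by (simp add: swap_vars_def)

lemma hom_on_swap_vars: "hom_on UNIV (swap_vars :: 'a::comm_ring_1 fps fps \<Rightarrow> _)"
proof -
  have "swap_vars (f * g) = swap_vars f * swap_vars g" for f g :: "'a fps fps"
  proof (intro fps_ext)
    fix k d
    have "swap_vars (f * g) $ k $ d = (\<Sum>i=0..d. \<Sum>j=0..k. f $ i $ j * g $ (d - i) $ (k - j))"
      by (simp add: fps_mult_nth fps_sum_nth)
    also have "\<dots> = (\<Sum>j=0..k. \<Sum>i=0..d. f $ i $ j * g $ (d - i) $ (k - j))"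
      by (rule sum.swap)
    also have "\<dots> = (swap_vars f * swap_vars g) $ k $ d"
      by (simp add: fps_mult_nth fps_sum_nth)
    finally show "swap_vars (f * g) $ k $ d = (swap_vars f * swap_vars g) $ k $ d" .
  qed
  moreover have "swap_vars 1 = (1 :: 'a fps fps)"
    by (intro fps_ext) auto
  ultimately show ?thesis
    by (auto simp: hom_on_def subring_UNIV fps_eq_iff)
qed

text \<open>Both sides are sums of e_r A^r, cut off by the T-degree on one side and by the X-degree
  on the other. A is divisible by both variables, so neither cut-off loses a term.\<close>

lemma swap_vars_lift_compose:
  fixes A :: "'a::comm_ring_1 fps fps"
  assumes A: "A $ 0 = 0" "swap_vars A $ 0 = 0"
  shows "swap_vars (lift e oo A) = lift e oo swap_vars A"
proof (intro fps_ext)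
  fix k d
  have pow: "swap_vars A ^ r = swap_vars (A ^ r)" for r
    using hom_on_power[OF hom_on_swap_vars UNIV_I, of A r] by simp
  have vd: "(A ^ r) $ d $ k = 0" if "r > d" for r
    using fps_power_nth_eq_0[OF A(1) that] by simp
  have vk: "(A ^ r) $ d $ k = 0" if "r > k" for r
    using arg_cong[OF fps_power_nth_eq_0[OF A(2) that], of "\<lambda>f. f $ d"] by (simp add: pow)
  have "swap_vars (lift e oo A) $ k $ d = (\<Sum>r=0..d. e $ r * (A ^ r) $ d $ k)"
    by (simp add: fps_compose_nth fps_sum_nth)
  also have "\<dots> = (\<Sum>r=0..max d k. e $ r * (A ^ r) $ d $ k)"
    using vd by (intro sum.mono_neutral_left) auto
  also have "\<dots> = (\<Sum>r=0..k. e $ r * (A ^ r) $ d $ k)"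
    using vk by (intro sum.mono_neutral_right) auto
  also have "\<dots> = (lift e oo swap_vars A) $ k $ d"
    by (simp add: fps_compose_nth fps_sum_nth pow)
  finally show "swap_vars (lift e oo A) $ k $ d = (lift e oo swap_vars A) $ k $ d" .
qed

context lubin_tate
begin

lemma G_coeff_simps:
  "G_coeff \<pi> q Q 0 = 0" "G_coeff \<pi> q Q (Suc 0) = fps_X"
  "k > 0 \<Longrightarrow> G_coeff \<pi> q Q (q * k) = fps_const (1 / \<pi>) * (G_coeff \<pi> q Q k oo Q)"
  "k \<noteq> 1 \<Longrightarrow> \<not> q dvd k \<Longrightarrow> G_coeff \<pi> q Q k = 0"
  using q_ge_2 by (subst G_coeff.simps, auto)+

lemma G_coeff_cases:
  obtains "k = 0" | "k = 1" | j where "k = q * j" "0 < j" "j < k" | "k \<noteq> 1" "\<not> q dvd k"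
proof -
  show ?thesis
  proof (cases "q dvd k")
    case True
    then obtain j where j: "k = q * j" by (rule dvdE)
    show ?thesis
    proof (cases "j = 0")
      case False
      then have "j < k" using mult_le_mono1[OF q_ge_2, of j] j by linarith
      then show ?thesis using that(3)[of j] j False by simp
    qed (use that(1) j in simp)
  qed (use that in blast)
qed

lemma G_coeff_power: "G_coeff \<pi> q Q (q ^ i) = fps_const (1 / \<pi> ^ i) * (fps_iter Q i)" if "Q $ 0 = 0"
proof (induction i)
  case (Suc i)
  have "G_coeff \<pi> q Q (q ^ Suc i) = fps_const (1 / \<pi>) * (G_coeff \<pi> q Q (q ^ i) oo Q)"
    using q_pos by (simp add: G_coeff_simps)
  also have "\<dots> = fps_const (1 / \<pi>) * (fps_const (1 / \<pi> ^ i) * fps_iter Q (Suc i))"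
    by (simp only: Suc fps_const_mult_compose[OF that] fps_iter.simps)
  finally show ?case by (simp add: mult.assoc[symmetric] mult.commute)
qed (simp add: G_coeff_simps)

lemma G_coeff_nonzero: "G_coeff \<pi> q Q k \<noteq> 0 \<Longrightarrow> \<exists>i. k = q ^ i"
proof (induction k rule: less_induct)
  case (less k)
  show ?case
  proof (cases k rule: G_coeff_cases)
    case (3 j)
    then have "G_coeff \<pi> q Q j \<noteq> 0" using less.prems by (auto simp: G_coeff_simps)
    then obtain i where "j = q ^ i" using less.IH[OF 3(3)] by blast
    then show ?thesis using 3 by (intro exI[of _ "Suc i"]) simp
  qed (use less.prems in \<open>auto simp: G_coeff_simps intro: exI[of _ 0]\<close>)
qed

text \<open>A single constant clears all denominators, so convergence at points of positive
  valuation follows from the integral case.\<close>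

lemma G_coeff_integral:
  assumes Q: "lt_series Q"
  shows "\<exists>c. \<exists>f\<in>R1. G_coeff \<pi> q Q k = fps_const c * f"
proof (induction k rule: less_induct)
  case (less k)
  show ?case
  proof (cases k rule: G_coeff_cases)
    case (3 j)
    then obtain c f where f: "f \<in> R1" "G_coeff \<pi> q Q j = fps_const c * f" using less.IH by blast
    have "G_coeff \<pi> q Q k = fps_const (1 / \<pi> * c) * (f oo Q)"
      using lt_series_simps[OF Q] by (simp add: 3 f(2) G_coeff_simps fps_const_mult_compose mult.assoc[symmetric])
    moreover have "f oo Q \<in> R1" by (intro fps_over_compose R f lt_series_simps[OF Q])
    ultimately show ?thesis by blast
  next
    case 1
    then show ?thesis using subring_0[OF R1] by (intro exI[of _ 0] bexI[of _ 0]) (auto simp: G_coeff_simps)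
  next
    case 2
    then show ?thesis using fps_over_X[OF R] by (intro exI[of _ 1] bexI[of _ fps_X]) (auto simp: G_coeff_simps)
  next
    case 4
    then show ?thesis using subring_0[OF R1] by (intro exI[of _ 0] bexI[of _ 0]) (auto simp: G_coeff_simps)
  qed
qed

lemma G_coeff_nth_0: "lt_series Q \<Longrightarrow> G_coeff \<pi> q Q k $ 0 = 0"
proof (induction k rule: less_induct)
  case (less k)
  show ?case
    by (cases k rule: G_coeff_cases) (use less in \<open>auto simp: G_coeff_simps\<close>)
qed

text \<open>The linear coefficient \<pi> of Q cancels the factor 1 / \<pi> at each step. This
  supplies the separate linear condition in \<open>fun_eq\<close>.\<close>

lemma G_coeff_nth_1: "lt_series Q \<Longrightarrow> G_coeff \<pi> q Q k $ Suc 0 \<in> R"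
proof (induction k rule: less_induct)
  case (less k)
  note Q = lt_series_simps[OF less.prems]
  show ?case
  proof (cases k rule: G_coeff_cases)
    case (3 j)
    have "G_coeff \<pi> q Q k $ Suc 0 = G_coeff \<pi> q Q j $ Suc 0"
      using \<pi>_nonzero Q by (simp add: 3 G_coeff_simps fps_compose_nth G_coeff_nth_0[OF less.prems])
    then show ?thesis using less 3 by simp
  qed (auto simp: G_coeff_simps subring_0[OF R] subring_1[OF R])
qed

text \<open>The first half of A(T, X), with T outermost; the second half is the same series at
  X^q.\<close>

definition Gser :: "'a fps \<Rightarrow> 'a fps fps" where
  "Gser Q = swap_vars (Abs_fps (G_coeff \<pi> q Q))"

abbreviation inner_pow :: "'a fps fps \<Rightarrow> 'a fps fps" where
  "inner_pow \<equiv> map_fps (\<lambda>g. g oo fps_X ^ q)"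

definition Aser :: "'a fps \<Rightarrow> 'a fps fps" where
  "Aser Q = Gser Q - inner_pow (Gser Q)"

lemma Gser_nth: "Gser Q $ d $ k = G_coeff \<pi> q Q k $ d"
  by (simp add: Gser_def)

lemma Aser_nth: "Aser Q $ d $ k = G_coeff \<pi> q Q k $ d - (if q dvd k then G_coeff \<pi> q Q (k div q) $ d else 0)"
  by (simp add: Aser_def Gser_nth fps_nth_compose_X_power)

lemma \<sigma>_inner_pow: "\<sigma> Q (inner_pow f) = inner_pow (\<sigma> Q f)"
proof -
  have "inner_pow (lift Q) = lift Q" by (rule fps_ext) simp
  then show ?thesis
    using map_fps_compose[OF hom_on_compose_X_power[OF q_pos(2)], of "inner_pow f" "lift Q"]
    by (simp add: \<sigma>_def)
qed

text \<open>\<sigma> shifts the index i by one, so G - \<sigma>(G) / \<pi> is the term i = 0, namely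
  T X.\<close>

lemma fun_eq_Gser:
  assumes Q: "lt_series Q"
  shows "fun_eq Q (Gser Q)"
proof -
  note Q' = lt_series_simps[OF Q]
  have "\<sigma> Q (Gser Q) $ d $ k = (if q dvd k then (G_coeff \<pi> q Q (k div q) oo Q) $ d else 0)" for d k
  proof -
    have "\<sigma> Q (Gser Q) $ d $ k = (\<Sum>r=0..d. (if q dvd k then G_coeff \<pi> q Q (k div q) $ r else 0) * (Q ^ r) $ d)"
    proof -
      have "\<sigma> Q (Gser Q) $ d = (\<Sum>r=0..d. (Gser Q $ r oo fps_X ^ q) * fps_const ((Q ^ r) $ d))"
        by (simp add: \<sigma>_def fps_compose_nth lift_simps(5)[symmetric] del: lift_simps(5))
      then show ?thesis
        by (simp add: fps_sum_nth fps_nth_compose_X_power Gser_nth cong: if_cong)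
    qed
    then show ?thesis by (simp add: fps_compose_nth)
  qed
  then have "(Gser Q - c2 (1 / \<pi>) * \<sigma> Q (Gser Q)) $ d $ k = (fps_const fps_X * fps_X) $ d $ k" for d k
    using Q' q_ge_2 by (cases k rule: G_coeff_cases) (auto simp: Gser_nth G_coeff_simps)
  then have "Gser Q - c2 (1 / \<pi>) * \<sigma> Q (Gser Q) = fps_const fps_X * fps_X"
    by (intro fps_ext)
  moreover have "fps_const fps_X * fps_X \<in> R2"
    by (intro subring_mult[OF R2] fps_over_const R1 fps_over_X R)
  moreover have "Gser Q $ 0 = 0" "Gser Q $ 1 \<in> R1"
    using G_coeff_nth_0[OF Q] G_coeff_nth_1[OF Q] by (auto simp: fps_eq_iff Gser_nth intro!: fps_overI)
  ultimately show ?thesis by (simp add: fun_eq_def)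
qed

lemma inner_pow_coeff_in: "f \<in> R1 \<Longrightarrow> f oo fps_X ^ q \<in> R1"
  by (intro fps_over_compose R subring_power R1 fps_over_X)

text \<open>Substituting X^q for X commutes with \<sigma> and preserves integrality, so both halves
  of A satisfy the functional equation.\<close>

lemma fun_eq_Aser:
  assumes Q: "lt_series Q"
  shows "fun_eq Q (Aser Q)"
proof -
  note S = lt_series_simps(5)[OF Q]
  let ?G = "Gser Q"
  have G: "fun_eq Q ?G" by (rule fun_eq_Gser[OF Q])
  have "inner_pow (?G - c2 (1 / \<pi>) * \<sigma> Q ?G) \<in> R2"
    using G by (intro map_fps_over[of R1] inner_pow_coeff_in) (auto simp: fun_eq_def)
  also have "inner_pow (?G - c2 (1 / \<pi>) * \<sigma> Q ?G) = inner_pow ?G - c2 (1 / \<pi>) * \<sigma> Q (inner_pow ?G)"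
  proof -
    have "inner_pow (c2 (1 / \<pi>)) = c2 (1 / \<pi>)" by (rule fps_ext) simp
    then show ?thesis
      using hom_on_diff[OF hom_inner, of ?G "c2 (1 / \<pi>) * \<sigma> Q ?G"]
        hom_on_mult[OF hom_inner, of "c2 (1 / \<pi>)" "\<sigma> Q ?G"]
      by (simp add: \<sigma>_inner_pow)
  qed
  finally have "fun_eq Q (inner_pow ?G)"
    using G inner_pow_coeff_in by (auto simp: fun_eq_def)
  then have "fun_eq Q (c2 (-1) * inner_pow ?G)"
    by (intro fun_eq_const_mult S subring_minus subring_1 R)
  then have "fun_eq Q (?G + c2 (-1) * inner_pow ?G)"
    by (intro fun_eq_add S G)
  also have "?G + c2 (-1) * inner_pow ?G = Aser Q"
  proof -
    have neg: "c2 (-1) = - (1 :: 'a fps fps)" by (simp add: fps_eq_iff)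
    show ?thesis by (simp only: neg Aser_def mult_minus_left mult_1_left add_uminus_conv_diff)
  qed
  finally show ?thesis .
qed

lemma Aser_nth_0: "lt_series Q \<Longrightarrow> Aser Q $ 0 = 0"
  by (simp add: fps_eq_iff Aser_nth G_coeff_nth_0)

lemma swap_vars_Aser_nth_0: "swap_vars (Aser Q) $ 0 = 0"
  by (simp add: fps_eq_iff Aser_nth G_coeff_simps)

end

section \<open>Convergence in X, specialisation of T, and comparison of the values\<close>

locale lubin_tate_valued = lubin_tate R \<pi> q + complete_valuation v
  for R :: "'a::field_char_0 set" and \<pi> q and v :: "'a \<Rightarrow> ereal" +
  assumes R_subset: "R \<subseteq> V" and \<pi>_pos: "0 < v \<pi>"
begin

lemma R1_V: "f \<in> R1 \<Longrightarrow> f \<in> fps_over V"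
  using R_subset by (auto simp: fps_over_def)

text \<open>The i-th iterate is exp_Q(\<pi>^i log_Q). After division by \<pi>^i the linear term of
  exp_Q gives log_Q exactly, and the term of degree r >= 2 still carries \<pi>^(i (r - 1)).\<close>

lemma fps_iter_limit:
  assumes Q: "lt_series Q"
  shows "val_tendsto v (\<lambda>i. fps_iter Q i $ d / \<pi> ^ i) (log Q $ d)"
  unfolding val_tendsto_iff
proof
  fix C :: real
  define t where "t = (\<lambda>r. exp Q $ r * (log Q ^ r) $ d)"
  \<comment> \<open>Only the finitely many r <= d contribute, so \<open>b\<close> bounds them
    independently of i, and \<open>N\<close> is chosen below so that b + N \<delta> > C.\<close>
  have "vnull t {0..d}" by (simp add: vnull_def)
  then obtain b where "\<forall>r\<in>{0..d}. ereal b \<le> v (t r)"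
    using vnull_bounded by blast
  then have b: "ereal b \<le> v (t r)" if "r \<le> d" for r using that by auto
  obtain \<delta> where \<delta>: "\<delta> > 0" "ereal \<delta> \<le> v \<pi>" using v_pos_real[OF \<pi>_pos] by blast
  obtain N :: nat where N: "(C - b) / \<delta> < real N" using reals_Archimedean2 by blast
  have "ereal C \<le> v (fps_iter Q i $ d / \<pi> ^ i - log Q $ d)" if i: "i \<ge> N" for i
  proof -
    have nth: "fps_iter Q i $ d = (\<Sum>r=0..d. exp Q $ r * ((\<pi> ^ i) ^ r * (log Q ^ r) $ d))"
      by (simp add: fps_iter_eq_lt_hom[OF Q] lt_hom_def fps_compose_nth power_mult_distrib fps_const_power)
    have "log Q $ d = (\<Sum>r=0..d. if r = 1 then log Q $ d else 0)"
      by (cases "d = 0") (auto simp: sum.delta)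
    then have "fps_iter Q i $ d / \<pi> ^ i - log Q $ d =
        (\<Sum>r=0..d. t r * (\<pi> ^ i) ^ r / \<pi> ^ i - (if r = 1 then log Q $ d else 0))"
      unfolding nth by (simp add: sum_subtractf sum_divide_distrib t_def ac_simps)
    also have "ereal C \<le> v \<dots>"
    proof (rule v_ge_sum)
      fix r assume r: "r \<in> {0..d}"
      consider "r = 0" | "r = 1" | "r \<ge> 2" by linarith
      then show "ereal C \<le> v (t r * (\<pi> ^ i) ^ r / \<pi> ^ i - (if r = 1 then log Q $ d else 0))"
      proof cases
        case 3
        then obtain s where s: "r = Suc (Suc s)" by (metis add_2_eq_Suc le_Suc_ex)
        have eq: "t r * (\<pi> ^ i) ^ r / \<pi> ^ i = t r * \<pi> ^ i * (\<pi> ^ i) ^ s"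
          using \<pi>_nonzero by (simp add: s)
        have "ereal (b + real i * \<delta>) \<le> v (t r * \<pi> ^ i)"
          using b[of r] r by (intro v_ge_mult v_ge_power \<delta>) auto
        moreover have "C \<le> b + real i * \<delta>"
        proof -
          have "(C - b) / \<delta> \<le> real i" using N i by linarith
          then show ?thesis using \<delta>(1) by (simp add: pos_divide_le_eq algebra_simps)
        qed
        ultimately have "ereal C \<le> v (t r * \<pi> ^ i)"
          by (meson ereal_less_eq(3) order_trans)
        then have "ereal C \<le> v (t r * \<pi> ^ i * (\<pi> ^ i) ^ s)"
          using \<pi>_pos by (elim v_ge_mult_nonneg) (intro v_nonneg_power, simp)
        then show ?thesis using 3 by (simp only: eq) simp
      qed (use \<pi>_nonzero in \<open>auto simp: t_def\<close>)
    qed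
    finally show ?thesis .
  qed
  then show "\<exists>N. \<forall>i\<ge>N. ereal C \<le> v (fps_iter Q i $ d / \<pi> ^ i - log Q $ d)" by blast
qed

text \<open>Coefficients of A at powers of q are successive differences of the sequence in
  \<open>fps_iter_limit\<close>, which makes partial sums telescope.\<close>

lemma Aser_nth_power:
  assumes Q: "lt_series Q"
  shows "Aser Q $ d $ (q ^ i) = fps_iter Q i $ d / \<pi> ^ i - (if i = 0 then 0 else fps_iter Q (i - 1) $ d / \<pi> ^ (i - 1))"
proof -
  have "q ^ Suc j div q = q ^ j" for j using q_pos by simp
  then have "Aser Q $ d $ (q ^ i) = G_coeff \<pi> q Q (q ^ i) $ d - (if i = 0 then 0 else G_coeff \<pi> q Q (q ^ (i - 1)) $ d)"
    using q_ge_2 by (cases i) (auto simp: Aser_nth)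
  then show ?thesis by (simp add: G_coeff_power[OF lt_series_simps(2)[OF Q]])
qed

lemma Aser_support:
  assumes "Aser Q $ d $ k \<noteq> 0"
  shows "\<exists>i. k = q ^ i"
proof (cases k rule: G_coeff_cases)
  case (3 j)
  then have "G_coeff \<pi> q Q k \<noteq> 0 \<or> G_coeff \<pi> q Q j \<noteq> 0"
    using assms q_pos by (auto simp: Aser_nth)
  then show ?thesis using G_coeff_nonzero 3 by (metis power_Suc)
qed (use assms in \<open>auto simp: Aser_nth G_coeff_simps intro: exI[of _ 0]\<close>)

lemma root_power: "(z :: 'a) ^ q = z \<Longrightarrow> z ^ (q ^ i) = z"
  by (induction i) (auto simp: power_mult)

text \<open>Differences of a convergent sequence tend to 0, so A converges even when v z = 0. As
  z^(q^i) = z, the partial sum up to X^(q^n) telescopes to z times the n-th term of that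
  sequence.\<close>

lemma Aser_value:
  assumes Q: "lt_series Q" and z: "z ^ q = z" "0 \<le> v z"
  shows "conv z (Aser Q $ d)" "ev z (Aser Q $ d) = z * log Q $ d"
proof -
  let ?u = "\<lambda>i. fps_iter Q i $ d / \<pi> ^ i"
  show conv: "conv z (Aser Q $ d)"
    unfolding conv_def vnull_def
  proof
    fix C :: real
    obtain N where N: "\<And>i. i \<ge> N \<Longrightarrow> ereal C \<le> v (?u i - log Q $ d)"
      using fps_iter_limit[OF Q, of d] unfolding val_tendsto_iff by meson
    have "k \<in> (\<lambda>i. q ^ i) ` {..N}" if k: "\<not> ereal C \<le> v (Aser Q $ d $ k * z ^ k)" for k
    proof -
      have "Aser Q $ d $ k \<noteq> 0" using k by auto
      then obtain i where i: "k = q ^ i" using Aser_support by blast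
      have "i \<le> N"
      proof (rule ccontr)
        assume "\<not> i \<le> N"
        then have "ereal C \<le> v (?u i - log Q $ d)" "ereal C \<le> v (?u (i - 1) - log Q $ d)" "i \<noteq> 0"
          using N by auto
        then have "ereal C \<le> v (Aser Q $ d $ k)"
          using v_ge_trans[of "ereal C" "?u i" "log Q $ d" "?u (i - 1)"] v_diff_commute[of "log Q $ d"]
          by (simp add: i Aser_nth_power[OF Q])
        then show False using k z(2) v_ge_mult_nonneg v_nonneg_power by blast
      qed
      then show ?thesis using i by blast
    qed
    then have "{k \<in> UNIV. \<not> ereal C \<le> v (Aser Q $ d $ k * z ^ k)} \<subseteq> (\<lambda>i. q ^ i) ` {..N}" by blast
    then show "finite {k \<in> UNIV. \<not> ereal C \<le> v (Aser Q $ d $ k * z ^ k)}"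
      by (rule finite_subset) simp
  qed
  have sums: "(\<Sum>k\<in>{..q ^ n}. Aser Q $ d $ k * z ^ k) = ?u n * z" for n
  proof (induction n)
    case 0
    have "Aser Q $ d $ 0 = 0" "Aser Q $ d $ Suc 0 = ?u 0"
      using Aser_nth_power[OF Q, of d 0] by (simp_all add: Aser_nth G_coeff_simps)
    then show ?case by simp
  next
    case (Suc n)
    have less: "q ^ n < q ^ Suc n" using q_ge_2 by simp
    have zero: "Aser Q $ d $ k = 0" if "q ^ n < k" "k < q ^ Suc n" for k
    proof (rule ccontr)
      assume "Aser Q $ d $ k \<noteq> 0"
      then obtain i where "k = q ^ i" using Aser_support by blast
      then have "n < i" "i < Suc n" using that q_ge_2 by (auto simp: power_strict_increasing_iff simp del: power_Suc)
      then show False by simp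
    qed
    have "{..q ^ Suc n} = {..q ^ n} \<union> {q ^ n<..q ^ Suc n}" using less by (auto simp del: power_Suc)
    then have "(\<Sum>k\<in>{..q ^ Suc n}. Aser Q $ d $ k * z ^ k) =
        (\<Sum>k\<in>{..q ^ n}. Aser Q $ d $ k * z ^ k) + (\<Sum>k\<in>{q ^ n<..q ^ Suc n}. Aser Q $ d $ k * z ^ k)"
      by (simp only:) (rule sum.union_disjoint, auto)
    also have "(\<Sum>k\<in>{q ^ n<..q ^ Suc n}. Aser Q $ d $ k * z ^ k) = (\<Sum>k\<in>{q ^ Suc n}. Aser Q $ d $ k * z ^ k)"
    proof (rule sum.mono_neutral_right)
      show "\<forall>k\<in>{q ^ n<..q ^ Suc n} - {q ^ Suc n}. Aser Q $ d $ k * z ^ k = 0"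
      proof
        fix k assume "k \<in> {q ^ n<..q ^ Suc n} - {q ^ Suc n}"
        then have "q ^ n < k" "k < q ^ Suc n" by (auto simp del: power_Suc)
        then show "Aser Q $ d $ k * z ^ k = 0" by (simp add: zero del: power_Suc)
      qed
    qed (use less in \<open>auto simp del: power_Suc\<close>)
    also have "\<dots> = (?u (Suc n) - ?u n) * z"
      using Aser_nth_power[OF Q, of d "Suc n"] root_power[OF z(1), of "Suc n"] by (simp del: power_Suc)
    finally show ?case 
      by (simp only: Suc left_diff_distrib add_diff_eq add_diff_cancel_left')
  qed
  have mono: "{..q ^ n} \<subseteq> {..q ^ Suc n}" for n
    using power_increasing[OF le_SucI[OF order_refl] q_pos(2), of n] by (simp only: atMost_subset_iff)
  have exh: "\<exists>n. k \<in> {..q ^ n}" for k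
  proof (rule exI)
    have "k < 2 ^ k" by simp
    also have "2 ^ k \<le> q ^ k" using q_ge_2 by (rule power_mono) simp
    finally show "k \<in> {..q ^ k}" by simp
  qed
  have "val_tendsto v (\<lambda>n. \<Sum>k\<in>{..q ^ n}. Aser Q $ d $ k * z ^ k) (ev z (Aser Q $ d))"
    by (rule has_vsum_partial_sums[OF conv_has_vsum[OF conv] finite_atMost mono exh])
  then have lim: "val_tendsto v (\<lambda>n. ?u n * z) (ev z (Aser Q $ d))"
    by (simp only: sums)
  have "val_tendsto v (\<lambda>n. ?u n * z) (z * log Q $ d)"
    unfolding val_tendsto_iff
  proof
    fix C
    obtain N where N: "\<And>i. i \<ge> N \<Longrightarrow> ereal C \<le> v (?u i - log Q $ d)"
      using fps_iter_limit[OF Q, of d] unfolding val_tendsto_iff by meson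
    have "ereal C \<le> v (?u i * z - z * log Q $ d)" if "i \<ge> N" for i
      using v_ge_mult_nonneg[OF N[OF that] z(2)] by (simp only: left_diff_distrib mult.commute[of z])
    then show "\<exists>N. \<forall>i\<ge>N. ereal C \<le> v (?u i * z - z * log Q $ d)" by blast
  qed
  with lim show "ev z (Aser Q $ d) = z * log Q $ d" by (rule val_tendsto_unique)
qed

lemma conv_over_lift: "lift e \<in> fps_over {f. conv x f}"
  by (auto intro!: fps_overI conv_const)

lemma map_ev_lift: "map_fps (ev x) (lift e) = e"
  by (simp add: fps_eq_iff)

definition Hser :: "'a fps \<Rightarrow> 'a fps \<Rightarrow> 'a fps fps" where
  "Hser P Q = lift (exp P) oo Aser Q"

lemma Hser_integral: "lt_series P \<Longrightarrow> lt_series Q \<Longrightarrow> Hser P Q \<in> R2"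
  unfolding Hser_def by (rule exp_integral[OF _ lt_series_simps(5) fun_eq_Aser])

text \<open>Each T-coefficient of the composition is a polynomial in T-coefficients of A, so
  evaluation at X = z passes inside, where A becomes z log_Q.\<close>

lemma Hser_value:
  assumes Q: "lt_series Q" and z: "z ^ q = z" "0 \<le> v z"
  shows "conv z (Hser P Q $ d)" "ev z (Hser P Q $ d) = lt_hom P Q z $ d"
proof -
  have A: "Aser Q \<in> fps_over {f. conv z f}"
    by (auto intro!: fps_overI Aser_value[OF Q z])
  show "conv z (Hser P Q $ d)"
    using fps_overD[OF fps_over_compose[OF hom_on_subring[OF conv_hom] conv_over_lift A]]
    by (simp add: Hser_def)
  have "map_fps (ev z) (Hser P Q) = exp P oo map_fps (ev z) (Aser Q)"
    unfolding Hser_def using map_fps_compose[OF conv_hom conv_over_lift A] by (simp add: map_ev_lift)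
  also have "map_fps (ev z) (Aser Q) = fps_const z * log Q"
    by (simp add: fps_eq_iff Aser_value[OF Q z])
  finally show "ev z (Hser P Q $ d) = lt_hom P Q z $ d"
    by (simp add: lt_hom_def fps_eq_iff)
qed

definition Eser :: "'a fps \<Rightarrow> (nat \<Rightarrow> 'a) \<Rightarrow> nat \<Rightarrow> 'a fps" where
  "Eser P \<omega> m = exp P oo
     (\<Sum>i<m. fps_const (\<omega> (m - i) / \<pi> ^ i) * (fps_X ^ (q ^ i) - fps_X ^ (q ^ (i + 1))))"

text \<open>The convention \<omega> 0 = 0 merges Q(\<omega> 1) = 0 with the other root relations.
  These are assumed only up to n because the series produced by changing the uniformiser is only
  known to satisfy those.\<close>

context
  fixes Q :: "'a fps" and \<omega> :: "nat \<Rightarrow> 'a" and n :: nat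
  assumes Q: "lt_series Q" and \<omega>_0: "\<omega> 0 = 0" and \<omega>_pos: "\<And>m. 0 < v (\<omega> m)"
    and \<omega>_Suc: "\<And>m. m < n \<Longrightarrow> ev (\<omega> (Suc m)) Q = \<omega> m"
begin

lemma conv_G_coeff: "conv (\<omega> m) (G_coeff \<pi> q Q k)"
proof -
  obtain c f where "f \<in> R1" "G_coeff \<pi> q Q k = fps_const c * f" using G_coeff_integral[OF Q] by blast
  then show ?thesis using \<omega>_pos by (simp add: conv_mult conv_const conv_integral R1_V)
qed

text \<open>The i-th iterate of Q sends \<omega> m to \<omega> (m - i), which is 0 from i = m on; so
  the infinite sum over i breaks off as in E.\<close>

lemma ev_G_coeff: "m \<le> n \<Longrightarrow> ev (\<omega> m) (G_coeff \<pi> q Q k) = (\<Sum>i<m. if k = q ^ i then \<omega> (m - i) / \<pi> ^ i else 0)"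
proof (induction k arbitrary: m rule: less_induct)
  case (less k)
  show ?case
  proof (cases m)
    case 0
    then show ?thesis by (simp add: \<omega>_0 G_coeff_nth_0[OF Q])
  next
    case (Suc l)
    have RHS: "(\<Sum>i<m. if k = q ^ i then \<omega> (m - i) / \<pi> ^ i else 0) =
        (if k = 1 then \<omega> m else 0) + (\<Sum>i<l. if k = q * q ^ i then \<omega> (l - i) / \<pi> ^ i / \<pi> else 0)"
    proof -
      let ?f = "\<lambda>i. if k = q ^ i then \<omega> (m - i) / \<pi> ^ i else 0"
      have "(\<Sum>i<m. ?f i) = ?f 0 + (\<Sum>i<l. ?f (Suc i))"
        unfolding Suc by (rule sum.lessThan_Suc_shift)
      moreover have "?f (Suc i) = (if k = q * q ^ i then \<omega> (l - i) / \<pi> ^ i / \<pi> else 0)" for i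
        by (simp add: Suc mult.commute)
      ultimately show ?thesis by simp
    qed
    show ?thesis
    proof (cases k rule: G_coeff_cases)
      case (3 j)
      obtain c f where f: "f \<in> R1" "G_coeff \<pi> q Q j = fps_const c * f" using G_coeff_integral[OF Q] by blast
      have fQ: "f oo Q \<in> R1" by (intro fps_over_compose R f lt_series_simps[OF Q])
      have conv: "conv (\<omega> m) (f oo Q)" "conv (\<omega> l) f"
        using \<omega>_pos f(1) fQ by (auto intro!: conv_integral R1_V)
      have "ev (\<omega> m) (G_coeff \<pi> q Q k) = ev (\<omega> m) (fps_const (1 / \<pi>) * (fps_const c * (f oo Q)))"
        using 3 by (simp add: G_coeff_simps f(2) fps_const_mult_compose lt_series_simps[OF Q] del: fps_const_mult)
      also have "\<dots> = 1 / \<pi> * (c * ev (\<omega> m) (f oo Q))"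
        using conv by (simp only: ev_mult conv_const conv_mult ev_const)
      also have "ev (\<omega> m) (f oo Q) = ev (\<omega> l) f"
        using ev_compose[of f Q "\<omega> m"] f(1) lt_series_simps[OF Q] \<omega>_pos \<omega>_Suc[of l] less.prems
        by (simp add: Suc R1_V)
      also have "c * ev (\<omega> l) f = ev (\<omega> l) (G_coeff \<pi> q Q j)"
        using conv by (simp add: f(2) ev_mult conv_const)
      also have "\<dots> = (\<Sum>i<l. if j = q ^ i then \<omega> (l - i) / \<pi> ^ i else 0)"
        by (rule less.IH[OF 3(3)]) (use less.prems Suc in simp)
      finally show ?thesis
        unfolding RHS using 3 q_pos by (simp add: sum_divide_distrib if_distrib[of "\<lambda>x. x / \<pi>"] cong: if_cong)
    qed (unfold RHS, use q_ge_2 hom_on_0[OF conv_hom, of "\<omega> m"] in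
        \<open>auto simp: G_coeff_simps intro!: sum.neutral sum.neutral[symmetric]\<close>)
  qed
qed

lemma map_ev_Aser:
  assumes "m \<le> n"
  shows "map_fps (ev (\<omega> m)) (swap_vars (Aser Q)) =
     (\<Sum>i<m. fps_const (\<omega> (m - i) / \<pi> ^ i) * (fps_X ^ (q ^ i) - fps_X ^ (q ^ (i + 1))))"
proof (rule fps_ext)
  fix k
  have "swap_vars (Aser Q) $ k = G_coeff \<pi> q Q k - (if q dvd k then G_coeff \<pi> q Q (k div q) else 0)"
    by (auto simp: fps_eq_iff Aser_nth)
  then have "map_fps (ev (\<omega> m)) (swap_vars (Aser Q)) $ k =
      ev (\<omega> m) (G_coeff \<pi> q Q k) - (if q dvd k then ev (\<omega> m) (G_coeff \<pi> q Q (k div q)) else 0)"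
    using hom_on_diff[OF conv_hom, of "G_coeff \<pi> q Q k" "\<omega> m" "G_coeff \<pi> q Q (k div q)"] conv_G_coeff by auto
  also have "\<dots> = (\<Sum>i<m. (if k = q ^ i then \<omega> (m - i) / \<pi> ^ i else 0) -
      (if k = q ^ (i + 1) then \<omega> (m - i) / \<pi> ^ i else 0))"
  proof -
    have "(if q dvd k then ev (\<omega> m) (G_coeff \<pi> q Q (k div q)) else 0) =
        (\<Sum>i<m. if k = q ^ (i + 1) then \<omega> (m - i) / \<pi> ^ i else 0)"
      using q_pos assms by (auto simp: ev_G_coeff intro!: sum.cong sum.neutral)
    then show ?thesis using assms by (simp add: ev_G_coeff sum_subtractf)
  qed
  also have "\<dots> = (\<Sum>i<m. fps_const (\<omega> (m - i) / \<pi> ^ i) * (fps_X ^ (q ^ i) - fps_X ^ (q ^ (i + 1)))) $ k"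
    by (auto simp: fps_sum_nth intro!: sum.cong)
  finally show "map_fps (ev (\<omega> m)) (swap_vars (Aser Q)) $ k =
    (\<Sum>i<m. fps_const (\<omega> (m - i) / \<pi> ^ i) * (fps_X ^ (q ^ i) - fps_X ^ (q ^ (i + 1)))) $ k" .
qed

text \<open>Evaluation at T = \<omega> m, applied to each X-coefficient, is a homomorphism on
  convergent series and commutes with the composition; A becomes the polynomial inside E.\<close>

lemma Eser_eq:
  assumes "m \<le> n"
  shows "Eser P \<omega> m = map_fps (ev (\<omega> m)) (swap_vars (Hser P Q))"
proof -
  have "swap_vars (Aser Q) $ k = G_coeff \<pi> q Q k - (if q dvd k then G_coeff \<pi> q Q (k div q) else 0)" for k
    by (auto simp: fps_eq_iff Aser_nth)
  then have A: "swap_vars (Aser Q) \<in> fps_over {f. conv (\<omega> m) f}"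
    using conv_G_coeff subring_diff[OF hom_on_subring[OF conv_hom], of "G_coeff \<pi> q Q _" "\<omega> m"]
      subring_0[OF hom_on_subring[OF conv_hom], of "\<omega> m"] by (auto intro!: fps_overI)
  have "swap_vars (Hser P Q) = lift (exp P) oo swap_vars (Aser Q)"
    unfolding Hser_def by (intro swap_vars_lift_compose Aser_nth_0 Q swap_vars_Aser_nth_0)
  then show ?thesis
    using map_fps_compose[OF conv_hom conv_over_lift A]
    by (simp only: Eser_def map_ev_lift map_ev_Aser[OF assms])
qed

text \<open>One double family summed in both orders: over the T-degree d first it gives the series E
  at z, over the X-degree k first the series in T at \<omega> m.\<close>

lemma Eser_value:
  assumes m: "m \<le> n" and P: "lt_series P" and z: "z ^ q = z" "0 \<le> v z"
  shows "fps_value v (Eser P \<omega> m) z = ev (\<omega> m) (lt_hom P Q z)"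
proof -
  let ?H = "Hser P Q" and ?x = "\<omega> m"
  let ?c = "\<lambda>(k, d). (?H $ d $ k * z ^ k) * ?x ^ d"
  have int: "0 \<le> v (?H $ d $ k)" for d k
  proof -
    have "?H $ d $ k \<in> R" by (intro fps_overD Hser_integral P Q)
    then show ?thesis using R_subset by (auto simp: V_def)
  qed
  have null: "vnull ?c (UNIV \<times> UNIV)"
    unfolding vnull_def
  proof
    fix C :: real
    obtain \<delta> where \<delta>: "\<delta> > 0" "ereal \<delta> \<le> v ?x" using v_pos_real[OF \<omega>_pos] by blast
    obtain N :: nat where N: "C / \<delta> < real N" using reals_Archimedean2 by blast
    let ?F = "\<Union>d\<in>{..N}. {k \<in> UNIV. \<not> ereal C \<le> v (?H $ d $ k * z ^ k)} \<times> {d}"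
    have "w \<in> ?F" if w: "\<not> ereal C \<le> v (?c w)" for w
    proof -
      obtain k d where kd: "w = (k, d)" by (cases w)
      have nb: "\<not> ereal C \<le> v (?H $ d $ k * z ^ k * ?x ^ d)" using w kd by simp
      have "0 \<le> v (?H $ d $ k * z ^ k)"
        using int z by (intro v_nonneg_mult v_nonneg_power)
      then have "ereal (real d * \<delta>) \<le> v (?x ^ d * (?H $ d $ k * z ^ k))"
        by (rule v_ge_mult_nonneg[OF v_ge_power[OF \<delta>(2)]])
      then have "ereal (real d * \<delta>) \<le> v (?H $ d $ k * z ^ k * ?x ^ d)"
        by (simp only: mult.commute[of "?x ^ d"])
      then have "real d * \<delta> < C" using nb by (meson ereal_less_eq(3) not_le order_trans)
      then have "real d < real N" using N \<delta>(1) by (simp add: pos_less_divide_eq[symmetric] less_trans)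
      moreover have "\<not> ereal C \<le> v (?H $ d $ k * z ^ k)"
        using nb v_ge_mult_nonneg v_nonneg_power \<omega>_pos less_imp_le by blast
      ultimately show ?thesis using kd by auto
    qed
    then have "{w \<in> UNIV \<times> UNIV. \<not> ereal C \<le> v (?c w)} \<subseteq> ?F" by blast
    moreover have "finite ?F"
      using Hser_value(1)[OF Q z, of P] by (auto simp: conv_def vnull_def)
    ultimately show "finite {w \<in> UNIV \<times> UNIV. \<not> ereal C \<le> v (?c w)}" by (rule finite_subset)
  qed
  then obtain L where L: "has_vsum ?c (UNIV \<times> UNIV) L" using vnull_has_vsum by blast
  have rows: "has_vsum (\<lambda>d. (?H $ d $ k * z ^ k) * ?x ^ d) UNIV (Eser P \<omega> m $ k * z ^ k)" for k
  proof -
    have "swap_vars ?H $ k \<in> fps_over V"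
      using int by (auto intro!: fps_overI simp: V_def)
    then have "has_vsum (\<lambda>d. swap_vars ?H $ k $ d * ?x ^ d) UNIV (ev ?x (swap_vars ?H $ k))"
      by (intro conv_has_vsum conv_integral \<omega>_pos)
    then have "has_vsum (\<lambda>d. swap_vars ?H $ k $ d * ?x ^ d) UNIV (Eser P \<omega> m $ k)"
      by (simp add: Eser_eq[OF m])
    from has_vsum_cmult[OF this, of "z ^ k"] show ?thesis
      by (simp add: ac_simps)
  qed
  have cols: "has_vsum (\<lambda>k. (?H $ d $ k * z ^ k) * ?x ^ d) UNIV (lt_hom P Q z $ d * ?x ^ d)" for d
    using has_vsum_cmult[OF conv_has_vsum[OF Hser_value(1)[OF Q z]], of "?x ^ d" P d]
    by (simp add: Hser_value(2)[OF Q z] mult.commute)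
  have "has_vsum (\<lambda>k. Eser P \<omega> m $ k * z ^ k) UNIV L"
    by (rule has_vsum_Sigma[OF L rows])
  moreover have "has_vsum (\<lambda>d. lt_hom P Q z $ d * ?x ^ d) UNIV L"
    by (rule has_vsum_Sigma[OF has_vsum_swap[OF L] cols])
  ultimately show ?thesis
    by (simp add: fps_value_eqI)
qed

text \<open>Composition with Q turns [a] into [a \<pi>], and Q lowers the index of the root by
  one.\<close>

lemma ev_lt_hom_lt:
  assumes P: "lt_series P" and a: "a \<in> R"
  shows "m + i \<le> n \<Longrightarrow> ev (\<omega> (m + i)) (lt_hom P Q (a * \<pi> ^ i)) = ev (\<omega> m) (lt_hom P Q a)"
proof (induction i)
  case (Suc i)
  have "lt_hom P Q (a * \<pi> ^ Suc i) = lt_hom P Q (a * \<pi> ^ i) oo Q"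
    by (simp add: lt_hom_compose_lt[OF Q] ac_simps)
  moreover have "lt_hom P Q (a * \<pi> ^ i) \<in> fps_over V"
    by (intro R1_V lt_hom_integral P Q subring_mult R a subring_power \<pi>_in)
  ultimately show ?case
    using ev_compose[of "lt_hom P Q (a * \<pi> ^ i)" Q "\<omega> (m + Suc i)"] lt_series_simps[OF Q] R1_V \<omega>_pos
      \<omega>_Suc[of "m + i"] Suc by simp
qed simp

text \<open>The logarithms of the two arguments are a log_Q and b log_Q, so the group law adds a and
  b.\<close>

lemma ev_lt_hom_add:
  assumes P: "lt_series P" and ab: "a \<in> R" "b \<in> R" and x: "0 < v x"
  shows "fps2_value v (FG P) (ev x (lt_hom P Q a)) (ev x (lt_hom P Q b)) = ev x (lt_hom P Q (a + b))"
proof -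
  have "fps2_value v (FG P) (ev x (lt_hom P Q a)) (ev x (lt_hom P Q b)) = ev x (comp2 (FG P) (lt_hom P Q a) (lt_hom P Q b))"
    using FG_integral[OF P] R_subset x
    by (intro ev_comp2 R1_V lt_hom_integral P Q ab) (auto simp: fps2_over_def)
  also have "comp2 (FG P) (lt_hom P Q a) (lt_hom P Q b) = lt_hom P Q (a + b)"
    unfolding FG_def by (subst comp2_exp_law)
      (auto simp: log_lt_hom lt_hom_def[of P Q "a + b"] distrib_right fps_const_add[symmetric] simp del: fps_const_add)
  finally show ?thesis .
qed

lemma value_identity:
  assumes P: "lt_series P" and n: "n \<ge> 1"
    and z: "\<And>i. i < n \<Longrightarrow> z i \<in> R" "\<And>i. i < n \<Longrightarrow> z i ^ q = z i"
  shows "fps_value v (lt_hom P P (\<Sum>i<n. z i * \<pi> ^ i)) (fps_value v (Eser P \<omega> n) 1) =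
    foldl (fps2_value v (FG P)) (fps_value v (Eser P \<omega> n) (z 0))
      (map (\<lambda>i. fps_value v (Eser P \<omega> (n - i)) (z i)) [1..<n])"
proof -
  let ?x = "\<omega> n"
  \<comment> \<open>The factor \<pi>^i moves the value from the root \<omega> (n - i) to the common
    root \<omega> n.\<close>
  have term_eq: "fps_value v (Eser P \<omega> (n - i)) (z i) = ev ?x (lt_hom P Q (z i * \<pi> ^ i))" if i: "i < n" for i
  proof -
    have "z i \<in> V" using z(1)[OF i] R_subset by auto
    then have "fps_value v (Eser P \<omega> (n - i)) (z i) = ev (\<omega> (n - i)) (lt_hom P Q (z i))"
      by (intro Eser_value P z(2) i) (simp_all add: V_def)
    also have "\<dots> = ev (\<omega> (n - i + i)) (lt_hom P Q (z i * \<pi> ^ i))"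
      using i by (intro ev_lt_hom_lt[OF P z(1)[OF i], symmetric]) simp
    finally show ?thesis using i by simp
  qed
  have in_R: "(\<Sum>i<k. z i * \<pi> ^ i) \<in> R" if "k \<le> n" for k
    using that z(1) by (intro subring_sum R subring_mult subring_power \<pi>_in) auto
  have fold: "foldl (fps2_value v (FG P)) (ev ?x (lt_hom P Q (z 0)))
      (map (\<lambda>i. ev ?x (lt_hom P Q (z i * \<pi> ^ i))) [1..<Suc k]) = ev ?x (lt_hom P Q (\<Sum>i<Suc k. z i * \<pi> ^ i))"
    if "Suc k \<le> n" for k
    using that
  proof (induction k)
    case (Suc k)
    have "[1..<Suc (Suc k)] = [1..<Suc k] @ [Suc k]" by simp
    then have "foldl (fps2_value v (FG P)) (ev ?x (lt_hom P Q (z 0)))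
        (map (\<lambda>i. ev ?x (lt_hom P Q (z i * \<pi> ^ i))) [1..<Suc (Suc k)]) =
        fps2_value v (FG P) (ev ?x (lt_hom P Q (\<Sum>i<Suc k. z i * \<pi> ^ i))) (ev ?x (lt_hom P Q (z (Suc k) * \<pi> ^ Suc k)))"
      using Suc by (simp only: map_append foldl_append) simp
    also have "\<dots> = ev ?x (lt_hom P Q ((\<Sum>i<Suc k. z i * \<pi> ^ i) + z (Suc k) * \<pi> ^ Suc k))"
      using Suc.prems z(1)
      by (intro ev_lt_hom_add P in_R \<omega>_pos subring_mult R subring_power \<pi>_in) auto
    finally show ?case by (simp only: sum.lessThan_Suc)
  qed simp
  \<comment> \<open>The value at 1 is the image of \<omega> n under the isomorphism [1] from the
    group of Q to that of P.\<close>
  have one: "fps_value v (Eser P \<omega> n) 1 = ev ?x (lt_hom P Q 1)"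
    by (rule Eser_value[OF _ P]) auto
  have "fps_value v (lt_hom P P (\<Sum>i<n. z i * \<pi> ^ i)) (fps_value v (Eser P \<omega> n) 1) =
      ev ?x (lt_hom P P (\<Sum>i<n. z i * \<pi> ^ i) oo lt_hom P Q 1)"
    unfolding one using in_R[of n] \<omega>_pos
    by (intro ev_compose R1_V lt_hom_integral P Q subring_1 R) auto
  also have "\<dots> = ev ?x (lt_hom P Q (\<Sum>i<n. z i * \<pi> ^ i))"
    by (simp add: lt_hom_compose)
  also have "\<dots> = foldl (fps2_value v (FG P)) (ev ?x (lt_hom P Q (z 0)))
      (map (\<lambda>i. ev ?x (lt_hom P Q (z i * \<pi> ^ i))) [1..<n])"
    using fold[of "n - 1"] n by simp
  also have "\<dots> = foldl (fps2_value v (FG P)) (fps_value v (Eser P \<omega> n) (z 0))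
      (map (\<lambda>i. fps_value v (Eser P \<omega> (n - i)) (z i)) [1..<n])"
  proof -
    have eq: "map (\<lambda>i. fps_value v (Eser P \<omega> (n - i)) (z i)) [1..<n] =
        map (\<lambda>i. ev ?x (lt_hom P Q (z i * \<pi> ^ i))) [1..<n]"
      using term_eq by (intro map_cong) auto
    show ?thesis unfolding eq using term_eq[of 0] n by simp
  qed
  finally show ?thesis .
qed

end

end

section \<open>Finite extensions of the p-adic numbers\<close>

locale valued_field = complete_valuation v for v :: "'a::field_char_0 \<Rightarrow> ereal"
begin

section \<open>Limits and closedness of finite-dimensional spaces\<close>

definition vclosed :: "'a set \<Rightarrow> bool" where
  "vclosed A \<longleftrightarrow> (\<forall>s L. (\<forall>n. s n \<in> A) \<longrightarrow> val_tendsto v s L \<longrightarrow> L \<in> A)"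

lemma vclosedD: "vclosed A \<Longrightarrow> (\<And>n. s n \<in> A) \<Longrightarrow> val_tendsto v s L \<Longrightarrow> L \<in> A"
  unfolding vclosed_def by blast

lemma val_tendstoI: "(\<And>C. \<exists>N. \<forall>n\<ge>N. ereal C \<le> v (s n - L)) \<Longrightarrow> val_tendsto v s L"
  by (simp add: val_tendsto_iff)

lemma val_tendsto_add:
  assumes "val_tendsto v s L" "val_tendsto v t M"
  shows "val_tendsto v (\<lambda>n. s n + t n) (L + M)"
proof (rule val_tendstoI)
  fix C
  obtain N1 where N1: "\<And>n. n \<ge> N1 \<Longrightarrow> ereal C \<le> v (s n - L)" using assms(1) unfolding val_tendsto_iff by meson
  obtain N2 where N2: "\<And>n. n \<ge> N2 \<Longrightarrow> ereal C \<le> v (t n - M)" using assms(2) unfolding val_tendsto_iff by meson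
  have "ereal C \<le> v (s n + t n - (L + M))" if "n \<ge> max N1 N2" for n
    using v_ge_add[OF N1[of n] N2[of n]] that by (simp add: algebra_simps)
  then show "\<exists>N. \<forall>n\<ge>N. ereal C \<le> v (s n + t n - (L + M))" by blast
qed

lemma val_tendsto_cmult:
  assumes "val_tendsto v s L"
  shows "val_tendsto v (\<lambda>n. k * s n) (k * L)"
proof (rule val_tendstoI)
  fix C
  obtain D where D: "ereal D \<le> v k" using v_bounded by blast
  obtain N where N: "\<And>n. n \<ge> N \<Longrightarrow> ereal (C - D) \<le> v (s n - L)" using assms unfolding val_tendsto_iff by meson
  have "ereal C \<le> v (k * s n - k * L)" if "n \<ge> N" for n
    using v_ge_mult[OF D N[OF that]] by (simp add: right_diff_distrib)
  then show "\<exists>N. \<forall>n\<ge>N. ereal C \<le> v (k * s n - k * L)" by blast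
qed

lemma val_tendsto_mult:
  assumes s: "val_tendsto v s L" and t: "val_tendsto v t M"
  shows "val_tendsto v (\<lambda>n. s n * t n) (L * M)"
proof (rule val_tendstoI)
  fix C
  obtain D where D: "ereal D \<le> v L" using v_bounded by blast
  obtain E where E: "ereal E \<le> v M" using v_bounded by blast
  obtain N1 where N1: "\<And>n. n \<ge> N1 \<Longrightarrow> ereal (C - E) \<le> v (s n - L)" using s unfolding val_tendsto_iff by meson
  obtain N2 where N2: "\<And>n. n \<ge> N2 \<Longrightarrow> ereal E \<le> v (t n - M)" using t unfolding val_tendsto_iff by meson
  obtain N3 where N3: "\<And>n. n \<ge> N3 \<Longrightarrow> ereal (C - D) \<le> v (t n - M)" using t unfolding val_tendsto_iff by meson
  have "ereal C \<le> v (s n * t n - L * M)" if n: "n \<ge> max N1 (max N2 N3)" for n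
  proof -
    have "ereal E \<le> v (t n)" using v_ge_add[OF N2[of n] E] n by simp
    then have "ereal C \<le> v ((s n - L) * t n)"
      using v_ge_mult[OF N1[of n], of E "t n"] n by simp
    moreover have "ereal C \<le> v (L * (t n - M))"
      using v_ge_mult[OF D N3[of n]] n by simp
    ultimately have "ereal C \<le> v ((s n - L) * t n + L * (t n - M))" by (rule v_ge_add)
    then show ?thesis by (simp add: algebra_simps)
  qed
  then show "\<exists>N. \<forall>n\<ge>N. ereal C \<le> v (s n * t n - L * M)" by blast
qed

lemma v_eq_of_close: "v y < v (x - y) \<Longrightarrow> v x = v y"
proof -
  assume *: "v y < v (x - y)"
  have "v y \<le> v x" using v_ge_add[of "v y" "x - y" y] * by simp
  moreover have "v x \<le> v y"
  proof (rule ccontr)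
    assume "\<not> v x \<le> v y"
    then have "v y < min (v x) (v (x - y))" using * by simp
    also have "\<dots> \<le> v (x - (x - y))" by (rule v_ge_diff) auto
    finally show False by simp
  qed
  ultimately show ?thesis by (rule antisym[rotated])
qed

lemma val_tendsto_inverse:
  assumes s: "val_tendsto v s L" and L: "L \<noteq> 0"
  shows "val_tendsto v (\<lambda>n. inverse (s n)) (inverse L)"
proof (rule val_tendstoI)
  fix C
  obtain l where l: "v L = ereal l" using L v_not_MInf[of L] v_eq_PInf[of L] by (cases "v L") auto
  obtain N1 where N1: "\<And>n. n \<ge> N1 \<Longrightarrow> ereal (l + 1) \<le> v (s n - L)" using s unfolding val_tendsto_iff by meson
  obtain N2 where N2: "\<And>n. n \<ge> N2 \<Longrightarrow> ereal (C + 2 * l) \<le> v (s n - L)" using s unfolding val_tendsto_iff by meson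
  have "ereal C \<le> v (inverse (s n) - inverse L)" if n: "n \<ge> max N1 N2" for n
  proof -
    have "v L < ereal (l + 1)" by (simp add: l)
    also have "\<dots> \<le> v (s n - L)" using N1 n by simp
    finally have vs: "v (s n) = ereal l" using v_eq_of_close[of L "s n"] l by simp
    then have s0: "s n \<noteq> 0" by auto
    have "inverse (s n) - inverse L = (L - s n) * (inverse (s n) * inverse L)"
      using s0 L by (simp add: field_simps)
    moreover have "ereal (- l) \<le> v (inverse (s n))" "ereal (- l) \<le> v (inverse L)"
      using s0 L vs l by (simp_all add: v_inverse)
    then have "ereal (- l + - l) \<le> v (inverse (s n) * inverse L)" by (rule v_ge_mult)
    moreover have "ereal (C + 2 * l) \<le> v (L - s n)" using N2[of n] n v_diff_commute by simp
    ultimately show ?thesis using v_ge_mult[of "C + 2 * l" "L - s n" "- l + - l"] by simp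
  qed
  then show "\<exists>N. \<forall>n\<ge>N. ereal C \<le> v (inverse (s n) - inverse L)" by blast
qed

lemma val_tendsto_const: "val_tendsto v (\<lambda>n. c) c"
  by (rule val_tendstoI) simp

lemma Qp_add: "x \<in> Qp v \<Longrightarrow> y \<in> Qp v \<Longrightarrow> x + y \<in> Qp v"
proof -
  assume "x \<in> Qp v" "y \<in> Qp v"
  then obtain s t where "\<forall>n. s n \<in> \<rat>" "val_tendsto v s x" "\<forall>n. t n \<in> \<rat>" "val_tendsto v t y"
    unfolding Qp_def by blast
  then show ?thesis
    unfolding Qp_def by (intro CollectI exI[of _ "\<lambda>n. s n + t n"]) (simp add: val_tendsto_add)
qed

lemma Qp_mult: "x \<in> Qp v \<Longrightarrow> y \<in> Qp v \<Longrightarrow> x * y \<in> Qp v"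
proof -
  assume "x \<in> Qp v" "y \<in> Qp v"
  then obtain s t where "\<forall>n. s n \<in> \<rat>" "val_tendsto v s x" "\<forall>n. t n \<in> \<rat>" "val_tendsto v t y"
    unfolding Qp_def by blast
  then show ?thesis
    unfolding Qp_def by (intro CollectI exI[of _ "\<lambda>n. s n * t n"]) (simp add: val_tendsto_mult)
qed

lemma Qp_rat: "x \<in> \<rat> \<Longrightarrow> x \<in> Qp v"
  unfolding Qp_def by (intro CollectI exI[of _ "\<lambda>n. x"]) (simp add: val_tendsto_const)

lemma Qp_minus: "x \<in> Qp v \<Longrightarrow> - x \<in> Qp v"
  using Qp_mult[OF Qp_rat[of "-1"]] by simp

lemma Qp_inverse: "x \<in> Qp v \<Longrightarrow> inverse x \<in> Qp v"
proof (cases "x = 0")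
  case False
  assume "x \<in> Qp v"
  then obtain s where "\<forall>n. s n \<in> \<rat>" "val_tendsto v s x"
    unfolding Qp_def by blast
  then show ?thesis
    unfolding Qp_def using False
    by (intro CollectI exI[of _ "\<lambda>n. inverse (s n)"]) (simp add: val_tendsto_inverse)
qed (simp add: Qp_rat)

lemma vclosed_Qp: "vclosed (Qp v)"
  unfolding vclosed_def
proof (intro allI impI)
  fix s L assume s: "\<forall>n. s n \<in> Qp v" and L: "val_tendsto v s L"
  have "\<exists>r\<in>\<rat>. ereal (real n) \<le> v (r - s n)" for n
  proof -
    obtain t where t: "\<forall>k. t k \<in> \<rat>" "val_tendsto v t (s n)" using s by (auto simp: Qp_def)
    obtain N where "\<And>k. k \<ge> N \<Longrightarrow> ereal (real n) \<le> v (t k - s n)" using t(2) unfolding val_tendsto_iff by meson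
    then show ?thesis using t(1) by blast
  qed
  then obtain r where r: "\<And>n. r n \<in> \<rat>" "\<And>n. ereal (real n) \<le> v (r n - s n)" by metis
  have "val_tendsto v r L"
  proof (rule val_tendstoI)
    fix C
    obtain N where N: "\<And>n. n \<ge> N \<Longrightarrow> ereal C \<le> v (s n - L)" using L unfolding val_tendsto_iff by meson
    obtain M :: nat where M: "C < real M" using reals_Archimedean2 by blast
    have "ereal C \<le> v (r n - L)" if n: "n \<ge> max N M" for n
    proof (rule v_ge_trans)
      have "ereal C \<le> ereal (real n)" using M n by simp
      then show "ereal C \<le> v (r n - s n)" using r(2)[of n] by (rule order_trans)
    qed (use N n in simp)
    then show "\<exists>N. \<forall>n\<ge>N. ereal C \<le> v (r n - L)" by blast
  qed
  then show "L \<in> Qp v" using r(1) by (auto simp: Qp_def)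
qed

definition Qspan :: "'a set \<Rightarrow> 'a set" where
  "Qspan B = {x. \<exists>c. (\<forall>b\<in>B. c b \<in> Qp v) \<and> x = (\<Sum>b\<in>B. c b * b)}"

lemma Qspan_add: "x \<in> Qspan B \<Longrightarrow> y \<in> Qspan B \<Longrightarrow> x + y \<in> Qspan B"
proof -
  assume "x \<in> Qspan B" "y \<in> Qspan B"
  then obtain c d where "\<forall>b\<in>B. c b \<in> Qp v" "x = (\<Sum>b\<in>B. c b * b)" "\<forall>b\<in>B. d b \<in> Qp v" "y = (\<Sum>b\<in>B. d b * b)"
    unfolding Qspan_def by blast
  then show ?thesis
    unfolding Qspan_def
    by (intro CollectI exI[of _ "\<lambda>b. c b + d b"]) (auto simp: Qp_add distrib_right sum.distrib)
qed

lemma Qspan_scale: "x \<in> Qspan B \<Longrightarrow> k \<in> Qp v \<Longrightarrow> k * x \<in> Qspan B"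
proof -
  assume "x \<in> Qspan B" and k: "k \<in> Qp v"
  then obtain c where "\<forall>b\<in>B. c b \<in> Qp v" "x = (\<Sum>b\<in>B. c b * b)"
    unfolding Qspan_def by blast
  then show ?thesis
    unfolding Qspan_def using k
    by (intro CollectI exI[of _ "\<lambda>b. k * c b"]) (auto simp: Qp_mult sum_distrib_left mult.assoc)
qed

lemma Qspan_diff: "x \<in> Qspan B \<Longrightarrow> y \<in> Qspan B \<Longrightarrow> x - y \<in> Qspan B"
  using Qspan_add[of x B "-1 * y"] Qspan_scale[of y B "-1"] Qp_rat[of "-1"] by simp

lemma Qspan_insert:
  assumes "finite B" "b \<notin> B"
  shows "Qspan (insert b B) = {w + k * b |w k. w \<in> Qspan B \<and> k \<in> Qp v}"
proof (intro subset_antisym subsetI)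
  fix x assume "x \<in> Qspan (insert b B)"
  then obtain c where "\<forall>b\<in>insert b B. c b \<in> Qp v" "x = (\<Sum>b\<in>insert b B. c b * b)"
    unfolding Qspan_def by blast
  then have "x = (\<Sum>b\<in>B. c b * b) + c b * b" "(\<Sum>b\<in>B. c b * b) \<in> Qspan B" "c b \<in> Qp v"
    using assms by (auto simp: Qspan_def)
  then show "x \<in> {w + k * b |w k. w \<in> Qspan B \<and> k \<in> Qp v}" by blast
next
  fix x assume "x \<in> {w + k * b |w k. w \<in> Qspan B \<and> k \<in> Qp v}"
  then obtain c k where c: "\<forall>b\<in>B. c b \<in> Qp v" "k \<in> Qp v" "x = (\<Sum>b\<in>B. c b * b) + k * b"
    unfolding Qspan_def by blast
  have "(\<Sum>a\<in>B. (if a = b then k else c a) * a) = (\<Sum>b\<in>B. c b * b)"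
    using assms by (intro sum.cong) auto
  then show "x \<in> Qspan (insert b B)"
    unfolding Qspan_def using c assms
    by (intro CollectI exI[of _ "\<lambda>a. if a = b then k else c a"]) auto
qed

text \<open>If b lies outside the closed span W of the other generators, its distance from W is
  positive; hence the b-coordinates of a convergent sequence are Cauchy, and what remains converges
  in W.\<close>

lemma vclosed_Qspan: "finite B \<Longrightarrow> vclosed (Qspan B)"
proof (induction B rule: finite_induct)
  case empty
  have "val_tendsto v s 0 \<and> val_tendsto v s L \<Longrightarrow> L = 0" for s L
    using val_tendsto_unique by blast
  moreover have "val_tendsto v s 0" if "\<forall>n. s n = 0" for s :: "nat \<Rightarrow> 'a"
    by (rule val_tendstoI) (simp add: that)
  ultimately show ?case by (auto simp: vclosed_def Qspan_def)
next
  case (insert b B)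
  let ?W = "Qspan B"
  note span = Qspan_insert[OF insert(1,2)]
  show ?case
  proof (cases "b \<in> ?W")
    case True
    have "Qspan (insert b B) = ?W"
    proof (intro subset_antisym subsetI)
      fix x assume "x \<in> Qspan (insert b B)"
      then show "x \<in> ?W" unfolding span using True by (auto intro: Qspan_add Qspan_scale)
    next
      fix x assume "x \<in> ?W"
      then have "x = x + 0 * b \<and> x \<in> ?W \<and> 0 \<in> Qp v" by (simp add: Qp_rat)
      then show "x \<in> Qspan (insert b B)" unfolding span by blast
    qed
    then show ?thesis using insert by simp
  next
    case False
    \<comment> \<open>Otherwise elements of W would converge to b, against closedness.\<close>
    have "\<exists>M. \<forall>w\<in>?W. v (b - w) \<le> ereal M"
    proof (rule ccontr)
      assume "\<not> ?thesis"
      then have "\<forall>n::nat. \<exists>w\<in>?W. ereal (real n) \<le> v (b - w)" by (meson linear)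
      then obtain w where w: "\<And>n. w n \<in> ?W" "\<And>n. ereal (real n) \<le> v (b - w n)" by metis
      have "val_tendsto v w b"
      proof (rule val_tendstoI)
        fix C
        obtain M :: nat where M: "C < real M" using reals_Archimedean2 by blast
        have "ereal C \<le> v (w n - b)" if n: "n \<ge> M" for n
        proof -
          have "ereal C \<le> ereal (real n)" using M n by simp
          then show ?thesis using w(2)[of n] v_diff_commute[of b] by (metis order_trans)
        qed
        then show "\<exists>N. \<forall>n\<ge>N. ereal C \<le> v (w n - b)" by blast
      qed
      then show False using vclosedD[OF insert.IH, of w b] w(1) False by blast
    qed
    then obtain M where M: "\<And>w. w \<in> ?W \<Longrightarrow> v (b - w) \<le> ereal M" by blast
    show ?thesis
      unfolding vclosed_def
    proof (intro allI impI)
      fix s L assume s: "\<forall>n. s n \<in> Qspan (insert b B)" and L: "val_tendsto v s L"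
      have "\<forall>n. \<exists>w k. w \<in> ?W \<and> k \<in> Qp v \<and> s n = w + k * b" using s unfolding span by blast
      then obtain w k where wk: "\<And>n. w n \<in> ?W" "\<And>n. k n \<in> Qp v" "\<And>n. s n = w n + k n * b" by metis
      \<comment> \<open>With d = k m - k n nonzero, s m - s n = d (b - u) for some u in W, and v (b
        - u) <= M.\<close>
      have close: "ereal C \<le> v (k m - k n)" if C: "ereal (C + M) \<le> v (s m - s n)" for C m n
      proof (cases "k m = k n")
        case False
        define d where "d = k m - k n"
        have d: "d \<noteq> 0" "inverse d \<in> Qp v" "- inverse d \<in> Qp v"
          using False Qp_add[OF wk(2) Qp_minus[OF wk(2)], of m n] by (auto simp: d_def Qp_inverse Qp_minus)
        define u where "u = (- inverse d) * (w m - w n)"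
        have u: "u \<in> ?W" unfolding u_def using wk(1) d by (intro Qspan_scale Qspan_diff)
        have "s m - s n = d * (b - u)"
        proof -
          have "d * u = - (w m - w n)" using d(1) by (simp add: u_def mult.assoc[symmetric])
          then have "d * (b - u) = d * b + (w m - w n)" by (simp only: right_diff_distrib) simp
          then show ?thesis by (simp add: wk(3) d_def algebra_simps)
        qed
        then have "ereal (C + M) \<le> v d + v (b - u)" using C by (simp add: v_mult)
        also have "\<dots> \<le> v d + ereal M" using M[OF u] by (rule add_left_mono)
        finally show ?thesis unfolding d_def[symmetric] by (cases "v d") auto
      qed simp
      have "val_Cauchy v k"
        unfolding val_Cauchy_def
      proof
        fix C :: real
        obtain N where N: "\<And>n. n \<ge> N \<Longrightarrow> ereal (C + 1 + M) \<le> v (s n - L)" using L unfolding val_tendsto_iff by meson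
        have "ereal C < v (k m - k n)" if "m \<ge> N" "n \<ge> N" for m n
        proof -
          have "ereal (C + 1 + M) \<le> v (s m - s n)"
            using v_ge_trans[OF N[OF that(1)], of "s n"] N[OF that(2)] v_diff_commute[of L] by simp
          then have "ereal (C + 1) \<le> v (k m - k n)" by (rule close)
          moreover have "ereal C < ereal (C + 1)" by simp
          ultimately show ?thesis by (rule less_le_trans[rotated])
        qed
        then show "\<exists>N. \<forall>m\<ge>N. \<forall>n\<ge>N. ereal C < v (k m - k n)" by blast
      qed
      then obtain \<kappa> where \<kappa>: "val_tendsto v k \<kappa>" using complete by blast
      have "\<kappa> \<in> Qp v" using vclosedD[OF vclosed_Qp wk(2) \<kappa>] .
      have "val_tendsto v (\<lambda>n. s n + (- b) * k n) (L + (- b) * \<kappa>)"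
        by (intro val_tendsto_add L val_tendsto_cmult \<kappa>)
      moreover have "(\<lambda>n. s n + (- b) * k n) = w" by (simp add: wk(3) fun_eq_iff mult.commute)
      ultimately have "L + (- b) * \<kappa> \<in> ?W" using vclosedD[OF insert.IH wk(1)] by simp
      moreover have "L = (L + (- b) * \<kappa>) + \<kappa> * b" by (simp add: mult.commute)
      ultimately show "L \<in> Qspan (insert b B)" unfolding span using \<open>\<kappa> \<in> Qp v\<close> by blast
    qed
  qed
qed

text \<open>K is the span of its finite generating set. Closedness later places the limits of
  \<open>frobenius_powers_converge\<close> in K.\<close>

lemma finite_ext_closed:
  assumes "finite_ext_Qp v K"
  shows "vclosed K"
proof -
  have K: "is_subfield K" "Qp v \<subseteq> K" using assms by (auto simp: finite_ext_Qp_def)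
  obtain B where B: "finite B" "B \<subseteq> K" "\<forall>x\<in>K. \<exists>c. (\<forall>b\<in>B. c b \<in> Qp v) \<and> x = (\<Sum>b\<in>B. c b * b)"
    using assms unfolding finite_ext_Qp_def by blast
  have zero: "0 \<in> K" and diff: "\<And>x y. x \<in> K \<Longrightarrow> y \<in> K \<Longrightarrow> x - y \<in> K" and mult: "\<And>x y. x \<in> K \<Longrightarrow> y \<in> K \<Longrightarrow> x * y \<in> K"
    using K(1) by (auto simp: is_subfield_def)
  have add: "x + y \<in> K" if "x \<in> K" "y \<in> K" for x y
    using diff[OF that(1) diff[OF zero that(2)]] by simp
  have sum: "sum f A \<in> K" if "\<And>a. a \<in> A \<Longrightarrow> f a \<in> K" for f :: "'a \<Rightarrow> 'a" and A
    using that by (induction A rule: infinite_finite_induct) (auto intro: zero add)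
  have "Qspan B \<subseteq> K" using B(2) K(2) by (auto simp: Qspan_def intro!: sum mult)
  moreover have "K \<subseteq> Qspan B" using B(3) by (auto simp: Qspan_def)
  ultimately show ?thesis using vclosed_Qspan[OF B(1)] by (metis subset_antisym)
qed

section \<open>Polynomials with integral coefficients modulo elements of positive valuation\<close>

lemma coeff_synthetic_div_nonneg:
  assumes "\<And>i. 0 \<le> v (coeff f i)" "0 \<le> v s"
  shows "0 \<le> v (poly f s)" "0 \<le> v (coeff (synthetic_div f s) i)"
proof -
  have "0 \<le> v (poly f s) \<and> (\<forall>i. 0 \<le> v (coeff (synthetic_div f s) i))"
    using assms(1)
  proof (induction f)
    case (pCons a f)
    have a: "0 \<le> v a" using pCons.prems[of 0] by simp
    have "0 \<le> v (coeff f i)" for i using pCons.prems[of "Suc i"] by simp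
    then have IH: "0 \<le> v (poly f s)" "\<And>i. 0 \<le> v (coeff (synthetic_div f s) i)" using pCons.IH by auto
    have "0 \<le> v (a + s * poly f s)" using a IH assms(2) by (intro v_ge_add v_nonneg_mult)
    moreover have "0 \<le> v (coeff (pCons (poly f s) (synthetic_div f s)) i)" for i
      using IH by (simp add: coeff_pCons split: nat.split)
    ultimately show ?case by simp
  qed simp
  then show "0 \<le> v (poly f s)" "0 \<le> v (coeff (synthetic_div f s) i)" by auto
qed

lemma v_pos_add: "0 < v x \<Longrightarrow> 0 < v y \<Longrightarrow> 0 < v (x + y)"
  using v_add[of x y] by (metis less_le_trans min_less_iff_conj)

lemma v_pos_diff: "0 < v x \<Longrightarrow> 0 < v y \<Longrightarrow> 0 < v (x - y)"
  using v_pos_add[of x "- y"] by simp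

lemma v_pos_mult: "0 < v x \<Longrightarrow> 0 \<le> v y \<Longrightarrow> 0 < v (x * y)"
  using v_ge_mult_nonneg[of "v x" x y] by (simp add: less_le_trans)

text \<open>The bound on the number of roots, read modulo positive valuation: synthetic division at
  s lowers the degree, and t - s is a unit for every other point t of \<open>S\<close>.\<close>

lemma poly_vanishing_mod:
  assumes "finite S" "\<And>s. s \<in> S \<Longrightarrow> 0 \<le> v s" "\<And>s t. s \<in> S \<Longrightarrow> t \<in> S \<Longrightarrow> s \<noteq> t \<Longrightarrow> v (s - t) = 0"
    and "\<And>i. 0 \<le> v (coeff f i)" "\<And>s. s \<in> S \<Longrightarrow> 0 < v (poly f s)" "degree f < card S"
  shows "0 < v (coeff f i)"
  using assms
proof (induction S arbitrary: f i rule: finite_induct)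
  case (insert s S)
  define g where "g = synthetic_div f s"
  have f: "f = [:-s, 1:] * g + [:poly f s:]" unfolding g_def by (rule synthetic_div_correct'[symmetric])
  have fs: "0 < v (poly f s)" and s: "0 \<le> v s" using insert.prems by auto
  show ?case
  proof (cases "degree f = 0")
    case True
    then obtain c where "f = [:c:]" by (rule degree_eq_zeroE)
    then show ?thesis using fs by (cases i) auto
  next
    case False
    have g: "0 < v (coeff g i)" for i
    proof (rule insert.IH)
      fix t assume t: "t \<in> S"
      then have ts: "v (t - s) = 0" using insert by (intro insert.prems) auto
      have "poly f t - poly f s = (t - s) * poly g t"
        using arg_cong[OF f, of "\<lambda>p. poly p t"] by (simp add: algebra_simps)
      then have "v (poly f t - poly f s) = v (poly g t)" by (simp add: v_mult ts)
      then show "0 < v (poly g t)" using v_pos_diff[OF insert.prems(4)[of t] fs] t by simp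
    next
      show "0 \<le> v (coeff g i)" for i
        unfolding g_def using insert.prems s by (intro coeff_synthetic_div_nonneg)
      show "degree g < card S"
        unfolding g_def degree_synthetic_div using insert.prems(5) insert.hyps False by simp
    qed (use insert.prems in auto)
    have "coeff f i = (if i = 0 then poly f s else coeff g (i - 1)) - s * coeff g i"
      by (subst f) (simp add: coeff_pCons split: nat.split)
    moreover have "0 < v (s * coeff g i)" using v_pos_mult[OF g s] by (simp add: mult.commute)
    ultimately show ?thesis using v_pos_diff g fs by simp
  qed
qed simp

end

section \<open>The residue field\<close>

text \<open>As infinite sets have cardinality 0, q >= 2 includes finiteness of the residue field;
  \<open>residue_card_ge_2\<close> derives it from the existence of a Lubin-Tate series.\<close>

locale p_adic_field = valued_field v for v :: "'a::field_char_0 \<Rightarrow> ereal" +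
  fixes p :: nat and K :: "'a set" and \<pi> :: 'a and q :: nat
  assumes vp: "v (of_nat p) = 1" and ext: "finite_ext_Qp v K" and unif: "uniformiser v K \<pi>"
    and q_def: "q = card (residue_field v K)" and q_ge_2: "q \<ge> 2"
begin

abbreviation "R \<equiv> val_ring v K"

lemma subfield_K: "is_subfield K"
  using ext by (simp add: finite_ext_Qp_def)

lemma K_inverse: "x \<in> K \<Longrightarrow> inverse x \<in> K"
  using subfield_K by (simp add: is_subfield_def)

lemma subring_K: "subring K"
proof -
  have zero: "0 \<in> K" and diff: "x - y \<in> K" if "x \<in> K" "y \<in> K" for x y
    using subfield_K that by (auto simp: is_subfield_def)
  have minus: "- x \<in> K" if "x \<in> K" for x
    using diff[OF zero[OF that that] that] by simp
  have "x + y \<in> K" if "x \<in> K" "y \<in> K" for x y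
    using diff[OF that(1) minus[OF that(2)]] by simp
  then show ?thesis
    using subfield_K minus by (auto simp: subring_def is_subfield_def)
qed

lemma subring_R: "subring R"
  using subring_K by (auto simp: subring_def val_ring_def intro: v_ge_add v_nonneg_mult)

lemma \<pi>_R: "\<pi> \<in> R" and max_ideal_eq: "max_ideal v K = pmult \<pi> R"
  using unif by (auto simp: uniformiser_def pmult_def)

lemma pos_in_ideal: "x \<in> K \<Longrightarrow> 0 < v x \<Longrightarrow> x \<in> pmult \<pi> R"
  using max_ideal_eq by (auto simp: max_ideal_def)

lemma \<pi>_pos: "0 < v \<pi>"
proof -
  have "\<pi> * 1 \<in> pmult \<pi> R" by (rule pmultI[OF subring_1[OF subring_R]])
  then show ?thesis using max_ideal_eq by (auto simp: max_ideal_def)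
qed

text \<open>p is a nonzero element of the maximal ideal.\<close>

lemma \<pi>_nonzero: "\<pi> \<noteq> 0"
proof
  assume "\<pi> = 0"
  have "(of_nat p :: 'a) \<in> K" by (rule subring_of_nat[OF subring_K])
  then have "(of_nat p :: 'a) \<in> pmult \<pi> R" using vp by (intro pos_in_ideal) auto
  then have "(of_nat p :: 'a) = 0" using \<open>\<pi> = 0\<close> by (auto simp: pmult_def)
  then show False using vp by simp
qed

lemma residue_representatives:
  obtains S where "S \<subseteq> R" "finite S" "card S = q"
    "\<And>s t. s \<in> S \<Longrightarrow> t \<in> S \<Longrightarrow> s \<noteq> t \<Longrightarrow> v (s - t) = 0"
    "\<And>x. x \<in> R \<Longrightarrow> \<exists>s\<in>S. 0 < v (x - s)"
proof -
  define r where "r = {(x, y). x \<in> R \<and> y \<in> R \<and> x - y \<in> max_ideal v K}"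
  have K_diff: "x - y \<in> K" if "x \<in> R" "y \<in> R" for x y
    using subring_diff[OF subring_K] that by (auto simp: val_ring_def)
  have r_iff: "(x, y) \<in> r \<longleftrightarrow> x \<in> R \<and> y \<in> R \<and> 0 < v (x - y)" for x y
    using K_diff by (auto simp: r_def max_ideal_def)
  have equiv: "equiv R r"
  proof (rule equivI)
    show "r \<subseteq> R \<times> R" "refl_on R r" by (auto simp: r_iff refl_on_def)
    show "sym r" by (auto simp: r_iff sym_def v_diff_commute)
    have "0 < v (x - z)" if "0 < v (x - y)" "0 < v (y - z)" for x y z
      using v_pos_add[OF that] by simp
    then show "trans r" unfolding trans_def r_iff by blast
  qed
  have quot: "residue_field v K = R // r" by (simp add: residue_field_def r_def)
  define f where "f = (\<lambda>X. SOME x. x \<in> (X :: 'a set))"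
  have f: "f X \<in> X" if "X \<in> R // r" for X
    using in_quotient_imp_non_empty[OF equiv that] unfolding f_def by (auto intro: someI_ex)
  have fR: "f X \<in> R" if "X \<in> R // r" for X
    using f[OF that] in_quotient_imp_subset[OF equiv that] by auto
  have f_rel: "X = Y" if "X \<in> R // r" "Y \<in> R // r" "(f X, f Y) \<in> r" for X Y
    using quotient_eqI[OF equiv that(1,2) f[OF that(1)] f[OF that(2)] that(3)] .
  have inj: "inj_on f (R // r)"
  proof (rule inj_onI)
    fix X Y assume XY: "X \<in> R // r" "Y \<in> R // r" "f X = f Y"
    then have "(f X, f Y) \<in> r" using fR[OF XY(1)] by (simp add: r_iff)
    then show "X = Y" using f_rel XY by blast
  qed
  have "card (R // r) = q" using q_def quot by simp
  moreover from this have "finite (R // r)" using q_ge_2 by (intro card_ge_0_finite) simp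
  ultimately have S: "finite (f ` (R // r))" "card (f ` (R // r)) = q"
    using card_image[OF inj] by auto
  show ?thesis
  proof (rule that[of "f ` (R // r)"])
    show "f ` (R // r) \<subseteq> R" using fR by auto
    show "v (s - t) = 0" if st: "s \<in> f ` (R // r)" "t \<in> f ` (R // r)" "s \<noteq> t" for s t
    proof -
      have "(s, t) \<notin> r" using st f_rel by auto
      moreover have "s \<in> R" "t \<in> R" using st fR by auto
      moreover have "0 \<le> v (s - t)" using calculation(2,3) by (auto simp: val_ring_def intro: v_ge_diff)
      ultimately show ?thesis by (auto simp: r_iff)
    qed
    show "\<exists>s\<in>f ` (R // r). 0 < v (x - s)" if x: "x \<in> R" for x
    proof -
      have X: "r `` {x} \<in> R // r" using x by (rule quotientI)
      have "f (r `` {x}) \<in> r `` {x}" by (rule f[OF X])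
      then have "0 < v (x - f (r `` {x}))" by (simp add: r_iff)
      then show ?thesis using X by blast
    qed
  qed (use S in auto)
qed

lemma prod_cong_mod:
  assumes "finite I" "\<And>i. i \<in> I \<Longrightarrow> 0 \<le> v (x i)" "\<And>i. i \<in> I \<Longrightarrow> 0 \<le> v (y i)"
    "\<And>i. i \<in> I \<Longrightarrow> 0 < v (x i - y i)"
  shows "0 \<le> v (prod x I) \<and> 0 < v (prod x I - prod y I)"
  using assms
proof (induction I rule: finite_induct)
  case (insert i I)
  then have IH: "0 \<le> v (prod x I)" "0 < v (prod x I - prod y I)" by auto
  have "0 < v ((x i - y i) * prod x I)"
    using insert.prems IH by (intro v_pos_mult) auto
  moreover have "0 < v ((prod x I - prod y I) * y i)"
    using insert.prems IH by (intro v_pos_mult) auto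
  ultimately have "0 < v ((x i - y i) * prod x I + (prod x I - prod y I) * y i)" by (rule v_pos_add)
  then have "0 < v (x i * prod x I - y i * prod y I)" by (simp add: algebra_simps)
  then show ?case using insert IH by (auto intro: v_nonneg_mult)
qed simp

text \<open>For a unit a, multiplication by a permutes the nonzero residue classes; comparing
  products of representatives gives a^(q - 1) = 1 modulo the maximal ideal.\<close>

lemma residue_fermat:
  assumes a: "a \<in> R"
  shows "0 < v (a ^ q - a)"
proof (cases "0 < v a")
  case True
  obtain k where "q = Suc k" using q_ge_2 by (cases q) auto
  then have "0 < v (a ^ q)" using True by (simp add: v_pos_mult v_nonneg_power)
  then show ?thesis using True by (rule v_pos_diff)
next
  case False
  then have va: "v a = 0" using a by (auto simp: val_ring_def)
  obtain S where S: "S \<subseteq> R" "finite S" "card S = q"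
    "\<And>s t. s \<in> S \<Longrightarrow> t \<in> S \<Longrightarrow> s \<noteq> t \<Longrightarrow> v (s - t) = 0"
    "\<And>x. x \<in> R \<Longrightarrow> \<exists>s\<in>S. 0 < v (x - s)"
    using residue_representatives by metis
  have eqI: "s = t" if "s \<in> S" "t \<in> S" "0 < v (s - t)" for s t
    using S(4)[OF that(1,2)] that(3) by fastforce
  \<comment> \<open>\<open>s0\<close> represents the class of 0 and is left out of the
    product.\<close>
  obtain s0 where s0: "s0 \<in> S" "0 < v s0"
    using S(5)[OF subring_0[OF subring_R]] by auto
  define S' where "S' = S - {s0}"
  have S': "s \<in> R" "v s = 0" if "s \<in> S'" for s
  proof -
    have s: "s \<in> S" "s \<noteq> s0" using that by (auto simp: S'_def)
    then have "v (s - s0) = 0" using S(4) s0 by blast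
    show "s \<in> R" using s S(1) by auto
    have "\<not> 0 < v s" using v_pos_diff[OF _ s0(2), of s] \<open>v (s - s0) = 0\<close> by auto
    then show "v s = 0" using \<open>s \<in> R\<close> by (auto simp: val_ring_def)
  qed
  have "\<forall>s. \<exists>t. s \<in> S' \<longrightarrow> t \<in> S \<and> 0 < v (a * s - t)"
    using S(5) subring_mult[OF subring_R a] S'(1) by blast
  then obtain g where g: "\<And>s. s \<in> S' \<Longrightarrow> g s \<in> S" "\<And>s. s \<in> S' \<Longrightarrow> 0 < v (a * s - g s)" by metis
  have gS': "g s \<in> S'" if s: "s \<in> S'" for s
  proof -
    have "g s \<noteq> s0"
    proof
      assume "g s = s0"
      then have "0 < v (a * s)" using v_pos_add[OF g(2)[OF s] s0(2)] by simp
      then show False using S'(2)[OF s] va by (simp add: v_mult)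
    qed
    then show ?thesis using g(1)[OF s] by (simp add: S'_def)
  qed
  have inj: "inj_on g S'"
  proof (rule inj_onI)
    fix s t assume st: "s \<in> S'" "t \<in> S'" "g s = g t"
    have "0 < v ((a * s - g s) - (a * t - g t))" by (rule v_pos_diff[OF g(2)[OF st(1)] g(2)[OF st(2)]])
    also have "(a * s - g s) - (a * t - g t) = a * (s - t)" using st(3) by (simp add: algebra_simps)
    finally have "0 < v (s - t)" by (simp add: v_mult va)
    then show "s = t" using st by (intro eqI) (auto simp: S'_def)
  qed
  have finS': "finite S'" and cardS': "card S' = q - 1"
    using S(2,3) s0(1) by (auto simp: S'_def)
  have "g ` S' = S'"
    using inj finS' gS' by (intro endo_inj_surj) auto
  then have perm: "prod g S' = \<Prod>S'"
    using prod.reindex[OF inj, of id] by simp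
  have "0 < v ((\<Prod>s\<in>S'. a * s) - prod g S')"
    using prod_cong_mod[OF finS', of "\<lambda>s. a * s" g] S' gS' g(2) va
    by (auto simp: v_mult val_ring_def)
  also have "(\<Prod>s\<in>S'. a * s) - prod g S' = (a ^ (q - 1) - 1) * \<Prod>S'"
    by (simp add: perm prod.distrib cardS' algebra_simps)
  finally have pos: "0 < v ((a ^ (q - 1) - 1) * \<Prod>S')" .
  have "v (prod h I) = 0" if "finite I" "\<And>i. i \<in> I \<Longrightarrow> v (h i) = 0" for h :: "'a \<Rightarrow> 'a" and I
    using that by (induction I rule: finite_induct) (auto simp: v_mult)
  then have "v (\<Prod>S') = 0" using finS' S'(2) by simp
  then have "0 < v (a ^ (q - 1) - 1)" using pos by (simp add: v_mult)
  then have "0 < v ((a ^ (q - 1) - 1) * a)" by (rule v_pos_mult) (simp add: va)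
  also have "(a ^ (q - 1) - 1) * a = a ^ q - a"
    using q_ge_2 by (cases q) (auto simp: algebra_simps)
  finally show ?thesis .
qed

lemma fermat: "a \<in> R \<Longrightarrow> a ^ q - a \<in> pmult \<pi> R"
proof (rule pos_in_ideal)
  assume a: "a \<in> R"
  then have "a \<in> K" by (simp add: val_ring_def)
  then show "a ^ q - a \<in> K" by (intro subring_diff subring_power subring_K)
qed (rule residue_fermat)

text \<open>\<open>(X + 1)^q - X^q - 1\<close> has degree less than \<open>q\<close> and vanishes on all \<open>q\<close> residue classes.\<close>

lemma binomial_in_ideal:
  assumes i: "0 < i" "i < q"
  shows "of_nat (q choose i) \<in> pmult \<pi> R"
proof (rule pos_in_ideal)
  show "(of_nat (q choose i) :: 'a) \<in> K" by (rule subring_of_nat[OF subring_K])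
  obtain S where S: "S \<subseteq> R" "finite S" "card S = q"
    "\<And>s t. s \<in> S \<Longrightarrow> t \<in> S \<Longrightarrow> s \<noteq> t \<Longrightarrow> v (s - t) = 0"
    using residue_representatives by metis
  define f :: "'a poly" where "f = [:1, 1:] ^ q - monom 1 q - 1"
  have f_coeff: "coeff f j = (if 0 < j \<and> j < q then of_nat (q choose j) else 0)" for j
  proof (cases "j \<le> q")
    case True
    then show ?thesis
      using q_ge_2 by (auto simp: f_def coeff_linear_poly_power)
  next
    case False
    have "degree ([:1, 1:] ^ q :: 'a poly) = q" by (simp add: degree_power_eq)
    then have "coeff ([:1, 1:] ^ q :: 'a poly) j = 0" using False by (intro coeff_eq_0) simp
    then show ?thesis using False by (auto simp: f_def)
  qed
  have nat_nonneg: "0 \<le> v (of_nat k)" for k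
    using subring_of_nat[OF subring_V, of k] by (simp add: V_def)
  have "degree f < q"
  proof -
    have "degree f \<le> q - 1" by (rule degree_le) (auto simp: f_coeff)
    then show ?thesis using q_ge_2 by simp
  qed
  moreover have "0 < v (poly f s)" if "s \<in> S" for s
  proof -
    have s: "s \<in> R" using that S(1) by auto
    then have s1: "1 + s \<in> R" by (intro subring_add subring_1 subring_R)
    have "0 < v (((1 + s) ^ q - (1 + s)) - (s ^ q - s))"
      by (intro v_pos_diff residue_fermat s s1)
    then show ?thesis by (simp add: f_def poly_monom poly_power algebra_simps)
  qed
  ultimately have "0 < v (coeff f i)"
    using S nat_nonneg by (intro poly_vanishing_mod[of S]) (auto simp: f_coeff val_ring_def)
  then show "0 < v (of_nat (q choose i))" using i by (simp add: f_coeff)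
qed

lemma v_one_minus: "0 < v x \<Longrightarrow> v (1 - x) = 0"
  using v_eq_of_close[of 1 "1 - x"] by simp

text \<open>From here on the formal theory applies to the valuation ring of K.\<close>

sublocale lubin_tate_valued R \<pi> q v
proof unfold_locales
  show "frob_ring R \<pi> q"
    using subring_R \<pi>_R q_ge_2 binomial_in_ideal by (simp add: frob_ring_def)
  fix a assume a: "a \<in> R"
  show "a ^ q - a \<in> pmult \<pi> R" by (rule fermat[OF a])
  have "0 < v (\<pi> * a)" using a \<pi>_pos by (intro v_pos_mult) (auto simp: val_ring_def)
  then have v1: "v (1 - \<pi> * a) = 0" by (rule v_one_minus)
  then show nz: "1 - \<pi> * a \<noteq> 0" by auto
  have "1 - \<pi> * a \<in> R"
    by (intro subring_diff subring_mult subring_R subring_1 \<pi>_R a)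
  then show "inverse (1 - \<pi> * a) \<in> R"
    using nz v1 K_inverse by (simp add: val_ring_def v_inverse)
qed (auto simp: \<pi>_nonzero \<pi>_pos val_ring_def V_def)

text \<open>Construction of the Teichmueller lift: the powers s^(q^j) are Cauchy because each
  further q-th power improves Fermat's congruence by a factor \<pi>.\<close>

lemma frobenius_powers_converge:
  assumes s: "s \<in> R"
  obtains t where "t \<in> K" "t ^ q = t" "0 < v (t - s)"
proof -
  define a where "a = (\<lambda>j. s ^ (q ^ j))"
  have aR: "a j \<in> R" for j unfolding a_def by (intro subring_power subring_R s)
  have a_Suc: "a (Suc j) = a j ^ q" for j by (simp add: a_def power_mult[symmetric] mult.commute)
  have step: "a (Suc j) - a j \<in> pmult (\<pi> ^ Suc j) R" for j
  proof (induction j)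
    case 0
    show ?case using fermat[OF s] by (simp add: a_def)
  next
    case (Suc j)
    have "a (Suc j) ^ q - a j ^ q \<in> pmult (\<pi> ^ Suc (Suc j)) R"
      using Suc by (intro frobenius_cong[OF frob_ring] aR) auto
    then show ?case by (simp only: a_Suc[symmetric])
  qed
  obtain \<delta> where \<delta>: "\<delta> > 0" "ereal \<delta> \<le> v \<pi>" using v_pos_real[OF \<pi>_pos] by blast
  have v_step: "ereal (real (Suc j) * \<delta>) \<le> v (a (Suc j) - a j)" for j
  proof -
    obtain w where w: "w \<in> R" "a (Suc j) - a j = \<pi> ^ Suc j * w" using step by (rule pmultE)
    then show ?thesis
      unfolding w(2) using v_ge_mult_nonneg[OF v_ge_power[OF \<delta>(2)]] by (simp only: val_ring_def) blast
  qed
  have v_diff: "ereal (real (Suc j) * \<delta>) \<le> v (a (j + k) - a j)" for j k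
  proof (induction k)
    case (Suc k)
    have "real (Suc j) * \<delta> \<le> real (Suc (j + k)) * \<delta>" using \<delta>(1) by (intro mult_right_mono) auto
    then have "ereal (real (Suc j) * \<delta>) \<le> v (a (Suc (j + k)) - a (j + k))"
      using v_step[of "j + k"] by (meson ereal_less_eq(3) order_trans)
    then show ?case using v_ge_trans[OF _ Suc, of "a (Suc (j + k))"] by simp
  qed simp
  have tail: "ereal (real (Suc j) * \<delta>) \<le> v (a k - a j)" if "k \<ge> j" for j k
    using v_diff[of j "k - j"] that by simp
  have "val_Cauchy v a"
    unfolding val_Cauchy_def
  proof
    fix C :: real
    obtain N :: nat where "C / \<delta> < real N" using reals_Archimedean2 by blast
    then have N: "C < real (Suc N) * \<delta>"
      using \<delta>(1) by (simp add: pos_divide_less_eq algebra_simps)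
    have "ereal C < v (a m - a n)" if "m \<ge> N" "n \<ge> N" for m n
    proof -
      have "ereal (real (Suc N) * \<delta>) \<le> v (a m - a n)"
        using v_ge_trans[OF tail[OF that(1)], of "a n"] tail[OF that(2)] v_diff_commute[of "a N"] by simp
      moreover have "ereal C < ereal (real (Suc N) * \<delta>)" using N by simp
      ultimately show ?thesis by (rule less_le_trans[rotated])
    qed
    then show "\<exists>N. \<forall>m\<ge>N. \<forall>n\<ge>N. ereal C < v (a m - a n)" by blast
  qed
  then obtain t where t: "val_tendsto v a t" using complete by blast
  have "t \<in> K"
    using vclosedD[OF finite_ext_closed[OF ext] _ t] aR by (auto simp: val_ring_def)
  moreover have close: "\<exists>N. \<forall>n\<ge>N. ereal C \<le> v (a n - t)" for C using t by (simp add: val_tendsto_iff)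
  have "0 < v (t - s)"
  proof -
    obtain N where N: "ereal \<delta> \<le> v (a N - t)" using close[of \<delta>] by blast
    have "ereal \<delta> \<le> v (a N - s)" using tail[of 0 N] by (simp add: a_def)
    then have "ereal \<delta> \<le> v (t - s)" using v_ge_trans[of "ereal \<delta>" t "a N" s] N v_diff_commute[of t] by simp
    moreover have "0 < ereal \<delta>" using \<delta>(1) by simp
    ultimately show ?thesis by (rule less_le_trans[rotated])
  qed
  \<comment> \<open>\<open>a (Suc N)\<close> is close to t and, being \<open>a N ^ q\<close>, also
    to t^q.\<close>
  moreover have "t ^ q = t"
  proof (rule v_zeroI)
    fix C
    obtain N where N: "\<forall>n\<ge>N. ereal C \<le> v (a n - t)" using close by blast
    have s_nonneg: "0 \<le> v s" using s by (simp add: val_ring_def)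
    have "0 \<le> v (t - s + s)" using \<open>0 < v (t - s)\<close> s_nonneg by (intro v_ge_add) auto
    then have tV: "t \<in> V" by (simp add: V_def)
    have aV: "a N \<in> V" using aR[of N] by (simp add: V_def val_ring_def)
    have "(\<Sum>i<q. t ^ (q - Suc i) * a N ^ i) \<in> V"
      by (intro subring_sum subring_mult subring_power subring_V tV aV)
    moreover have "a N ^ q - t ^ q = (a N - t) * (\<Sum>i<q. t ^ (q - Suc i) * a N ^ i)"
      by (rule power_diff_sumr2)
    ultimately have "ereal C \<le> v (a (Suc N) - t ^ q)"
      using N v_ge_mult_nonneg[of "ereal C" "a N - t"] by (simp add: a_Suc V_def)
    moreover have "ereal C \<le> v (a (Suc N) - t)" using N by simp
    ultimately show "ereal C \<le> v (t ^ q - t)"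
      using v_ge_trans[of "ereal C" "t ^ q" "a (Suc N)" t] v_diff_commute[of "t ^ q"] by simp
  qed
  ultimately show ?thesis by (blast intro: that)
qed

text \<open>The Teichmueller lifts of the \<open>q\<close> residue classes lie in \<open>K\<close> because \<open>K\<close> is closed; they
  already exhaust the at most \<open>q\<close> roots of \<open>X^q - X\<close>.\<close>

lemma root_of_unity_in_ring:
  assumes z: "z ^ q = z"
  shows "z \<in> R"
proof -
  obtain S where S: "S \<subseteq> R" "finite S" "card S = q"
    "\<And>s t. s \<in> S \<Longrightarrow> t \<in> S \<Longrightarrow> s \<noteq> t \<Longrightarrow> v (s - t) = 0"
    using residue_representatives by metis
  have "\<forall>s. \<exists>t. s \<in> S \<longrightarrow> t \<in> K \<and> t ^ q = t \<and> 0 < v (t - s)"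
    using frobenius_powers_converge S(1) by (metis subsetD)
  then obtain \<tau> where \<tau>: "\<And>s. s \<in> S \<Longrightarrow> \<tau> s \<in> K" "\<And>s. s \<in> S \<Longrightarrow> \<tau> s ^ q = \<tau> s"
      "\<And>s. s \<in> S \<Longrightarrow> 0 < v (\<tau> s - s)" by metis
  have inj: "inj_on \<tau> S"
  proof (rule inj_onI, rule ccontr)
    fix s t assume st: "s \<in> S" "t \<in> S" "\<tau> s = \<tau> t" "s \<noteq> t"
    have "0 < v ((\<tau> t - t) - (\<tau> s - s))" by (rule v_pos_diff[OF \<tau>(3)[OF st(2)] \<tau>(3)[OF st(1)]])
    then show False using S(4)[OF st(1,2,4)] st(3) by simp
  qed
  define f :: "'a poly" where "f = monom 1 q - monom 1 1"
  have f_q: "coeff f q = 1" using q_ge_2 by (simp add: f_def)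
  then have f0: "f \<noteq> 0" by auto
  have deg: "degree f \<le> q"
    using q_ge_2 by (intro degree_le) (auto simp: f_def)
  have roots: "{x. poly f x = 0} = {x. x ^ q = x}" by (auto simp: f_def poly_monom)
  have "card {x :: 'a. x ^ q = x} \<le> q"
    using card_poly_roots_bound[OF f0] deg roots by simp
  moreover have "finite {x :: 'a. x ^ q = x}" using poly_roots_finite[OF f0] roots by simp
  moreover have "\<tau> ` S \<subseteq> {x. x ^ q = x}" using \<tau>(2) by auto
  moreover have "card (\<tau> ` S) = q" using card_image[OF inj] S(3) by simp
  ultimately have "\<tau> ` S = {x. x ^ q = x}"
    by (intro card_subset_eq) (auto intro: antisym card_mono)
  then obtain s where s: "s \<in> S" "z = \<tau> s" using z by auto
  have "0 \<le> v (\<tau> s - s + s)"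
    using \<tau>(3)[OF s(1)] S(1) s(1) by (intro v_ge_add) (auto simp: val_ring_def)
  then show ?thesis using s \<tau>(1) by (simp add: val_ring_def)
qed

end

section \<open>Change of the uniformiser\<close>

context p_adic_field
begin

lemma ideal_pow_max_ideal:
  "x \<in> ideal_pow R (max_ideal v K) k \<Longrightarrow> x \<in> pmult (\<pi> ^ k) R"
proof (induction k arbitrary: x)
  case 0
  then show ?case by (simp add: pmult_def)
next
  case (Suc k)
  from Suc.prems have "x \<in> ideal_mult (max_ideal v K) (ideal_pow R (max_ideal v K) k)" by simp
  then show ?case
  proof (induction x rule: ideal_mult.induct)
    case zero
    show ?case by (rule pmult_0[OF subring_R])
  next
    case (add_prod x a b)
    obtain a' where a': "a' \<in> R" "a = \<pi> * a'"
      using add_prod.hyps(2) unfolding max_ideal_eq by (rule pmultE)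
    obtain b' where b': "b' \<in> R" "b = \<pi> ^ k * b'"
      using Suc.IH[OF add_prod.hyps(3)] by (rule pmultE)
    have "a * b = \<pi> ^ Suc k * (a' * b')" by (simp add: a' b')
    also have "\<dots> \<in> pmult (\<pi> ^ Suc k) R"
      by (intro pmultI subring_mult[OF subring_R] a' b')
    finally show ?case using add_prod.IH by (intro pmult_add[OF subring_R])
  qed
qed

lemma lubin_tate_series_nth:
  assumes "lubin_tate_series v K \<pi>' P"
  shows "P \<in> fps_over R" "P $ 0 = 0" "P $ 1 = \<pi>'" "P - fps_X ^ q \<in> pmult (fps_const \<pi>') (fps_over R)"
proof -
  obtain S where "P - fps_const \<pi>' * fps_X = fps_X ^ 2 * S"
    using assms by (auto simp: lubin_tate_series_def)
  then have P: "P = fps_const \<pi>' * fps_X + fps_X ^ 2 * S" by (simp add: algebra_simps)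
  show "P $ 0 = 0" "P $ 1 = \<pi>'"
    unfolding P by (simp_all add: fps_X_power_mult_nth)
  show "P \<in> fps_over R" using assms by (simp add: lubin_tate_series_def)
  show "P - fps_X ^ q \<in> pmult (fps_const \<pi>') (fps_over R)"
    using assms by (auto simp: lubin_tate_series_def q_def pmult_def)
qed

lemma lt_seriesI:
  assumes "lubin_tate_series v K \<pi> P"
  shows "lt_series P"
  using lubin_tate_series_nth[OF assms]
  by (simp add: lt_series_def frob_series_def fps_over_pmult)

lemma lt_formal_group_eq:
  assumes P: "lt_series P"
  shows "lt_formal_group v K P = FG P"
  unfolding lt_formal_group_def
proof (rule the_equality)
  show "comm_formal_group R (FG P) \<and>
      subst1 P (subst2 (FG P) varX varY) = subst2 (FG P) (subst1 P varX) (subst1 P varY)"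
    using FG_formal_group[OF P] FG_commutes[OF P] by blast
  show "F = FG P" if "comm_formal_group R F \<and>
      subst1 P (subst2 F varX varY) = subst2 F (subst1 P varX) (subst1 P varY)" for F
    using that by (intro FG_unique[OF P]) (auto simp: comm_formal_group_def)
qed

lemma fg_exp_eq:
  assumes P: "lt_series P"
  shows "fg_exp K (FG P) = exp P"
  unfolding fg_exp_def
proof (rule the_equality)
  have "exp P \<in> fps_over K"
    by (rule exp_over[OF subring_K K_inverse _ P]) (auto simp: val_ring_def)
  then show "exp P \<in> fps_over K \<and> exp P $ 0 = 0 \<and> exp P $ 1 = 1 \<and>
      subst1 (exp P) (varX + varY) = subst2 (FG P) (subst1 (exp P) varX) (subst1 (exp P) varY)"
    using exp_homomorphism by simp
  show "e = exp P" if "e \<in> fps_over K \<and> e $ 0 = 0 \<and> e $ 1 = 1 \<and>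
      subst1 e (varX + varY) = subst2 (FG P) (subst1 e varX) (subst1 e varY)" for e
    using that by (intro exp_unique) auto
qed

lemma lt_mult_eq:
  assumes P: "lt_series P" and a: "a \<in> R"
  shows "lt_mult v K P a = lt_hom P P a"
  unfolding lt_mult_def
proof (rule the_equality)
  have "P oo lt_hom P P a = lt_hom P P a oo P"
    using lt_hom_compose[of P P \<pi> P a] lt_eq_lt_hom[OF P] lt_hom_compose_lt[OF P, of P a] by (simp add: mult.commute)
  then show "lt_hom P P a \<in> fps_over R \<and> lt_hom P P a $ 0 = 0 \<and> lt_hom P P a $ 1 = a \<and> P oo lt_hom P P a = lt_hom P P a oo P"
    using lt_hom_integral[OF P P a] by simp
  show "A = lt_hom P P a" if "A \<in> fps_over R \<and> A $ 0 = 0 \<and> A $ 1 = a \<and> P oo A = A oo P" for A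
    using that by (intro lt_mult_unique[OF P]) auto
qed

text \<open>Only indices m - i >= 1 occur, so the two families may differ at 0, where the convention
  \<omega> 0 = 0 is imposed.\<close>

lemma E_series_eq:
  assumes "lt_series P" "\<And>i. 1 \<le> i \<Longrightarrow> \<omega> i = \<omega>' i"
  shows "E_series v K \<pi> P \<omega> m = Eser P \<omega>' m"
proof -
  have "(\<Sum>i<m. fps_const (\<omega> (m - i) / \<pi> ^ i) * (fps_X ^ (q ^ i) - fps_X ^ (q ^ (i + 1)))) =
      (\<Sum>i<m. fps_const (\<omega>' (m - i) / \<pi> ^ i) * (fps_X ^ (q ^ i) - fps_X ^ (q ^ (i + 1))))"
    using assms(2) by (intro sum.cong refl) simp
  then show ?thesis
    by (simp only: E_series_def Eser_def Let_def q_def[symmetric] lt_formal_group_eq[OF assms(1)] fg_exp_eq[OF assms(1)])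
qed

lemma fps_iter_nth:
  assumes "Q $ 0 = 0"
  shows "fps_iter Q i $ 0 = 0" "fps_iter Q i $ 1 = (Q $ 1) ^ i"
proof -
  have "fps_iter Q i $ 0 = 0 \<and> fps_iter Q i $ 1 = (Q $ 1) ^ i"
    using assms by (induction i) (auto simp: fps_compose_nth)
  then show "fps_iter Q i $ 0 = 0" "fps_iter Q i $ 1 = (Q $ 1) ^ i" by auto
qed

lemma fps_iter_in: "Q \<in> fps_over R \<Longrightarrow> fps_iter Q i \<in> fps_over R"
  by (induction i) (auto intro: fps_over_X fps_over_compose subring_R)

text \<open>Replaces the parameter \<open>\<pi>'\<close> of \<open>Q\<close> by \<open>\<pi>\<close>: the correction term vanishes at
  \<open>\<omega>\<^sub>1, \<dots>, \<omega>\<^sub>n\<close>, and it is divisible by \<open>\<pi>\<close> since \<open>\<pi> \<equiv> \<pi>'\<close> modulo \<open>\<pi>^(n+1)\<close>.\<close>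

lemma change_of_parameter:
  assumes unif': "uniformiser v K \<pi>'"
    and cong: "\<pi> - \<pi>' \<in> ideal_pow R (max_ideal v K) (n + 1)"
    and Q: "lubin_tate_series v K \<pi>' Q"
    and \<omega>_0: "\<omega> 0 = 0" and \<omega>_pos: "\<And>m. 0 < v (\<omega> m)" and \<omega>_Suc: "\<And>m. fps_value v Q (\<omega> (Suc m)) = \<omega> m"
  obtains Q' where "lt_series Q'" "\<And>m. m < n \<Longrightarrow> fps_value v Q' (\<omega> (Suc m)) = \<omega> m"
proof -
  \<comment> \<open>The roles of the uniformisers are exchanged in order to divide \<pi> by
    \<pi>'.\<close>
  interpret other: p_adic_field v p K \<pi>' q
    using vp ext unif' q_def q_ge_2 by unfold_locales
  note Q' = lubin_tate_series_nth[OF Q]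
  obtain u where u: "u \<in> R" "\<pi>' = \<pi> * u"
    using pos_in_ideal[of \<pi>'] other.\<pi>_pos other.\<pi>_R by (auto simp: val_ring_def elim: pmultE)
  obtain u' where u': "u' \<in> R" "\<pi> = \<pi>' * u'"
    using other.pos_in_ideal[of \<pi>] \<pi>_pos \<pi>_R by (auto simp: val_ring_def elim: pmultE)
  obtain c where c: "c \<in> R" "\<pi> - \<pi>' = \<pi> ^ (n + 1) * c"
    using ideal_pow_max_ideal[OF cong] by (rule pmultE)
  \<comment> \<open>This is (\<pi> - \<pi>') / \<pi>'^n in a form that shows divisibility by \<pi>:
    insert \<pi> - \<pi>' = \<pi>^(n + 1) c and \<pi> = \<pi>' u'. Since the n-th iterate of Q has
    linear coefficient \<pi>'^n, the correction turns the linear coefficient \<pi>' of Q into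
    \<pi>.\<close>
  define k where "k = \<pi> * (u' ^ n * c)"
  have k: "k \<in> pmult \<pi> R"
    unfolding k_def by (intro pmultI subring_mult subring_power subring_R u' c)
  have k_eq: "k * \<pi>' ^ n = \<pi> - \<pi>'"
  proof -
    have "\<pi> ^ n = \<pi>' ^ n * u' ^ n" by (subst u'(2)) (rule power_mult_distrib)
    then show ?thesis by (simp add: k_def c(2))
  qed
  define D where "D = fps_const k * fps_iter Q n"
  have iter: "fps_iter Q i \<in> fps_over R" for i by (rule fps_iter_in[OF Q'(1)])
  have D: "D \<in> pmult (fps_const \<pi>) (fps_over R)"
  proof -
    have "fps_const k = fps_const \<pi> * fps_const (u' ^ n * c)" by (simp add: k_def)
    then have "D = fps_const \<pi> * (fps_const (u' ^ n * c) * fps_iter Q n)"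
      by (simp only: D_def mult.assoc)
    then show ?thesis
      using u'(1) c(1) by (auto intro!: pmultI subring_mult subring_fps_over subring_power subring_R fps_over_const iter)
  qed
  have "fps_const \<pi>' * S \<in> pmult (fps_const \<pi>) (fps_over R)" if "S \<in> fps_over R" for S
  proof -
    have eq: "fps_const \<pi>' * S = fps_const \<pi> * (fps_const u * S)"
      by (simp add: u(2) mult.assoc[symmetric])
    have "fps_const u * S \<in> fps_over R"
      by (intro subring_mult subring_fps_over subring_R fps_over_const u(1) that)
    then show ?thesis unfolding eq by (rule pmultI)
  qed
  then have QX: "Q - fps_X ^ q \<in> pmult (fps_const \<pi>) (fps_over R)"
    using Q'(4) by (auto elim!: pmultE)
  have "lt_series (Q + D)"
    unfolding lt_series_def frob_series_def fps_over_pmult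
  proof (intro conjI)
    have "D \<in> fps_over R"
      by (rule pmult_subset[OF R1 _ D]) (intro fps_over_const subring_R \<pi>_R)
    then show "Q + D \<in> fps_over R" using Q'(1) by (intro subring_add R1)
    show "(Q + D) $ 0 = 0" "(Q + D) $ 1 = \<pi>"
      using Q'(2,3) fps_iter_nth[OF Q'(2), of n] k_eq by (simp_all add: D_def)
    have "(Q - fps_X ^ q) + D \<in> pmult (fps_const \<pi>) (fps_over R)"
      by (rule pmult_add[OF R1 QX D])
    then show "Q + D - fps_X ^ q \<in> pmult (fps_const \<pi>) (fps_over R)" by (simp add: algebra_simps)
  qed
  moreover have "fps_value v (Q + D) (\<omega> (Suc m)) = \<omega> m" if m: "m < n" for m
  proof -
    have ev_iter: "ev (\<omega> l) (fps_iter Q i) = \<omega> (l - i)" for l i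
    proof (induction i arbitrary: l)
      case (Suc i)
      have "ev (\<omega> l) Q = \<omega> (l - 1)"
        using \<omega>_Suc[of "l - 1"] \<omega>_0 Q'(2) by (cases l) auto
      then have "ev (\<omega> l) (fps_iter Q (Suc i)) = ev (\<omega> (l - 1)) (fps_iter Q i)"
        using ev_compose[OF R1_V[OF iter] R1_V[OF Q'(1)] Q'(2) \<omega>_pos[of l], of i] by simp
      then show ?case using Suc by simp
    qed simp
    have conv: "conv (\<omega> (Suc m)) Q" "conv (\<omega> (Suc m)) (fps_iter Q n)"
      using \<omega>_pos by (auto intro!: conv_integral R1_V Q'(1) iter)
    have "ev (\<omega> (Suc m)) D = k * \<omega> (Suc m - n)"
      unfolding D_def using conv by (simp add: ev_mult conv_const ev_iter)
    \<comment> \<open>As m < n, the natural number \<open>Suc m - n\<close> is 0, and \<omega> 0 =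
      0.\<close>
    then have "ev (\<omega> (Suc m)) D = 0" using m \<omega>_0 by (simp add: Suc_leI)
    moreover have "conv (\<omega> (Suc m)) D" unfolding D_def by (intro conv_mult conv_const conv)
    ultimately show ?thesis
      using hom_on_add[OF conv_hom, of Q "\<omega> (Suc m)" D] conv \<omega>_Suc[of m] by simp
  qed
  ultimately show ?thesis by (rule that)
qed

end

text \<open>If q were 0 (which covers an infinite residue field) or 1, comparing the coefficient of
  index q in the congruence of P with X^q modulo \<pi> would make \<pi> a unit.\<close>

lemma (in valued_field) residue_card_ge_2:
  assumes \<pi>: "0 < v \<pi>" and P: "lubin_tate_series v K \<pi> P"
  shows "card (residue_field v K) \<ge> 2"
proof (rule ccontr)
  let ?q = "card (residue_field v K)"
  assume "\<not> 2 \<le> ?q"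
  then consider "?q = 0" | "?q = 1" by linarith
  note q_cases = this
  have unit: False if "0 \<le> v r" "\<pi> * r = 1" for r
    using v_pos_mult[OF \<pi> that(1)] that(2) by simp
  obtain S where "P - fps_const \<pi> * fps_X = fps_X ^ 2 * S" using P by (auto simp: lubin_tate_series_def)
  then have "P = fps_const \<pi> * fps_X + fps_X ^ 2 * S" by (simp add: algebra_simps)
  then have P_nth: "P $ 0 = 0" "P $ 1 = \<pi>" by (simp_all add: fps_X_power_mult_nth)
  obtain T where T: "\<And>n. 0 \<le> v (T $ n)" "P - fps_X ^ ?q = fps_const \<pi> * T"
    using P by (auto simp: lubin_tate_series_def fps_over_def val_ring_def)
  from q_cases show False
  proof cases
    case 1
    have "- 1 = \<pi> * T $ 0"
      using arg_cong[OF T(2), of "\<lambda>f. f $ 0"] P_nth unfolding 1 by simp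
    then have "\<pi> * - (T $ 0) = 1"
      by (metis add.inverse_inverse mult_minus_right)
    then show False using T(1)[of 0] by (intro unit[of "- (T $ 0)"]) auto
  next
    case 2
    have "\<pi> - 1 = \<pi> * T $ 1"
      using arg_cong[OF T(2), of "\<lambda>f. f $ 1"] P_nth unfolding 2 by simp
    then have "\<pi> * (1 - T $ 1) = 1"
      by (simp add: algebra_simps)
    then show False using T(1)[of 1] by (intro unit[of "1 - T $ 1"] v_ge_diff) auto
  qed
qed

theorem proposition2:
  fixes v :: "'c::field_char_0 \<Rightarrow> ereal" and K :: "'c set"
    and p q n :: nat and \<pi> \<pi>' :: 'c and P Q :: "'c fps" and \<omega> z :: "nat \<Rightarrow> 'c"
  assumes "prime p" and "is_Cp p v"
    and "finite_ext_Qp v K" and "q = card (residue_field v K)"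
    and "n \<ge> 1"
    and "uniformiser v K \<pi>" and "uniformiser v K \<pi>'"
    and "\<pi> - \<pi>' \<in> ideal_pow (val_ring v K) (max_ideal v K) (n + 1)"
    and "lubin_tate_series v K \<pi> P" and "lubin_tate_series v K \<pi>' Q"
    and "coherent_roots v Q \<omega>"
    and "\<forall>i<n. z i \<in> mu v (q - 1) \<union> {0}" and "z 0 \<noteq> 0"
  shows "fps_value v (lt_mult v K P (\<Sum>i<n. z i * \<pi> ^ i)) (fps_value v (E_series v K \<pi> P \<omega> n) 1)
       = foldl (fps2_value v (lt_formal_group v K P))
           (fps_value v (E_series v K \<pi> P \<omega> n) (z 0))
           (map (\<lambda>i. fps_value v (E_series v K \<pi> P \<omega> (n - i)) (z i)) [1..<n])"
proof -
  interpret valued_field v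
    using \<open>is_Cp p v\<close> by unfold_locales (auto simp: is_Cp_def)
  have "0 < v \<pi>"
  proof -
    have "1 \<in> val_ring v K"
      using \<open>finite_ext_Qp v K\<close> by (simp add: finite_ext_Qp_def is_subfield_def val_ring_def)
    then have "\<pi> * 1 \<in> max_ideal v K"
      using \<open>uniformiser v K \<pi>\<close> unfolding uniformiser_def by blast
    then show ?thesis by (simp add: max_ideal_def)
  qed
  then have "q \<ge> 2"
    using residue_card_ge_2 assms(4,9) by blast
  interpret p_adic_field v p K \<pi> q
    using assms(2-4,6) \<open>q \<ge> 2\<close> by unfold_locales (auto simp: is_Cp_def)
  have P: "lt_series P" using assms(9) by (rule lt_seriesI)
  \<comment> \<open>\<open>coherent_roots\<close> leaves \<omega> 0 free; the value 0 turns
    Q(\<omega> 1) = 0 into an instance of the recursion.\<close>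
  define W where "W = (\<lambda>i. if i = 0 then 0 else \<omega> i)"
  have W_0: "W 0 = 0" and W_pos: "0 < v (W m)" and W_Suc: "fps_value v Q (W (Suc m)) = W m" for m
    using assms(11) by (auto simp: W_def coherent_roots_def)
  obtain Q' where Q': "lt_series Q'" "\<And>m. m < n \<Longrightarrow> fps_value v Q' (W (Suc m)) = W m"
    using change_of_parameter[OF assms(7,8,10) W_0 W_pos W_Suc] by blast
  \<comment> \<open>The equation z^q = z treats roots of unity and 0 alike.\<close>
  have z_root: "z i ^ q = z i" if "i < n" for i
  proof -
    have "z i ^ (q - 1) = 1 \<or> z i = 0" using assms(12) that by (auto simp: mu_def)
    moreover have "z i ^ q = z i ^ (q - 1) * z i" using q_ge_2 by (cases q) auto
    ultimately show ?thesis using q_ge_2 by auto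
  qed
  then have z_R: "z i \<in> R" if "i < n" for i
    using root_of_unity_in_ring that by blast
  have a_R: "(\<Sum>i<n. z i * \<pi> ^ i) \<in> R"
    using z_R by (intro subring_sum subring_mult subring_power subring_R \<pi>_R) auto
  have E: "E_series v K \<pi> P \<omega> m = Eser P W m" for m
    using P by (rule E_series_eq) (simp add: W_def)
  show ?thesis
    unfolding E lt_mult_eq[OF P a_R] lt_formal_group_eq[OF P]
    using value_identity[OF Q'(1) W_0 W_pos Q'(2) P \<open>n \<ge> 1\<close> z_R z_root] .
qed

end
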